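(* Let $G$ be a group. If Moore's conjecture holds for every finitely generated subgroup of $G$, then Moore's conjecture holds for $G$.
   Context: All rings have a unit element $1$. For a group $\Gamma$ and a ring $R$, a strongly graded ring $R(\Gamma)$ over $R$ is a ring with an additive decomposition $R(\Gamma)=\bigoplus_{\gamma\in\Gamma}R_\gamma$ such that $R_\gamma R_\tau=R_{\gamma\tau}$ for all $\gamma,\tau\in\Gamma$ and $R_e=R$. For a subgroup $U\le\Gamma$, $R(U)=\bigoplus_{\gamma\in U}R_\gamma$ denotes the corresponding subring. Let $H$ be a subgroup of finite index of $\Gamma$. Moore's condition holds for the triple $(\Gamma,H,R)$ if for every nontrivial element $x\in\Gamma$ at least one of the following holds: (M1) $\langle x\rangle\cap H\neq\{e\}$; (M2) $\mathrm{ord}(x)$ is finite and invertible in $R$. Moore's conjecture holds for the triple $(\Gamma,H,R)$ if Moore's condition for $(\Gamma,H,R)$ implies that, for every strongly graded ring $R(\Gamma)$ over $R$, every $R(\Gamma)$-module $M$ which is projective over $R(H)$ is projective over $R(\Gamma)$. Moore's conjecture holds for the group $\Gamma$ if it holds for $(\Gamma,H,R)$ for every ring $R$ and every subgroup $H$ of finite index in $\Gamma$. *)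

theory Defs
  imports "HOL-Algebra.Algebra"
begin

section \<open>Modules over noncommutative rings\<close>

text \<open>
  The library's \<open>module\<close> locale requires a commutative ring. We keep its record type
  and its axioms, and drop commutativity. All modules are unital left modules.
\<close>

locale left_module = R?: ring R + M?: abelian_group M
  for R :: "('r, 'x) ring_scheme" (structure) and M :: "('r, 'm, 'y) module_scheme" (structure) +
  assumes smult_closed [simp, intro]:
      "\<lbrakk>a \<in> carrier R; x \<in> carrier M\<rbrakk> \<Longrightarrow> a \<odot>\<^bsub>M\<^esub> x \<in> carrier M"
    and smult_l_distr:
      "\<lbrakk>a \<in> carrier R; b \<in> carrier R; x \<in> carrier M\<rbrakk>
        \<Longrightarrow> (a \<oplus> b) \<odot>\<^bsub>M\<^esub> x = a \<odot>\<^bsub>M\<^esub> x \<oplus>\<^bsub>M\<^esub> b \<odot>\<^bsub>M\<^esub> x"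
    and smult_r_distr:
      "\<lbrakk>a \<in> carrier R; x \<in> carrier M; y \<in> carrier M\<rbrakk>
        \<Longrightarrow> a \<odot>\<^bsub>M\<^esub> (x \<oplus>\<^bsub>M\<^esub> y) = a \<odot>\<^bsub>M\<^esub> x \<oplus>\<^bsub>M\<^esub> a \<odot>\<^bsub>M\<^esub> y"
    and smult_assoc1:
      "\<lbrakk>a \<in> carrier R; b \<in> carrier R; x \<in> carrier M\<rbrakk>
        \<Longrightarrow> (a \<otimes> b) \<odot>\<^bsub>M\<^esub> x = a \<odot>\<^bsub>M\<^esub> (b \<odot>\<^bsub>M\<^esub> x)"
    and smult_one [simp]:
      "x \<in> carrier M \<Longrightarrow> \<one> \<odot>\<^bsub>M\<^esub> x = x"

definition left_module_hom ::
    "('r, 'x) ring_scheme \<Rightarrow> ('r, 'm, 'y) module_scheme \<Rightarrow> ('r, 'n, 'z) module_scheme \<Rightarrow> ('m \<Rightarrow> 'n) set"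
  where "left_module_hom R M N =
    {h \<in> carrier M \<rightarrow> carrier N.
      (\<forall>x \<in> carrier M. \<forall>y \<in> carrier M. h (x \<oplus>\<^bsub>M\<^esub> y) = h x \<oplus>\<^bsub>N\<^esub> h y) \<and>
      (\<forall>r \<in> carrier R. \<forall>x \<in> carrier M. h (r \<odot>\<^bsub>M\<^esub> x) = r \<odot>\<^bsub>N\<^esub> h x)}"

text \<open>
  A definition cannot quantify over types, so the lifting property is required only for test
  modules whose underlying types are \<^typ>\<open>'m \<Rightarrow> 'r\<close> (large enough for the free module on the
  elements of \<open>P\<close>) and \<^typ>\<open>'m\<close>. This is no restriction: by \<open>projective_module_lift\<close> below,
  a module that is projective in this sense has the lifting property for test modules of
  arbitrary types.
\<close>

definition projective_module :: "('r, 'x) ring_scheme \<Rightarrow> ('r, 'm) module \<Rightarrow> bool"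
  where "projective_module R P \<longleftrightarrow> left_module R P \<and>
    (\<forall>(A :: ('r, 'm \<Rightarrow> 'r) module) (B :: ('r, 'm) module) f g.
      left_module R A \<longrightarrow> left_module R B \<longrightarrow>
      f \<in> left_module_hom R A B \<longrightarrow> f ` carrier A = carrier B \<longrightarrow>
      g \<in> left_module_hom R P B \<longrightarrow>
      (\<exists>h \<in> left_module_hom R P A. \<forall>x \<in> carrier P. f (h x) = g x))"


subsection \<open>Independence of the types of the test modules\<close>

definition free_left_module :: "('r, 'x) ring_scheme \<Rightarrow> 'i set \<Rightarrow> ('r, 'i \<Rightarrow> 'r) module"
  where "free_left_module R J =
    module.make
      {c. (\<forall>i. c i \<in> carrier R) \<and> (\<forall>i. i \<notin> J \<longrightarrow> c i = \<zero>\<^bsub>R\<^esub>) \<and> finite {i. c i \<noteq> \<zero>\<^bsub>R\<^esub>}}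
      undefined undefined
      (\<lambda>_. \<zero>\<^bsub>R\<^esub>) (\<lambda>c d i. c i \<oplus>\<^bsub>R\<^esub> d i) (\<lambda>r c i. r \<otimes>\<^bsub>R\<^esub> c i)"

definition free_left_module_lift ::
    "('r, 'x) ring_scheme \<Rightarrow> ('r, 'm, 'y) module_scheme \<Rightarrow> ('i \<Rightarrow> 'm) \<Rightarrow> ('i \<Rightarrow> 'r) \<Rightarrow> 'm"
  where "free_left_module_lift R M a c = finsum M (\<lambda>i. c i \<odot>\<^bsub>M\<^esub> a i) {i. c i \<noteq> \<zero>\<^bsub>R\<^esub>}"

lemma (in ring) left_module_free:
  fixes J :: "'i set"
  shows "left_module R (free_left_module R J)"
proof -
  have fin_add: "finite {i. c i \<oplus> d i \<noteq> \<zero>}"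
    if "finite {i. c i \<noteq> \<zero>}" "finite {i. d i \<noteq> \<zero>}" for c d :: "'i \<Rightarrow> 'a"
    by (rule finite_subset[of _ "{i. c i \<noteq> \<zero>} \<union> {i. d i \<noteq> \<zero>}"]) (use that in auto)
  have fin_smult: "finite {i. r \<otimes> c i \<noteq> \<zero>}"
    if "finite {i. c i \<noteq> \<zero>}" "r \<in> carrier R" for r and c :: "'i \<Rightarrow> 'a"
    by (rule finite_subset[of _ "{i. c i \<noteq> \<zero>}"]) (use that in auto)
  have inv: "\<exists>y\<in>carrier (free_left_module R J). y \<oplus>\<^bsub>free_left_module R J\<^esub> x = \<zero>\<^bsub>free_left_module R J\<^esub>"
    if "x \<in> carrier (free_left_module R J)" for x
  proof
    have "finite {i. \<ominus> x i \<noteq> \<zero>}"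
      by (rule finite_subset[of _ "{i. x i \<noteq> \<zero>}"]) (use that in \<open>auto simp: free_left_module_def module.defs\<close>)
    with that show "(\<lambda>i. \<ominus> x i) \<in> carrier (free_left_module R J)"
      by (auto simp: free_left_module_def module.defs)
    show "(\<lambda>i. \<ominus> x i) \<oplus>\<^bsub>free_left_module R J\<^esub> x = \<zero>\<^bsub>free_left_module R J\<^esub>"
      using that by (auto simp: free_left_module_def module.defs l_neg)
  qed
  have ab: "abelian_group (free_left_module R J)"
    by (rule abelian_groupI[OF _ _ _ _ _ inv])
       (auto simp: free_left_module_def module.defs fin_add a_assoc intro: a_comm)
  show ?thesis
    by (intro left_module.intro left_module_axioms.intro ab)
       (auto simp: free_left_module_def module.defs fin_smult l_distr r_distr m_assoc ring_axioms)
qed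

lemma (in left_module) zero_smult:
  assumes "x \<in> carrier M" shows "\<zero> \<odot>\<^bsub>M\<^esub> x = \<zero>\<^bsub>M\<^esub>"
proof -
  have "\<zero> \<odot>\<^bsub>M\<^esub> x \<oplus>\<^bsub>M\<^esub> \<zero> \<odot>\<^bsub>M\<^esub> x = \<zero> \<odot>\<^bsub>M\<^esub> x"
    using smult_l_distr[of \<zero> \<zero> x] assms by simp
  then show ?thesis
    using assms by (metis M.add.l_cancel_one' R.zero_closed smult_closed)
qed

lemma (in left_module) smult_zero:
  assumes "r \<in> carrier R" shows "r \<odot>\<^bsub>M\<^esub> \<zero>\<^bsub>M\<^esub> = \<zero>\<^bsub>M\<^esub>"
proof -
  have "r \<odot>\<^bsub>M\<^esub> \<zero>\<^bsub>M\<^esub> \<oplus>\<^bsub>M\<^esub> r \<odot>\<^bsub>M\<^esub> \<zero>\<^bsub>M\<^esub> = r \<odot>\<^bsub>M\<^esub> \<zero>\<^bsub>M\<^esub>"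
    using smult_r_distr[of r "\<zero>\<^bsub>M\<^esub>" "\<zero>\<^bsub>M\<^esub>"] assms by simp
  then show ?thesis
    using assms by (metis M.add.l_cancel_one' M.zero_closed smult_closed)
qed

lemma (in left_module) smult_finsum:
  assumes "finite T" "r \<in> carrier R" "u \<in> T \<rightarrow> carrier M"
  shows "r \<odot>\<^bsub>M\<^esub> finsum M u T = finsum M (\<lambda>i. r \<odot>\<^bsub>M\<^esub> u i) T"
  using assms(1,3)
proof (induction T rule: finite_induct)
  case empty
  show ?case using assms by (simp add: smult_zero)
next
  case (insert i T)
  then have "u \<in> T \<rightarrow> carrier M" "u i \<in> carrier M" by auto
  moreover from this have "(\<lambda>i. r \<odot>\<^bsub>M\<^esub> u i) \<in> T \<rightarrow> carrier M" using assms by auto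
  ultimately show ?case using insert assms by (simp add: smult_r_distr)
qed

lemma (in left_module) free_left_module_lift_hom:
  assumes a: "a \<in> J \<rightarrow> carrier M"
  shows "free_left_module_lift R M a \<in> left_module_hom R (free_left_module R J) M"
proof -
  let ?L = "free_left_module_lift R M a"
  let ?F = "free_left_module R J"
  have mem: "c i \<odot>\<^bsub>M\<^esub> a i \<in> carrier M" if "c \<in> carrier ?F" "i \<in> J" for c i
    using that a by (auto simp: free_left_module_def module.defs)
  have sup: "{i. c i \<noteq> \<zero>} \<subseteq> J" "finite {i. c i \<noteq> \<zero>}" if "c \<in> carrier ?F" for c
    using that by (auto simp: free_left_module_def module.defs)
  have eq: "?L c = finsum M (\<lambda>i. c i \<odot>\<^bsub>M\<^esub> a i) T"
    if "c \<in> carrier ?F" "finite T" "T \<subseteq> J" "{i. c i \<noteq> \<zero>} \<subseteq> T" for c T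
    unfolding free_left_module_lift_def
    by (rule M.add.finprod_mono_neutral_cong_left)
       (use that a mem in \<open>auto intro!: zero_smult\<close>)
  interpret F: left_module R ?F by (rule R.left_module_free)
  show ?thesis
    unfolding left_module_hom_def
  proof (intro CollectI conjI ballI funcsetI)
    fix c assume c: "c \<in> carrier ?F"
    show "?L c \<in> carrier M"
      unfolding free_left_module_lift_def
      by (rule M.finsum_closed) (use mem c sup[OF c] in auto)
  next
    fix c d assume c: "c \<in> carrier ?F" and d: "d \<in> carrier ?F"
    let ?T = "{i. c i \<noteq> \<zero>} \<union> {i. d i \<noteq> \<zero>}"
    have T: "finite ?T" "?T \<subseteq> J" using sup[OF c] sup[OF d] by auto
    have cd: "c \<oplus>\<^bsub>?F\<^esub> d \<in> carrier ?F" using c d by simp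
    have add: "(c \<oplus>\<^bsub>?F\<^esub> d) i = c i \<oplus> d i" for i by (simp add: free_left_module_def module.defs)
    have cl: "c i \<in> carrier R" "d i \<in> carrier R" for i
      using c d by (auto simp: free_left_module_def module.defs)
    have "?L (c \<oplus>\<^bsub>?F\<^esub> d) = finsum M (\<lambda>i. (c \<oplus>\<^bsub>?F\<^esub> d) i \<odot>\<^bsub>M\<^esub> a i) ?T"
      by (rule eq[OF cd T]) (auto simp: add)
    also have "\<dots> = finsum M (\<lambda>i. c i \<odot>\<^bsub>M\<^esub> a i \<oplus>\<^bsub>M\<^esub> d i \<odot>\<^bsub>M\<^esub> a i) ?T"
      by (rule M.finsum_cong') (use a T cl in \<open>auto simp: add smult_l_distr Pi_iff subset_eq\<close>)
    also have "\<dots> = finsum M (\<lambda>i. c i \<odot>\<^bsub>M\<^esub> a i) ?T \<oplus>\<^bsub>M\<^esub> finsum M (\<lambda>i. d i \<odot>\<^bsub>M\<^esub> a i) ?T"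
      by (rule M.finsum_addf) (use mem c d T in auto)
    also have "\<dots> = ?L c \<oplus>\<^bsub>M\<^esub> ?L d"
      using eq[OF c T] eq[OF d T] by simp
    finally show "?L (c \<oplus>\<^bsub>?F\<^esub> d) = ?L c \<oplus>\<^bsub>M\<^esub> ?L d" .
  next
    fix r c assume r: "r \<in> carrier R" and c: "c \<in> carrier ?F"
    let ?T = "{i. c i \<noteq> \<zero>}"
    have T: "finite ?T" "?T \<subseteq> J" using sup[OF c] by auto
    have rc: "r \<odot>\<^bsub>?F\<^esub> c \<in> carrier ?F" using r c by simp
    have cl: "c i \<in> carrier R" for i using c by (auto simp: free_left_module_def module.defs)
    have "?L (r \<odot>\<^bsub>?F\<^esub> c) = finsum M (\<lambda>i. (r \<odot>\<^bsub>?F\<^esub> c) i \<odot>\<^bsub>M\<^esub> a i) ?T"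
      by (rule eq[OF rc T]) (use r in \<open>auto simp: free_left_module_def module.defs\<close>)
    also have "\<dots> = finsum M (\<lambda>i. r \<odot>\<^bsub>M\<^esub> (c i \<odot>\<^bsub>M\<^esub> a i)) ?T"
      by (rule M.finsum_cong')
         (use a T cl r in \<open>auto simp: free_left_module_def module.defs smult_assoc1 Pi_iff subset_eq\<close>)
    also have "\<dots> = r \<odot>\<^bsub>M\<^esub> ?L c"
      unfolding free_left_module_lift_def
      by (rule smult_finsum[symmetric]) (use T r mem c in auto)
    finally show "?L (r \<odot>\<^bsub>?F\<^esub> c) = r \<odot>\<^bsub>M\<^esub> ?L c" .
  qed
qed

lemma (in left_module) free_left_module_lift_basis:
  assumes x: "x \<in> J" and a: "a \<in> J \<rightarrow> carrier M"
  defines "e \<equiv> \<lambda>i. if i = x then \<one> else \<zero>"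
  shows "e \<in> carrier (free_left_module R J)" "free_left_module_lift R M a e = a x"
proof -
  have sub: "{i. e i \<noteq> \<zero>} \<subseteq> {x}" by (auto simp: e_def)
  then have "finite {i. e i \<noteq> \<zero>}" by (rule finite_subset) simp
  then show "e \<in> carrier (free_left_module R J)"
    using x by (auto simp: free_left_module_def module.defs e_def)
  have ax: "a x \<in> carrier M" using x a by auto
  have deg: "a x = \<zero>\<^bsub>M\<^esub>" if "\<one> = \<zero>"
    using that zero_smult[OF ax] smult_one[OF ax] by metis
  have "free_left_module_lift R M a e = finsum M (\<lambda>i. e i \<odot>\<^bsub>M\<^esub> a i) {x}"
    unfolding free_left_module_lift_def
    by (rule M.add.finprod_mono_neutral_cong_left)
       (use sub ax deg in \<open>auto simp: e_def\<close>)
  also have "\<dots> = a x"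
    using ax by (simp add: M.finsum_insert e_def)
  finally show "free_left_module_lift R M a e = a x" .
qed

lemma free_left_module_lift_comp:
  assumes "left_module R M" "left_module R N" and h: "h \<in> left_module_hom R M N"
    and a: "a \<in> J \<rightarrow> carrier M" and c: "c \<in> carrier (free_left_module R J)"
  shows "h (free_left_module_lift R M a c) = free_left_module_lift R N (\<lambda>i. h (a i)) c"
proof -
  interpret M: left_module R M by fact
  interpret N: left_module R N by fact
  have hc: "\<And>x. x \<in> carrier M \<Longrightarrow> h x \<in> carrier N"
    and ha: "\<And>x y. x \<in> carrier M \<Longrightarrow> y \<in> carrier M \<Longrightarrow> h (x \<oplus>\<^bsub>M\<^esub> y) = h x \<oplus>\<^bsub>N\<^esub> h y"
    and hs: "\<And>r x. r \<in> carrier R \<Longrightarrow> x \<in> carrier M \<Longrightarrow> h (r \<odot>\<^bsub>M\<^esub> x) = r \<odot>\<^bsub>N\<^esub> h x"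
    using h by (auto simp: left_module_hom_def)
  have h0: "h \<zero>\<^bsub>M\<^esub> = \<zero>\<^bsub>N\<^esub>"
    using hs[of "\<zero>\<^bsub>R\<^esub>" "\<zero>\<^bsub>M\<^esub>"] by (simp add: M.zero_smult N.zero_smult hc)
  have cl: "\<And>i. c i \<in> carrier R" and sup: "{i. c i \<noteq> \<zero>\<^bsub>R\<^esub>} \<subseteq> J" "finite {i. c i \<noteq> \<zero>\<^bsub>R\<^esub>}"
    using c by (auto simp: free_left_module_def module.defs)
  have "h (finsum M (\<lambda>i. c i \<odot>\<^bsub>M\<^esub> a i) T) = finsum N (\<lambda>i. c i \<odot>\<^bsub>N\<^esub> h (a i)) T"
    if "finite T" "T \<subseteq> J" for T
    using that
  proof (induction T rule: finite_induct)
    case empty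
    show ?case by (simp add: h0)
  next
    case (insert i T)
    have mem: "\<And>j. j \<in> J \<Longrightarrow> a j \<in> carrier M" using a by auto
    have 1: "(\<lambda>i. c i \<odot>\<^bsub>M\<^esub> a i) \<in> T \<rightarrow> carrier M" "c i \<odot>\<^bsub>M\<^esub> a i \<in> carrier M"
      "(\<lambda>i. c i \<odot>\<^bsub>N\<^esub> h (a i)) \<in> T \<rightarrow> carrier N" "c i \<odot>\<^bsub>N\<^esub> h (a i) \<in> carrier N"
      "a i \<in> carrier M"
      using insert.prems mem cl hc by auto
    then show ?case using insert cl by (simp add: ha hs M.M.finsum_closed)
  qed
  then show ?thesis using sup by (simp add: free_left_module_lift_def)
qed

theorem projective_module_lift:
  fixes R :: "('r, 'x) ring_scheme" and P :: "('r, 'm) module"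
    and A :: "('r, 'a, 'y) module_scheme" and B :: "('r, 'b, 'z) module_scheme"
  assumes P: "projective_module R P" and A: "left_module R A" and B: "left_module R B"
    and f: "f \<in> left_module_hom R A B" "f ` carrier A = carrier B"
    and g: "g \<in> left_module_hom R P B"
  shows "\<exists>h \<in> left_module_hom R P A. \<forall>x \<in> carrier P. f (h x) = g x"
proof -
  let ?J = "carrier P"
  let ?F = "free_left_module R ?J"
  interpret P: left_module R P using P by (simp add: projective_module_def)
  interpret A: left_module R A by fact
  interpret B: left_module R B by fact
  interpret F: left_module R ?F by (rule P.R.left_module_free)
  let ?p = "free_left_module_lift R P (\<lambda>x. x)"
  have p: "?p \<in> left_module_hom R ?F P"
    by (rule P.free_left_module_lift_hom) simp
  have surj: "?p ` carrier ?F = carrier P"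
  proof
    show "?p ` carrier ?F \<subseteq> carrier P" using p by (auto simp: left_module_hom_def)
    show "carrier P \<subseteq> ?p ` carrier ?F"
    proof
      fix x assume "x \<in> carrier P"
      from P.free_left_module_lift_basis[of x ?J "\<lambda>x. x", OF this] show "x \<in> ?p ` carrier ?F"
        by (metis (no_types, lifting) Pi_I imageI)
    qed
  qed
  have idP: "(\<lambda>x. x) \<in> left_module_hom R P P" by (simp add: left_module_hom_def)
  obtain s where s: "s \<in> left_module_hom R P ?F" "\<And>x. x \<in> carrier P \<Longrightarrow> ?p (s x) = x"
    using P F.left_module_axioms P.left_module_axioms p surj idP
    unfolding projective_module_def by metis
  have "\<forall>x \<in> carrier P. \<exists>y \<in> carrier A. f y = g x"
  proof
    fix x assume "x \<in> carrier P"
    then have "g x \<in> f ` carrier A" using f(2) g by (auto simp: left_module_hom_def)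
    then show "\<exists>y \<in> carrier A. f y = g x" by (auto simp: image_iff)
  qed
  then obtain a where a: "\<And>x. x \<in> carrier P \<Longrightarrow> a x \<in> carrier A \<and> f (a x) = g x" by metis
  let ?q = "free_left_module_lift R A a"
  have q: "?q \<in> left_module_hom R ?F A"
    by (rule A.free_left_module_lift_hom) (use a in auto)
  show ?thesis
  proof (intro bexI ballI)
    show "(\<lambda>x. ?q (s x)) \<in> left_module_hom R P A"
      using q s(1) by (simp add: left_module_hom_def Pi_iff)
    fix x assume x: "x \<in> carrier P"
    have sx: "s x \<in> carrier ?F" using s(1) x by (auto simp: left_module_hom_def)
    have sub: "{i. s x i \<noteq> \<zero>\<^bsub>R\<^esub>} \<subseteq> carrier P" and cl: "\<And>i. s x i \<in> carrier R"
      using sx by (auto simp: free_left_module_def module.defs)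
    have "f (?q (s x)) = free_left_module_lift R B (\<lambda>i. f (a i)) (s x)"
      by (rule free_left_module_lift_comp[OF A B f(1) _ sx]) (use a in auto)
    also have "\<dots> = free_left_module_lift R B g (s x)"
      unfolding free_left_module_lift_def
      by (rule B.M.finsum_cong')
         (use a sub cl g in \<open>auto simp: left_module_hom_def Pi_iff subset_eq\<close>)
    also have "\<dots> = g (?p (s x))"
      by (rule free_left_module_lift_comp[OF P.left_module_axioms B g _ sx, symmetric]) auto
    also have "\<dots> = g x" using s(2) x by simp
    finally show "f (?q (s x)) = g x" .
  qed
qed


section \<open>Strongly graded rings\<close>

text \<open>
  \<open>graded_part S A V\<close> is \<open>R(V)\<close>, the sum of the components \<open>A \<gamma>\<close> with \<open>\<gamma> \<in> V\<close>, as a subring of \<open>S\<close>.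
\<close>

definition graded_part :: "('r, 'x) ring_scheme \<Rightarrow> ('g \<Rightarrow> 'r set) \<Rightarrow> 'g set \<Rightarrow> ('r, 'x) ring_scheme"
  where "graded_part S A V =
    S\<lparr>carrier := {finsum S c F | c F. finite F \<and> F \<subseteq> V \<and> (\<forall>\<gamma> \<in> F. c \<gamma> \<in> A \<gamma>)}\<rparr>"

text \<open>
  \<open>S\<close> is a ring \<open>R(\<Gamma>)\<close> with components \<open>R\<^sub>\<gamma> = A \<gamma>\<close>. In \<open>strongly_graded\<close>, the library's
  \<open>\<cdot>\<close> (\<^const>\<open>ideal_prod\<close>) is used for additive subgroups that need not be ideals: it is the
  set of all finite sums of products. The last two assumptions say \<open>R\<^sub>e = R\<close> as rings.
\<close>

locale strongly_graded_ring = \<Gamma>: group \<Gamma> + R: ring R + S: ring S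
  for \<Gamma> :: "('g, 'x) monoid_scheme" and R :: "('r, 'y) ring_scheme"
    and S :: "('r, 'z) ring_scheme" and A :: "'g \<Rightarrow> 'r set" +
  assumes component_subgroup:
      "\<gamma> \<in> carrier \<Gamma> \<Longrightarrow> additive_subgroup (A \<gamma>) S"
    and components_span:
      "carrier (graded_part S A (carrier \<Gamma>)) = carrier S"
    and components_independent:
      "\<lbrakk>finite F; F \<subseteq> carrier \<Gamma>; \<And>\<gamma>. \<gamma> \<in> F \<Longrightarrow> c \<gamma> \<in> A \<gamma>; finsum S c F = \<zero>\<^bsub>S\<^esub>; \<gamma> \<in> F\<rbrakk>
        \<Longrightarrow> c \<gamma> = \<zero>\<^bsub>S\<^esub>"
    and strongly_graded:
      "\<lbrakk>\<gamma> \<in> carrier \<Gamma>; \<tau> \<in> carrier \<Gamma>\<rbrakk> \<Longrightarrow> A \<gamma> \<cdot>\<^bsub>S\<^esub> A \<tau> = A (\<gamma> \<otimes>\<^bsub>\<Gamma>\<^esub> \<tau>)"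
    and base_component: "A \<one>\<^bsub>\<Gamma>\<^esub> = carrier R"
    and base_operations: "(\<lambda>r. r) \<in> ring_hom R S"


section \<open>Moore's condition and Moore's conjecture\<close>

text \<open>
  \<^const>\<open>group.ord\<close> is \<open>0\<close> on elements of infinite order.
\<close>

definition moore_condition ::
    "('g, 'x) monoid_scheme \<Rightarrow> 'g set \<Rightarrow> ('r, 'y) ring_scheme \<Rightarrow> bool"
  where "moore_condition \<Gamma> H R \<longleftrightarrow>
    (\<forall>x \<in> carrier \<Gamma>. x \<noteq> \<one>\<^bsub>\<Gamma>\<^esub> \<longrightarrow>
      generate \<Gamma> {x} \<inter> H \<noteq> {\<one>\<^bsub>\<Gamma>\<^esub>} \<or>
      (group.ord \<Gamma> x \<noteq> 0 \<and> add_pow R (group.ord \<Gamma> x) \<one>\<^bsub>R\<^esub> \<in> Units R))"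

text \<open>
  As in \<open>projective_module\<close>, quantification over types is not available: the type \<^typ>\<open>'r\<close> of the elements of the
  rings and the type \<^typ>\<open>'m\<close> of the elements of the modules are parameters. Since \<open>R\<^sub>e = R\<close>, the rings
  \<open>R\<close> and \<open>R(\<Gamma>)\<close> share the type \<^typ>\<open>'r\<close>.
\<close>

definition moore_conjecture_for ::
    "'m itself \<Rightarrow> ('g, 'x) monoid_scheme \<Rightarrow> 'g set \<Rightarrow> 'r ring \<Rightarrow> bool"
  where "moore_conjecture_for TYPE('m) \<Gamma> H R \<longleftrightarrow>
    (moore_condition \<Gamma> H R \<longrightarrow>
      (\<forall>(S :: 'r ring) A (M :: ('r, 'm) module).
        strongly_graded_ring \<Gamma> R S A \<longrightarrow> left_module S M \<longrightarrow>
        projective_module (graded_part S A H) M \<longrightarrow> projective_module S M))"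

definition moore_conjecture ::
    "'r itself \<Rightarrow> 'm itself \<Rightarrow> ('g, 'x) monoid_scheme \<Rightarrow> bool"
  where "moore_conjecture TYPE('r) TYPE('m) \<Gamma> \<longleftrightarrow>
    (\<forall>(R :: 'r ring) H. ring R \<longrightarrow> subgroup H \<Gamma> \<longrightarrow> finite (rcosets\<^bsub>\<Gamma>\<^esub> H) \<longrightarrow>
      moore_conjecture_for TYPE('m) \<Gamma> H R)"

definition finitely_generated_subgroup :: "('g, 'x) monoid_scheme \<Rightarrow> 'g set \<Rightarrow> bool"
  where "finitely_generated_subgroup G K \<longleftrightarrow>
    (\<exists>E. finite E \<and> E \<subseteq> carrier G \<and> K = generate G E)"

end

theory Submission
  imports Defs "HOL-Library.Countable_Set"
begin

text \<open>
  Since \<open>H\<close> has finite index, \<open>R(\<Gamma>)\<close> is a Frobenius extension of \<open>R(H)\<close>: there are finitely many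
  homogeneous \<open>u\<^sub>t\<close>, \<open>v\<^sub>t\<close> such that, with \<open>e\<close> the projection onto \<open>R(H)\<close>, every \<open>r\<close> is the sum of the
  \<open>u\<^sub>t e(v\<^sub>t r)\<close> and of the \<open>e(r u\<^sub>t) v\<^sub>t\<close>. The trace \<open>m \<mapsto> \<Sum> u\<^sub>t \<phi>(v\<^sub>t m)\<close> makes an \<open>R(H)\<close>-linear map
  \<open>\<phi>\<close> into an \<open>R(\<Gamma>)\<close>-linear one, and the same formula works for every finitely generated subgroup \<open>K\<close>
  whose \<open>R(K)\<close> contains the \<open>u\<^sub>t\<close> and \<open>v\<^sub>t\<close>.
  A module \<open>M\<close> that is projective over \<open>R(H)\<close> is projective over \<open>R(K \<inter> H)\<close>, hence over \<open>R(K)\<close> by hypothesis.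
  If \<open>M\<close> has a countable dual basis over \<open>R(H)\<close>, only countably many elements of \<open>\<Gamma>\<close> occur in its
  structure constants, and lifts that are linear over an increasing chain of such \<open>R(K)\<close> are corrected, by
  means of traces, so that they become eventually constant on the basis; the limit is \<open>R(\<Gamma>)\<close>-linear.
  In general, a Kaplansky type argument and Zorn's lemma reduce to countable subquotients of \<open>M\<close>, which
  are again projective over \<open>R(H)\<close>.
\<close>

section \<open>Homomorphisms and dual bases\<close>

text \<open>Projectivity over each member of a chain of subrings gives a lift at each stage, but
  lifts chosen at different stages need not agree, and the difference \<open>d\<close> of two
  consecutive lifts is linear over one \<open>R(K)\<close> only. A correction must be linear over
  all of \<open>R(\<Gamma>)\<close>, take values in the kernel of the map along which one lifts, and
  agree with \<open>d\<close> on the part of the dual basis already treated. Higman's criterion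
  provides it: projectivity over \<open>R(K)\<close> makes the identity of \<open>M\<close> the
  trace of an \<open>R(K \<inter> H)\<close>-linear \<open>\<psi>\<close>, so \<open>d\<close> is
  the trace of \<open>d \<circ> \<psi>\<close>. Only the values of \<open>d \<circ> \<psi>\<close>
  on the dual basis are kept; they define an \<open>R(H)\<close>-linear map, whose trace is the
  correction. Corrections are made stage by stage along the natural numbers, hence the need for
  countability. The chain need not exhaust \<open>R(\<Gamma>)\<close>: an \<open>R(H)\<close>-linear
  map that respects multiplication by the \<open>v\<^sub>t\<close> on the dual basis is
  \<open>R(\<Gamma>)\<close>-linear, so it is enough that the chain absorbs the coefficients of the
  \<open>v\<^sub>t x\<^sub>i\<close>.\<close>

lemma left_module_homI:
  assumes "\<And>x. x \<in> carrier M \<Longrightarrow> h x \<in> carrier N"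
    and "\<And>x y. \<lbrakk>x \<in> carrier M; y \<in> carrier M\<rbrakk> \<Longrightarrow> h (x \<oplus>\<^bsub>M\<^esub> y) = h x \<oplus>\<^bsub>N\<^esub> h y"
    and "\<And>r x. \<lbrakk>r \<in> carrier R; x \<in> carrier M\<rbrakk> \<Longrightarrow> h (r \<odot>\<^bsub>M\<^esub> x) = r \<odot>\<^bsub>N\<^esub> h x"
  shows "h \<in> left_module_hom R M N"
  using assms by (auto simp: left_module_hom_def)

lemma left_module_hom_closed:
  "\<lbrakk>h \<in> left_module_hom R M N; x \<in> carrier M\<rbrakk> \<Longrightarrow> h x \<in> carrier N"
  by (auto simp: left_module_hom_def)

lemma left_module_hom_add:
  "\<lbrakk>h \<in> left_module_hom R M N; x \<in> carrier M; y \<in> carrier M\<rbrakk> \<Longrightarrow> h (x \<oplus>\<^bsub>M\<^esub> y) = h x \<oplus>\<^bsub>N\<^esub> h y"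
  by (auto simp: left_module_hom_def)

lemma left_module_hom_smult:
  "\<lbrakk>h \<in> left_module_hom R M N; r \<in> carrier R; x \<in> carrier M\<rbrakk> \<Longrightarrow> h (r \<odot>\<^bsub>M\<^esub> x) = r \<odot>\<^bsub>N\<^esub> h x"
  by (auto simp: left_module_hom_def)

lemma left_module_hom_zero:
  assumes "left_module R M" "left_module R N" and h: "h \<in> left_module_hom R M N"
  shows "h \<zero>\<^bsub>M\<^esub> = \<zero>\<^bsub>N\<^esub>"
proof -
  interpret M: left_module R M by fact
  interpret N: left_module R N by fact
  show ?thesis
    using left_module_hom_smult[OF h, of "\<zero>\<^bsub>R\<^esub>" "\<zero>\<^bsub>M\<^esub>"] left_module_hom_closed[OF h]
    by (simp add: M.zero_smult N.zero_smult)
qed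

lemma left_module_hom_minus:
  assumes "left_module R M" "left_module R N" and h: "h \<in> left_module_hom R M N"
    and x: "x \<in> carrier M" and y: "y \<in> carrier M"
  shows "h (x \<ominus>\<^bsub>M\<^esub> y) = h x \<ominus>\<^bsub>N\<^esub> h y"
proof -
  interpret M: left_module R M by fact
  interpret N: left_module R N by fact
  note cl = left_module_hom_closed[OF h]
  have "h (x \<ominus>\<^bsub>M\<^esub> y) \<oplus>\<^bsub>N\<^esub> h y = h ((x \<ominus>\<^bsub>M\<^esub> y) \<oplus>\<^bsub>M\<^esub> y)"
    using x y by (simp add: left_module_hom_add[OF h])
  also have "(x \<ominus>\<^bsub>M\<^esub> y) \<oplus>\<^bsub>M\<^esub> y = x"
    using x y by (simp add: M.M.minus_eq M.M.a_assoc M.M.l_neg)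
  finally have "h x = h (x \<ominus>\<^bsub>M\<^esub> y) \<oplus>\<^bsub>N\<^esub> h y" ..
  then show ?thesis
    using x y cl by (simp add: N.M.minus_eq N.M.a_assoc N.M.r_neg)
qed

lemma left_module_hom_finsum:
  assumes "left_module R M" "left_module R N" and h: "h \<in> left_module_hom R M N"
    and "finite F" "f \<in> F \<rightarrow> carrier M"
  shows "h (finsum M f F) = finsum N (\<lambda>i. h (f i)) F"
proof -
  interpret M: left_module R M by fact
  interpret N: left_module R N by fact
  show ?thesis
    using assms(4,5)
  proof (induction F rule: finite_induct)
    case empty
    show ?case by (simp add: left_module_hom_zero[OF assms(1-3)])
  next
    case (insert i F)
    then have "f \<in> F \<rightarrow> carrier M" "f i \<in> carrier M" by auto
    moreover from this have "(\<lambda>i. h (f i)) \<in> F \<rightarrow> carrier N" "h (f i) \<in> carrier N"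
      using left_module_hom_closed[OF h] by auto
    ultimately show ?case
      using insert by (simp add: left_module_hom_add[OF h] M.M.finsum_closed)
  qed
qed

lemma left_module_hom_comp:
  assumes "h \<in> left_module_hom R L M" "k \<in> left_module_hom R M N"
  shows "(\<lambda>x. k (h x)) \<in> left_module_hom R L N"
  using assms by (auto simp: left_module_hom_def Pi_iff)

lemma left_module_hom_add_fun:
  assumes "left_module R M" "left_module R N"
    and h: "h \<in> left_module_hom R M N" and k: "k \<in> left_module_hom R M N"
  shows "(\<lambda>x. h x \<oplus>\<^bsub>N\<^esub> k x) \<in> left_module_hom R M N"
proof -
  interpret M: left_module R M by fact
  interpret N: left_module R N by fact
  note cl = left_module_hom_closed[OF h] left_module_hom_closed[OF k]
  show ?thesis
    by (rule left_module_homI)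
       (simp_all add: cl left_module_hom_add[OF h] left_module_hom_add[OF k]
          left_module_hom_smult[OF h] left_module_hom_smult[OF k] N.smult_r_distr N.M.a_ac)
qed

lemma left_module_hom_diff_fun:
  assumes "left_module R M" "left_module R N"
    and h: "h \<in> left_module_hom R M N" and k: "k \<in> left_module_hom R M N"
  shows "(\<lambda>x. h x \<ominus>\<^bsub>N\<^esub> k x) \<in> left_module_hom R M N"
proof -
  interpret M: left_module R M by fact
  interpret N: left_module R N by fact
  note cl = left_module_hom_closed[OF h] left_module_hom_closed[OF k]
  have neg: "r \<odot>\<^bsub>N\<^esub> (\<ominus>\<^bsub>N\<^esub> y) = \<ominus>\<^bsub>N\<^esub> (r \<odot>\<^bsub>N\<^esub> y)" if "r \<in> carrier R" "y \<in> carrier N" for r y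
  proof (rule N.M.minus_equality[symmetric])
    show "r \<odot>\<^bsub>N\<^esub> (\<ominus>\<^bsub>N\<^esub> y) \<oplus>\<^bsub>N\<^esub> r \<odot>\<^bsub>N\<^esub> y = \<zero>\<^bsub>N\<^esub>"
      using N.smult_r_distr[of r "\<ominus>\<^bsub>N\<^esub> y" y] that by (simp add: N.M.l_neg N.smult_zero)
  qed (use that in auto)
  show ?thesis
    by (rule left_module_homI)
       (simp_all add: cl left_module_hom_add[OF h] left_module_hom_add[OF k] N.M.minus_eq neg
          left_module_hom_smult[OF h] left_module_hom_smult[OF k] N.smult_r_distr N.M.a_ac
          N.M.minus_add)
qed

lemma left_module_hom_subring:
  "\<lbrakk>h \<in> left_module_hom R M N; C \<subseteq> carrier R\<rbrakk> \<Longrightarrow> h \<in> left_module_hom (R\<lparr>carrier := C\<rparr>) M N"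
  by (auto simp: left_module_hom_def)

lemma left_module_subring:
  assumes "left_module R M" and C: "subring C R"
  shows "left_module (R\<lparr>carrier := C\<rparr>) M"
proof -
  interpret M: left_module R M by fact
  have "C \<subseteq> carrier R" using subringE(1)[OF C] .
  then show ?thesis
    by (intro left_module.intro left_module_axioms.intro M.R.subring_is_ring[OF C] M.M.abelian_group_axioms)
       (auto simp: subset_eq M.smult_l_distr M.smult_r_distr M.smult_assoc1)
qed

lemma left_module_submodule:
  assumes "left_module R M" and C: "C \<subseteq> carrier M" "\<zero>\<^bsub>M\<^esub> \<in> C"
    and add: "\<And>x y. \<lbrakk>x \<in> C; y \<in> C\<rbrakk> \<Longrightarrow> x \<oplus>\<^bsub>M\<^esub> y \<in> C"
    and smult: "\<And>r x. \<lbrakk>r \<in> carrier R; x \<in> C\<rbrakk> \<Longrightarrow> r \<odot>\<^bsub>M\<^esub> x \<in> C"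
  shows "left_module R (M\<lparr>carrier := C\<rparr>)"
proof -
  interpret M: left_module R M by fact
  have C': "x \<in> carrier M" if "x \<in> C" for x using C that by auto
  \<comment> \<open>Negatives are produced as multiples by \<open>\<ominus>\<one>\<close>, so
    closure under scalars covers them.\<close>
  have "\<exists>y\<in>C. y \<oplus>\<^bsub>M\<^esub> x = \<zero>\<^bsub>M\<^esub>" if "x \<in> C" for x
  proof
    have x: "x \<in> carrier M" using that C' by auto
    have "(\<ominus>\<^bsub>R\<^esub> \<one>\<^bsub>R\<^esub> \<oplus>\<^bsub>R\<^esub> \<one>\<^bsub>R\<^esub>) \<odot>\<^bsub>M\<^esub> x = (\<ominus>\<^bsub>R\<^esub> \<one>\<^bsub>R\<^esub>) \<odot>\<^bsub>M\<^esub> x \<oplus>\<^bsub>M\<^esub> x"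
      using M.smult_l_distr[of "\<ominus>\<^bsub>R\<^esub> \<one>\<^bsub>R\<^esub>" "\<one>\<^bsub>R\<^esub>" x] x by simp
    then show "(\<ominus>\<^bsub>R\<^esub> \<one>\<^bsub>R\<^esub>) \<odot>\<^bsub>M\<^esub> x \<oplus>\<^bsub>M\<^esub> x = \<zero>\<^bsub>M\<^esub>" using x by (simp add: M.R.l_neg M.zero_smult)
    show "(\<ominus>\<^bsub>R\<^esub> \<one>\<^bsub>R\<^esub>) \<odot>\<^bsub>M\<^esub> x \<in> C" using smult that by simp
  qed
  then have "abelian_group (M\<lparr>carrier := C\<rparr>)"
    by (intro abelian_groupI) (simp_all add: C add C' M.M.a_ac)
  then show ?thesis
    by (intro left_module.intro left_module_axioms.intro M.R.ring_axioms)
       (simp_all add: smult C' M.smult_l_distr M.smult_r_distr M.smult_assoc1)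
qed

section \<open>Finite sums\<close>

lemma (in abelian_monoid) finsum_swap:
  assumes "finite A" "finite B" "\<And>i j. \<lbrakk>i \<in> A; j \<in> B\<rbrakk> \<Longrightarrow> g i j \<in> carrier G"
  shows "finsum G (\<lambda>i. finsum G (g i) B) A = finsum G (\<lambda>j. finsum G (\<lambda>i. g i j) A) B"
  using assms(1,3)
proof (induction A rule: finite_induct)
  case empty
  show ?case by simp
next
  case (insert a A)
  have "finsum G (\<lambda>j. finsum G (\<lambda>i. g i j) (insert a A)) B
      = finsum G (\<lambda>j. g a j \<oplus> finsum G (\<lambda>i. g i j) A) B"
    by (rule finsum_cong') (use insert in \<open>auto intro!: finsum_closed\<close>)
  also have "\<dots> = finsum G (g a) B \<oplus> finsum G (\<lambda>j. finsum G (\<lambda>i. g i j) A) B"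
    by (rule finsum_addf) (use insert in \<open>auto intro!: finsum_closed\<close>)
  also have "\<dots> = finsum G (g a) B \<oplus> finsum G (\<lambda>i. finsum G (g i) B) A"
    using insert by simp
  also have "\<dots> = finsum G (\<lambda>i. finsum G (g i) B) (insert a A)"
    by (rule finsum_insert[symmetric]) (use insert in \<open>auto intro!: finsum_closed\<close>)
  finally show ?case ..
qed

lemma (in abelian_monoid) finsum_Sigma:
  assumes "finite A" "\<And>i. i \<in> A \<Longrightarrow> finite (B i)" "\<And>i j. \<lbrakk>i \<in> A; j \<in> B i\<rbrakk> \<Longrightarrow> g (i, j) \<in> carrier G"
  shows "finsum G g (Sigma A B) = finsum G (\<lambda>i. finsum G (\<lambda>j. g (i, j)) (B i)) A"
  using assms
proof (induction A rule: finite_induct)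
  case empty
  show ?case by simp
next
  case (insert a A)
  have "finsum G g (Sigma (insert a A) B) = finsum G g (Pair a ` B a \<union> Sigma A B)"
    by (rule arg_cong[of _ _ "finsum G g"]) auto
  also have "\<dots> = finsum G g (Pair a ` B a) \<oplus> finsum G g (Sigma A B)"
    by (rule finsum_Un_disjoint) (use insert in auto)
  also have "finsum G g (Pair a ` B a) = finsum G (\<lambda>j. g (a, j)) (B a)"
    by (rule finsum_reindex) (use insert in \<open>auto simp: inj_on_def\<close>)
  also have "finsum G g (Sigma A B) = finsum G (\<lambda>i. finsum G (\<lambda>j. g (i, j)) (B i)) A"
    using insert by simp
  also have "finsum G (\<lambda>j. g (a, j)) (B a) \<oplus> \<dots>
      = finsum G (\<lambda>i. finsum G (\<lambda>j. g (i, j)) (B i)) (insert a A)"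
    by (rule finsum_insert[symmetric]) (use insert in \<open>auto intro!: finsum_closed\<close>)
  finally show ?case .
qed

lemma (in abelian_monoid) finsum_in_subset:
  assumes "finite F" "f \<in> F \<rightarrow> C" and C: "C \<subseteq> carrier G" "\<zero> \<in> C"
    and add: "\<And>x y. \<lbrakk>x \<in> C; y \<in> C\<rbrakk> \<Longrightarrow> x \<oplus> y \<in> C"
  shows "finsum G f F \<in> C"
  using assms(1,2)
proof (induction F rule: finite_induct)
  case (insert i F)
  then have "f \<in> F \<rightarrow> C" "f i \<in> C" by auto
  moreover from this have "f \<in> F \<rightarrow> carrier G" "f i \<in> carrier G" using C by auto
  ultimately show ?case using insert add by simp
qed (use C in simp)

lemma (in left_module) finsum_smult:
  assumes "finite F" "f \<in> F \<rightarrow> carrier R" "x \<in> carrier M"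
  shows "finsum R f F \<odot>\<^bsub>M\<^esub> x = finsum M (\<lambda>i. f i \<odot>\<^bsub>M\<^esub> x) F"
  using assms(1,2)
proof (induction F rule: finite_induct)
  case empty
  show ?case using assms by (simp add: zero_smult)
next
  case (insert i F)
  then have "f \<in> F \<rightarrow> carrier R" "f i \<in> carrier R" by auto
  moreover from this have "(\<lambda>i. f i \<odot>\<^bsub>M\<^esub> x) \<in> F \<rightarrow> carrier M" using assms by auto
  ultimately show ?case using insert assms by (simp add: smult_l_distr R.finsum_closed)
qed

text \<open>\<open>finsum\<close> is defined through the carrier of its structure, so a change of
  carrier is not transparent to it. For an infinite index set both sides are zero by
  convention.\<close>

lemma finsum_subgroup:
  assumes "abelian_group M" "abelian_group (M\<lparr>carrier := C\<rparr>)" "C \<subseteq> carrier M" "f \<in> F \<rightarrow> C"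
  shows "finsum (M\<lparr>carrier := C\<rparr>) f F = finsum M f F"
proof (cases "finite F")
  interpret M: abelian_group M by fact
  interpret C: abelian_group "M\<lparr>carrier := C\<rparr>" by fact
  case True
  then show ?thesis
    using assms(4)
  proof (induction F rule: finite_induct)
    case empty
    show ?case by (simp)
  next
    case (insert i F)
    then have "f \<in> F \<rightarrow> C" "f i \<in> C" by auto
    then have "f \<in> F \<rightarrow> carrier M" "f i \<in> carrier M" using assms(3) by auto
    then show ?case using insert \<open>f \<in> F \<rightarrow> C\<close> \<open>f i \<in> C\<close> by simp
  qed
next
  interpret M: abelian_group M by fact
  interpret C: abelian_group "M\<lparr>carrier := C\<rparr>" by fact
  case False
  then show ?thesis by (simp add: M.finsum_infinite C.finsum_infinite)
qed

section \<open>Coordinates in free modules\<close>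

lemma free_left_module_carrier:
  "c \<in> carrier (free_left_module R J) \<longleftrightarrow>
    (\<forall>i. c i \<in> carrier R) \<and> (\<forall>i. i \<notin> J \<longrightarrow> c i = \<zero>\<^bsub>R\<^esub>) \<and> finite {i. c i \<noteq> \<zero>\<^bsub>R\<^esub>}"
  by (simp add: free_left_module_def module.defs)

lemma free_left_module_add: "(c \<oplus>\<^bsub>free_left_module R J\<^esub> d) i = c i \<oplus>\<^bsub>R\<^esub> d i"
  and free_left_module_smult: "(r \<odot>\<^bsub>free_left_module R J\<^esub> c) i = r \<otimes>\<^bsub>R\<^esub> c i"
  and free_left_module_zero: "\<zero>\<^bsub>free_left_module R J\<^esub> i = \<zero>\<^bsub>R\<^esub>"
  by (simp_all add: free_left_module_def module.defs)

text \<open>The lift refers to the ring only through its zero, so one and the same map can be used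
  over \<open>S\<close> and over all its subrings.\<close>

lemma free_left_module_lift_subring [simp]:
  "free_left_module_lift (R\<lparr>carrier := C\<rparr>) M = free_left_module_lift R M"
  by (intro ext) (simp add: free_left_module_lift_def)

lemma free_left_module_mono:
  assumes "c \<in> carrier (free_left_module (R\<lparr>carrier := C\<rparr>) J)" "J \<subseteq> J'" "C \<subseteq> C'"
  shows "c \<in> carrier (free_left_module (R\<lparr>carrier := C'\<rparr>) J')"
  using assms by (auto simp: free_left_module_carrier)

lemma (in left_module) free_left_module_lift_cong:
  assumes "c \<in> carrier (free_left_module R J)" "\<And>i. \<lbrakk>i \<in> J; c i \<noteq> \<zero>\<rbrakk> \<Longrightarrow> a i = b i"
    "\<And>i. \<lbrakk>i \<in> J; c i \<noteq> \<zero>\<rbrakk> \<Longrightarrow> b i \<in> carrier M"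
  shows "free_left_module_lift R M a c = free_left_module_lift R M b c"
proof -
  have "i \<in> J" if "c i \<noteq> \<zero>" for i using assms(1) that by (auto simp: free_left_module_carrier)
  then show ?thesis
    unfolding free_left_module_lift_def
    by (intro M.finsum_cong') (use assms in \<open>auto simp: free_left_module_carrier\<close>)
qed

lemma (in left_module) free_left_module_lift_in_submodule:
  assumes "c \<in> carrier (free_left_module R J)" and C: "C \<subseteq> carrier M" "\<zero>\<^bsub>M\<^esub> \<in> C"
    and add: "\<And>x y. \<lbrakk>x \<in> C; y \<in> C\<rbrakk> \<Longrightarrow> x \<oplus>\<^bsub>M\<^esub> y \<in> C"
    and smult: "\<And>i. \<lbrakk>i \<in> J; c i \<noteq> \<zero>\<rbrakk> \<Longrightarrow> c i \<odot>\<^bsub>M\<^esub> a i \<in> C"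
  shows "free_left_module_lift R M a c \<in> C"
proof -
  have "finite {i. c i \<noteq> \<zero>}" "{i. c i \<noteq> \<zero>} \<subseteq> J"
    using assms(1) by (auto simp: free_left_module_carrier)
  then show ?thesis
    unfolding free_left_module_lift_def
    by (intro M.finsum_in_subset C add) (use smult in auto)
qed

section \<open>Dual bases and projectivity\<close>

text \<open>The coordinate functionals \<open>m \<mapsto> s m i\<close> of the dual basis lemma are
  packed into one map to the free module, whose elements have finite support; thus the sum that
  recovers \<open>m\<close> is finite. The index type \<open>'i\<close> is arbitrary, unlike the
  types in \<open>projective_module\<close>.\<close>

definition dual_basis ::
    "('r, 'x) ring_scheme \<Rightarrow> ('r, 'm, 'y) module_scheme \<Rightarrow> 'i set \<Rightarrow> ('i \<Rightarrow> 'm) \<Rightarrow> ('m \<Rightarrow> 'i \<Rightarrow> 'r) \<Rightarrow> bool"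
  where "dual_basis R M J x s \<longleftrightarrow> x \<in> J \<rightarrow> carrier M \<and>
    s \<in> left_module_hom R M (free_left_module R J) \<and>
    (\<forall>m \<in> carrier M. free_left_module_lift R M x (s m) = m)"

text \<open>The canonical map from the free module on all elements of \<open>P\<close> onto
  \<open>P\<close> splits, and its section is the coordinate map.\<close>

lemma projective_module_dual_basis:
  assumes P: "projective_module R P"
  shows "\<exists>s. dual_basis R P (carrier P) (\<lambda>x. x) s"
proof -
  interpret P: left_module R P using P by (simp add: projective_module_def)
  let ?F = "free_left_module R (carrier P)"
  let ?p = "free_left_module_lift R P (\<lambda>x. x)"
  have p: "?p \<in> left_module_hom R ?F P" by (rule P.free_left_module_lift_hom) simp
  have "?p ` carrier ?F = carrier P"
  proof
    show "carrier P \<subseteq> ?p ` carrier ?F"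
    proof
      fix x assume "x \<in> carrier P"
      from P.free_left_module_lift_basis[of x "carrier P" "\<lambda>x. x", OF this]
      show "x \<in> ?p ` carrier ?F" by (metis (no_types, lifting) Pi_I imageI)
    qed
  qed (use p in \<open>auto simp: left_module_hom_def\<close>)
  moreover have "(\<lambda>x. x) \<in> left_module_hom R P P" by (simp add: left_module_hom_def)
  ultimately show ?thesis
    using projective_module_lift[OF P P.R.left_module_free P.left_module_axioms p, of "\<lambda>x. x"]
    by (auto simp: dual_basis_def)
qed

text \<open>Preimages under \<open>f\<close> of the values \<open>g (x j)\<close> may be chosen
  freely, because linearity of the lift comes from \<open>s\<close>. The index type is unrelated to
  the type of \<open>P\<close>, so families indexed by triples can be used later.\<close>

lemma dual_basis_projective_module:
  fixes R :: "('r, 'x) ring_scheme" and P :: "('r, 'm) module"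
  assumes "left_module R P" "dual_basis R P J x s"
  shows "projective_module R P"
  unfolding projective_module_def
proof (intro conjI allI impI)
  interpret P: left_module R P by fact
  have x: "x \<in> J \<rightarrow> carrier P" and s: "s \<in> left_module_hom R P (free_left_module R J)"
    and eq: "\<And>m. m \<in> carrier P \<Longrightarrow> free_left_module_lift R P x (s m) = m"
    using assms(2) by (auto simp: dual_basis_def)
  show "left_module R P" by fact
  fix A :: "('r, 'm \<Rightarrow> 'r) module" and B :: "('r, 'm) module" and f g
  assume A: "left_module R A" and B: "left_module R B" and f: "f \<in> left_module_hom R A B"
    "f ` carrier A = carrier B" and g: "g \<in> left_module_hom R P B"
  interpret A: left_module R A by fact
  interpret B: left_module R B by fact
  have "\<exists>y \<in> carrier A. f y = g (x j)" if "j \<in> J" for j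
  proof -
    have "g (x j) \<in> f ` carrier A" using that x f(2) left_module_hom_closed[OF g] by auto
    then show ?thesis by auto
  qed
  then obtain a where a: "\<And>j. j \<in> J \<Longrightarrow> a j \<in> carrier A" "\<And>j. j \<in> J \<Longrightarrow> f (a j) = g (x j)" by metis
  then have aP: "a \<in> J \<rightarrow> carrier A" by auto
  show "\<exists>h\<in>left_module_hom R P A. \<forall>m\<in>carrier P. f (h m) = g m"
  proof (intro bexI ballI)
    show "(\<lambda>m. free_left_module_lift R A a (s m)) \<in> left_module_hom R P A"
      by (rule left_module_hom_comp[OF s A.free_left_module_lift_hom[OF aP]])
    fix m assume m: "m \<in> carrier P"
    note sm = left_module_hom_closed[OF s m]
    have "f (free_left_module_lift R A a (s m)) = free_left_module_lift R B (\<lambda>j. f (a j)) (s m)"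
      by (rule free_left_module_lift_comp[OF A B f(1) aP sm])
    also have "\<dots> = free_left_module_lift R B (\<lambda>j. g (x j)) (s m)"
      by (rule B.free_left_module_lift_cong[OF sm]) (use a x left_module_hom_closed[OF g] in auto)
    also have "\<dots> = g (free_left_module_lift R P x (s m))"
      by (rule free_left_module_lift_comp[OF assms(1) B g x sm, symmetric])
    finally show "f (free_left_module_lift R A a (s m)) = g m" using eq[OF m] by simp
  qed
qed

section \<open>Traces for Frobenius extensions\<close>

text \<open>The roles are \<open>S\<close> = \<open>R(\<Gamma>)\<close>, \<open>T\<close> =
  \<open>R(H)\<close> and \<open>e\<close> the projection. The right expansion makes
  \<open>v\<close> a finite dual basis of \<open>S\<close> as a left \<open>T\<close>-module, with
  coordinates \<open>r \<mapsto> e (r \<otimes> u t)\<close>; the left expansion shows that the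
  \<open>u t\<close> generate \<open>S\<close> as a right \<open>T\<close>-module.\<close>

locale frobenius_extension = ring S
  for S :: "('r, 'z) ring_scheme" (structure) +
  fixes T :: "'r set" and e :: "'r \<Rightarrow> 'r" and I :: "'t set" and u v :: "'t \<Rightarrow> 'r"
  assumes T_subring: "subring T S"
    and I_finite: "finite I"
    and u_closed: "t \<in> I \<Longrightarrow> u t \<in> carrier S"
    and v_closed: "t \<in> I \<Longrightarrow> v t \<in> carrier S"
    and e_closed: "r \<in> carrier S \<Longrightarrow> e r \<in> T"
    and e_add: "\<lbrakk>r \<in> carrier S; r' \<in> carrier S\<rbrakk> \<Longrightarrow> e (r \<oplus> r') = e r \<oplus> e r'"
    and e_mult: "\<lbrakk>r \<in> T; r' \<in> carrier S\<rbrakk> \<Longrightarrow> e (r \<otimes> r') = r \<otimes> e r'"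
    and left_expansion: "r \<in> carrier S \<Longrightarrow> finsum S (\<lambda>t. u t \<otimes> e (v t \<otimes> r)) I = r"
    and right_expansion: "r \<in> carrier S \<Longrightarrow> finsum S (\<lambda>t. e (r \<otimes> u t) \<otimes> v t) I = r"
begin

lemma T_subset: "T \<subseteq> carrier S"
  using T_subring by (rule subringE)

lemma e_closed': "r \<in> carrier S \<Longrightarrow> e r \<in> carrier S"
  using e_closed T_subset by blast

lemma e_zero: "e \<zero> = \<zero>"
  using e_add[of \<zero> \<zero>] e_closed'[of \<zero>] by simp

text \<open>The relative trace. For a group ring over a subgroup of finite index, \<open>u\<close>
  and \<open>v\<close> can be left coset representatives \<open>g\<close> and their inverses; this
  is then the sum of the \<open>g \<phi>(inv g m)\<close>.\<close>

definition trace ::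
    "('r, 'm, 'y) module_scheme \<Rightarrow> ('r, 'n, 'w) module_scheme \<Rightarrow> ('m \<Rightarrow> 'n) \<Rightarrow> 'm \<Rightarrow> 'n"
  where "trace M N \<phi> m = finsum N (\<lambda>t. u t \<odot>\<^bsub>N\<^esub> \<phi> (v t \<odot>\<^bsub>M\<^esub> m)) I"

text \<open>The right expansion rewrites \<open>r m\<close> in terms of the \<open>v t m\<close>
  with coefficients in \<open>T\<close>, and such coefficients pass through \<open>\<phi>\<close>.
  Even for the identity map this is useful: it reduces scalars from \<open>S\<close> to the finitely
  many \<open>v t\<close>.\<close>

lemma hom_expansion:
  assumes M: "left_module S M" and N: "left_module S N"
    and \<phi>: "\<phi> \<in> left_module_hom (S\<lparr>carrier := T\<rparr>) M N"
    and r: "r \<in> carrier S" and m: "m \<in> carrier M"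
  shows "\<phi> (r \<odot>\<^bsub>M\<^esub> m) = finsum N (\<lambda>t. e (r \<otimes> u t) \<odot>\<^bsub>N\<^esub> \<phi> (v t \<odot>\<^bsub>M\<^esub> m)) I"
proof -
  interpret M: left_module S M by fact
  interpret N: left_module S N by fact
  have er: "e (r \<otimes> u t) \<in> T" "e (r \<otimes> u t) \<in> carrier S" if "t \<in> I" for t
    using that r by (simp_all add: e_closed e_closed' u_closed)
  have "r \<odot>\<^bsub>M\<^esub> m = finsum S (\<lambda>t. e (r \<otimes> u t) \<otimes> v t) I \<odot>\<^bsub>M\<^esub> m"
    using r by (simp add: right_expansion)
  also have "\<dots> = finsum M (\<lambda>t. (e (r \<otimes> u t) \<otimes> v t) \<odot>\<^bsub>M\<^esub> m) I"
    by (rule M.finsum_smult) (use I_finite er m v_closed in auto)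
  also have "\<dots> = finsum M (\<lambda>t. e (r \<otimes> u t) \<odot>\<^bsub>M\<^esub> (v t \<odot>\<^bsub>M\<^esub> m)) I"
    by (rule M.M.finsum_cong') (use er m v_closed M.smult_assoc1 in auto)
  also have "\<phi> \<dots> = finsum N (\<lambda>t. \<phi> (e (r \<otimes> u t) \<odot>\<^bsub>M\<^esub> (v t \<odot>\<^bsub>M\<^esub> m))) I"
    by (rule left_module_hom_finsum[OF left_module_subring[OF M T_subring]
          left_module_subring[OF N T_subring] \<phi> I_finite])
       (use er m v_closed in auto)
  also have "\<dots> = finsum N (\<lambda>t. e (r \<otimes> u t) \<odot>\<^bsub>N\<^esub> \<phi> (v t \<odot>\<^bsub>M\<^esub> m)) I"
    by (rule N.M.finsum_cong')
       (use er m v_closed left_module_hom_smult[OF \<phi>] left_module_hom_closed[OF \<phi>] in auto)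
  finally show ?thesis .
qed

text \<open>For a scalar \<open>r\<close>, expanding \<open>\<phi>\<close> at \<open>v t r\<close>
  gives a double sum over \<open>t\<close> and \<open>t'\<close>. After the sums are interchanged,
  the inner one is the left expansion of \<open>r u t'\<close>, so the coefficients collapse to
  \<open>r u t'\<close>.\<close>

lemma trace_hom:
  assumes M: "left_module S M" and N: "left_module S N"
    and \<phi>: "\<phi> \<in> left_module_hom (S\<lparr>carrier := T\<rparr>) M N"
  shows "trace M N \<phi> \<in> left_module_hom S M N"
proof -
  interpret M: left_module S M by fact
  interpret N: left_module S N by fact
  note cl = left_module_hom_closed[OF \<phi>]
  show ?thesis
  proof (rule left_module_homI)
    fix m assume m: "m \<in> carrier M"
    then show "trace M N \<phi> m \<in> carrier N"
      unfolding trace_def by (intro N.M.finsum_closed) (use cl u_closed v_closed in auto)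
    fix m' assume m': "m' \<in> carrier M"
    have "trace M N \<phi> (m \<oplus>\<^bsub>M\<^esub> m')
        = finsum N (\<lambda>t. u t \<odot>\<^bsub>N\<^esub> \<phi> (v t \<odot>\<^bsub>M\<^esub> m) \<oplus>\<^bsub>N\<^esub> u t \<odot>\<^bsub>N\<^esub> \<phi> (v t \<odot>\<^bsub>M\<^esub> m')) I"
      unfolding trace_def
      by (rule N.M.finsum_cong')
         (use m m' cl u_closed v_closed
          in \<open>auto simp: M.smult_r_distr left_module_hom_add[OF \<phi>] N.smult_r_distr\<close>)
    also have "\<dots> = trace M N \<phi> m \<oplus>\<^bsub>N\<^esub> trace M N \<phi> m'"
      unfolding trace_def
      by (rule N.M.finsum_addf) (use m m' cl u_closed v_closed in auto)
    finally show "trace M N \<phi> (m \<oplus>\<^bsub>M\<^esub> m') = trace M N \<phi> m \<oplus>\<^bsub>N\<^esub> trace M N \<phi> m'" .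
  next
    fix r m assume r: "r \<in> carrier S" and m: "m \<in> carrier M"
    let ?\<phi> = "\<lambda>t. \<phi> (v t \<odot>\<^bsub>M\<^esub> m)"
    have \<phi>t: "?\<phi> t \<in> carrier N" if "t \<in> I" for t
      using that cl m v_closed by auto
    have "trace M N \<phi> (r \<odot>\<^bsub>M\<^esub> m)
        = finsum N (\<lambda>t. finsum N (\<lambda>t'. (u t \<otimes> e (v t \<otimes> (r \<otimes> u t'))) \<odot>\<^bsub>N\<^esub> ?\<phi> t') I) I"
      unfolding trace_def
    proof (rule N.M.finsum_cong')
      fix t assume t: "t \<in> I"
      have "\<phi> (v t \<odot>\<^bsub>M\<^esub> (r \<odot>\<^bsub>M\<^esub> m)) = \<phi> ((v t \<otimes> r) \<odot>\<^bsub>M\<^esub> m)"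
        using t r m v_closed by (simp add: M.smult_assoc1)
      also have "\<dots> = finsum N (\<lambda>t'. e (v t \<otimes> r \<otimes> u t') \<odot>\<^bsub>N\<^esub> ?\<phi> t') I"
        by (rule hom_expansion[OF M N \<phi>]) (use t r m v_closed in auto)
      finally have "u t \<odot>\<^bsub>N\<^esub> \<phi> (v t \<odot>\<^bsub>M\<^esub> (r \<odot>\<^bsub>M\<^esub> m))
          = u t \<odot>\<^bsub>N\<^esub> finsum N (\<lambda>t'. e (v t \<otimes> r \<otimes> u t') \<odot>\<^bsub>N\<^esub> ?\<phi> t') I" by simp
      also have "\<dots> = finsum N (\<lambda>t'. u t \<odot>\<^bsub>N\<^esub> (e (v t \<otimes> r \<otimes> u t') \<odot>\<^bsub>N\<^esub> ?\<phi> t')) I"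
        by (rule N.smult_finsum) (use t r \<phi>t v_closed u_closed e_closed' I_finite in auto)
      also have "\<dots> = finsum N (\<lambda>t'. (u t \<otimes> e (v t \<otimes> (r \<otimes> u t'))) \<odot>\<^bsub>N\<^esub> ?\<phi> t') I"
        by (rule N.M.finsum_cong')
           (use t r \<phi>t v_closed u_closed e_closed' in \<open>auto simp: N.smult_assoc1 m_assoc\<close>)
      finally show "u t \<odot>\<^bsub>N\<^esub> \<phi> (v t \<odot>\<^bsub>M\<^esub> (r \<odot>\<^bsub>M\<^esub> m)) = \<dots>" .
    qed (use r \<phi>t v_closed u_closed e_closed' in \<open>auto intro!: N.M.finsum_closed\<close>)
    also have "\<dots> = finsum N (\<lambda>t'. finsum N (\<lambda>t. (u t \<otimes> e (v t \<otimes> (r \<otimes> u t'))) \<odot>\<^bsub>N\<^esub> ?\<phi> t') I) I"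
      by (rule N.M.finsum_swap) (use r \<phi>t v_closed u_closed e_closed' I_finite in auto)
    also have "\<dots> = finsum N (\<lambda>t'. r \<odot>\<^bsub>N\<^esub> (u t' \<odot>\<^bsub>N\<^esub> ?\<phi> t')) I"
    proof (rule N.M.finsum_cong')
      fix t' assume t': "t' \<in> I"
      have "finsum N (\<lambda>t. (u t \<otimes> e (v t \<otimes> (r \<otimes> u t'))) \<odot>\<^bsub>N\<^esub> ?\<phi> t') I
          = finsum S (\<lambda>t. u t \<otimes> e (v t \<otimes> (r \<otimes> u t'))) I \<odot>\<^bsub>N\<^esub> ?\<phi> t'"
        by (rule N.finsum_smult[symmetric])
           (use t' r \<phi>t v_closed u_closed e_closed' I_finite in auto)
      then show "finsum N (\<lambda>t. (u t \<otimes> e (v t \<otimes> (r \<otimes> u t'))) \<odot>\<^bsub>N\<^esub> ?\<phi> t') I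
          = r \<odot>\<^bsub>N\<^esub> (u t' \<odot>\<^bsub>N\<^esub> ?\<phi> t')"
        using t' r \<phi>t u_closed by (simp add: left_expansion N.smult_assoc1)
    qed (use r \<phi>t u_closed in auto)
    also have "\<dots> = r \<odot>\<^bsub>N\<^esub> trace M N \<phi> m"
      unfolding trace_def
      by (rule N.smult_finsum[symmetric]) (use r \<phi>t u_closed I_finite in auto)
    finally show "trace M N \<phi> (r \<odot>\<^bsub>M\<^esub> m) = r \<odot>\<^bsub>N\<^esub> trace M N \<phi> m" .
  qed
qed

text \<open>One half of Higman's criterion. The map \<open>\<psi>\<close> applies \<open>e\<close>
  to the coordinates, \<open>\<psi> m = \<Sum> e(s m j) x j\<close>. Since \<open>s\<close> is
  linear over \<open>S\<close>, the trace replaces each coordinate by its left expansion and returns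
  \<open>m\<close>.\<close>

lemma trace_eq_id:
  assumes M: "left_module S M" and db: "dual_basis S M J x s"
  shows "\<exists>\<psi> \<in> left_module_hom (S\<lparr>carrier := T\<rparr>) M M. \<forall>m \<in> carrier M. trace M M \<psi> m = m"
proof -
  interpret M: left_module S M by fact
  interpret TM: left_module "S\<lparr>carrier := T\<rparr>" M by (rule left_module_subring[OF M T_subring])
  have x: "x \<in> J \<rightarrow> carrier M" and s: "s \<in> left_module_hom S M (free_left_module S J)"
    and eq: "\<And>m. m \<in> carrier M \<Longrightarrow> free_left_module_lift S M x (s m) = m"
    using db by (auto simp: dual_basis_def)
  let ?T = "S\<lparr>carrier := T\<rparr>"
  let ?\<psi> = "\<lambda>m. free_left_module_lift S M x (\<lambda>j. e (s m j))"
  have 1: "(\<lambda>c j. e (c j)) \<in> left_module_hom ?T (free_left_module S J) (free_left_module ?T J)"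
  proof (rule left_module_homI)
    fix c assume c: "c \<in> carrier (free_left_module S J)"
    then have c': "finite {j. c j \<noteq> \<zero>}" "\<And>j. c j \<in> carrier S" "\<And>j. j \<notin> J \<Longrightarrow> c j = \<zero>"
      by (simp_all add: free_left_module_carrier)
    have "{j. e (c j) \<noteq> \<zero>} \<subseteq> {j. c j \<noteq> \<zero>}"
      by (auto simp: e_zero)
    then have "finite {j. e (c j) \<noteq> \<zero>}"
      using c'(1) by (rule finite_subset)
    with c' show "(\<lambda>j. e (c j)) \<in> carrier (free_left_module ?T J)"
      by (simp add: free_left_module_carrier e_zero e_closed)
    fix d assume d: "d \<in> carrier (free_left_module S J)"
    show "(\<lambda>j. e ((c \<oplus>\<^bsub>free_left_module S J\<^esub> d) j)) =
        (\<lambda>j. e (c j)) \<oplus>\<^bsub>free_left_module ?T J\<^esub> (\<lambda>j. e (d j))"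
      by (rule ext) (use c d in \<open>simp add: free_left_module_add free_left_module_carrier e_add\<close>)
  next
    fix r c assume "r \<in> carrier ?T" "c \<in> carrier (free_left_module S J)"
    then show "(\<lambda>j. e ((r \<odot>\<^bsub>free_left_module S J\<^esub> c) j)) =
        r \<odot>\<^bsub>free_left_module ?T J\<^esub> (\<lambda>j. e (c j))"
      by (intro ext) (simp add: free_left_module_smult free_left_module_carrier e_mult)
  qed
  have 2: "s \<in> left_module_hom ?T M (free_left_module S J)"
    using s T_subset by (rule left_module_hom_subring)
  have 3: "free_left_module_lift S M x \<in> left_module_hom ?T (free_left_module ?T J) M"
    using TM.free_left_module_lift_hom[OF x] by simp
  have "?\<psi> \<in> left_module_hom ?T M M"
    by (rule left_module_hom_comp[OF left_module_hom_comp[OF 2 1] 3])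
  moreover have "trace M M ?\<psi> m = m" if m: "m \<in> carrier M" for m
  proof -
    define F where "F = {j. s m j \<noteq> \<zero>}"
    have sm: "s m \<in> carrier (free_left_module S J)" using left_module_hom_closed[OF s m] .
    then have F: "finite F" "F \<subseteq> J" and smj: "\<And>j. s m j \<in> carrier S"
      by (auto simp: F_def free_left_module_carrier)
    have xj: "x j \<in> carrier M" if "j \<in> F" for j using that F x by auto
    have "trace M M ?\<psi> m = finsum M (\<lambda>t. finsum M (\<lambda>j. (u t \<otimes> e (v t \<otimes> s m j)) \<odot>\<^bsub>M\<^esub> x j) F) I"
      unfolding trace_def
    proof (rule M.M.finsum_cong')
      fix t assume t: "t \<in> I"
      have "?\<psi> (v t \<odot>\<^bsub>M\<^esub> m) = finsum M (\<lambda>j. e (v t \<otimes> s m j) \<odot>\<^bsub>M\<^esub> x j) {j. e (v t \<otimes> s m j) \<noteq> \<zero>}"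
        using left_module_hom_smult[OF s v_closed[OF t] m]
        by (simp add: free_left_module_lift_def free_left_module_smult)
      \<comment> \<open>\<open>e\<close> may annihilate coordinates, so the sum is enlarged to
        \<open>F\<close>, which does not depend on \<open>t\<close>.\<close>
      also have "\<dots> = finsum M (\<lambda>j. e (v t \<otimes> s m j) \<odot>\<^bsub>M\<^esub> x j) F"
      proof (rule M.M.add.finprod_mono_neutral_cong_left)
        show "{j. e (v t \<otimes> s m j) \<noteq> \<zero>} \<subseteq> F"
          using t v_closed by (auto simp: F_def e_zero)
      qed (use F xj t smj v_closed e_closed' in \<open>auto simp: M.zero_smult\<close>)
      finally have "u t \<odot>\<^bsub>M\<^esub> ?\<psi> (v t \<odot>\<^bsub>M\<^esub> m)
          = u t \<odot>\<^bsub>M\<^esub> finsum M (\<lambda>j. e (v t \<otimes> s m j) \<odot>\<^bsub>M\<^esub> x j) F" by simp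
      also have "\<dots> = finsum M (\<lambda>j. u t \<odot>\<^bsub>M\<^esub> (e (v t \<otimes> s m j) \<odot>\<^bsub>M\<^esub> x j)) F"
        by (rule M.smult_finsum) (use F xj t smj v_closed u_closed e_closed' in auto)
      also have "\<dots> = finsum M (\<lambda>j. (u t \<otimes> e (v t \<otimes> s m j)) \<odot>\<^bsub>M\<^esub> x j) F"
        by (rule M.M.finsum_cong')
           (use xj t smj v_closed u_closed e_closed' in \<open>auto simp: M.smult_assoc1\<close>)
      finally show "u t \<odot>\<^bsub>M\<^esub> ?\<psi> (v t \<odot>\<^bsub>M\<^esub> m) = \<dots>" .
    qed (use xj smj v_closed u_closed e_closed' in \<open>auto intro!: M.M.finsum_closed\<close>)
    also have "\<dots> = finsum M (\<lambda>j. finsum M (\<lambda>t. (u t \<otimes> e (v t \<otimes> s m j)) \<odot>\<^bsub>M\<^esub> x j) I) F"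
      by (rule M.M.finsum_swap) (use F xj smj v_closed u_closed e_closed' I_finite in auto)
    also have "\<dots> = finsum M (\<lambda>j. s m j \<odot>\<^bsub>M\<^esub> x j) F"
    proof (rule M.M.finsum_cong')
      fix j assume j: "j \<in> F"
      have "finsum M (\<lambda>t. (u t \<otimes> e (v t \<otimes> s m j)) \<odot>\<^bsub>M\<^esub> x j) I
          = finsum S (\<lambda>t. u t \<otimes> e (v t \<otimes> s m j)) I \<odot>\<^bsub>M\<^esub> x j"
        by (rule M.finsum_smult[symmetric]) (use j xj smj v_closed u_closed e_closed' I_finite in auto)
      then show "finsum M (\<lambda>t. (u t \<otimes> e (v t \<otimes> s m j)) \<odot>\<^bsub>M\<^esub> x j) I = s m j \<odot>\<^bsub>M\<^esub> x j"
        by (simp add: left_expansion smj)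
    qed (use xj smj in auto)
    also have "\<dots> = m"
      using eq[OF m] by (simp add: free_left_module_lift_def F_def)
    finally show ?thesis .
  qed
  ultimately show ?thesis by blast
qed

text \<open>Both expansions of an element of \<open>C\<close> stay inside \<open>C\<close>, so the
  same \<open>u\<close> and \<open>v\<close> serve again. In the application \<open>C\<close> is
  \<open>R(K)\<close>, and \<open>T \<inter> C\<close> is \<open>R(K \<inter> H)\<close>.\<close>

lemma frobenius_extension_subring:
  assumes C: "subring C S" and uv: "\<And>t. t \<in> I \<Longrightarrow> u t \<in> C" "\<And>t. t \<in> I \<Longrightarrow> v t \<in> C"
    and e: "\<And>r. r \<in> C \<Longrightarrow> e r \<in> C"
  shows "frobenius_extension (S\<lparr>carrier := C\<rparr>) (T \<inter> C) e I u v"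
proof -
  note sub = subringE(1)[OF C]
  interpret C: ring "S\<lparr>carrier := C\<rparr>" by (rule subring_is_ring[OF C])
  have fs: "finsum (S\<lparr>carrier := C\<rparr>) f I = finsum S f I" if "f \<in> I \<rightarrow> C" for f
    by (rule finsum_subgroup[OF abelian_group_axioms C.abelian_group_axioms sub that])
  have "subring (T \<inter> C) S" by (rule subring_inter[OF T_subring C])
  then have TC: "subring (T \<inter> C) (S\<lparr>carrier := C\<rparr>)"
    using C.ring_incl_imp_subring[of "T \<inter> C"] subring_is_ring by simp
  show ?thesis
    by (intro frobenius_extension.intro frobenius_extension_axioms.intro C.ring_axioms TC I_finite)
       (use sub uv e e_closed e_add e_mult subringE(6)[OF C] left_expansion right_expansion
        in \<open>auto simp: fs subset_eq\<close>)
qed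

text \<open>Every scalar is a combination of the \<open>v t\<close> with coefficients in
  \<open>T\<close>, so compatibility with the \<open>v t\<close> on the basis gives compatibility
  with all of \<open>S\<close>. For each \<open>i\<close> the criterion involves finitely many
  elements, and can therefore be verified at a finite stage of a chain.\<close>

lemma hom_from_subring:
  assumes M: "left_module S M" and N: "left_module S N"
    and db: "dual_basis (S\<lparr>carrier := T\<rparr>) M J x s" and y: "y \<in> J \<rightarrow> carrier N"
    and h: "\<And>i t. \<lbrakk>i \<in> J; t \<in> I\<rbrakk> \<Longrightarrow>
      free_left_module_lift S N y (s (v t \<odot>\<^bsub>M\<^esub> x i)) = v t \<odot>\<^bsub>N\<^esub> y i"
  shows "(\<lambda>m. free_left_module_lift S N y (s m)) \<in> left_module_hom S M N"
proof -
  interpret M: left_module S M by fact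
  interpret N: left_module S N by fact
  let ?T = "S\<lparr>carrier := T\<rparr>"
  have TM: "left_module ?T M" and TN: "left_module ?T N"
    using M N T_subring by (auto intro: left_module_subring)
  interpret TN: left_module ?T N by (rule TN)
  have x: "x \<in> J \<rightarrow> carrier M" and s: "s \<in> left_module_hom ?T M (free_left_module ?T J)"
    and eq: "\<And>m. m \<in> carrier M \<Longrightarrow> free_left_module_lift S M x (s m) = m"
    using db by (auto simp: dual_basis_def)
  let ?h = "\<lambda>m. free_left_module_lift S N y (s m)"
  have hT: "?h \<in> left_module_hom ?T M N"
    using left_module_hom_comp[OF s TN.free_left_module_lift_hom[OF y]] by simp
  have single: "?h (r \<odot>\<^bsub>M\<^esub> x j) = r \<odot>\<^bsub>N\<^esub> y j" if r: "r \<in> carrier S" and j: "j \<in> J" for r j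
  proof -
    have yj: "y j \<in> carrier N" and xj: "x j \<in> carrier M" using j x y by auto
    have "?h (r \<odot>\<^bsub>M\<^esub> x j) = finsum N (\<lambda>t. e (r \<otimes> u t) \<odot>\<^bsub>N\<^esub> ?h (v t \<odot>\<^bsub>M\<^esub> x j)) I"
      by (rule hom_expansion[OF M N hT r xj])
    also have "\<dots> = finsum N (\<lambda>t. (e (r \<otimes> u t) \<otimes> v t) \<odot>\<^bsub>N\<^esub> y j) I"
      by (rule N.M.finsum_cong')
         (use r j yj h u_closed v_closed e_closed' in \<open>auto simp: N.smult_assoc1\<close>)
    also have "\<dots> = finsum S (\<lambda>t. e (r \<otimes> u t) \<otimes> v t) I \<odot>\<^bsub>N\<^esub> y j"
      by (rule N.finsum_smult[symmetric]) (use r yj u_closed v_closed e_closed' I_finite in auto)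
    also have "\<dots> = r \<odot>\<^bsub>N\<^esub> y j" using r by (simp add: right_expansion)
    finally show ?thesis .
  qed
  \<comment> \<open>The coefficients range over \<open>S\<close> here, although those produced by
    \<open>s\<close> lie in \<open>T\<close>: multiplication by \<open>r\<close> may lead out of
    \<open>T\<close>.\<close>
  have lift: "?h (free_left_module_lift S M x c) = free_left_module_lift S N y c"
    if c: "c \<in> carrier (free_left_module S J)" for c
  proof -
    have F: "finite {j. c j \<noteq> \<zero>}" "{j. c j \<noteq> \<zero>} \<subseteq> J" and cj: "\<And>j. c j \<in> carrier S"
      using c by (auto simp: free_left_module_carrier)
    have "?h (free_left_module_lift S M x c) = finsum N (\<lambda>j. ?h (c j \<odot>\<^bsub>M\<^esub> x j)) {j. c j \<noteq> \<zero>}"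
      unfolding free_left_module_lift_def[of S M]
      by (rule left_module_hom_finsum[OF TM TN hT F(1)]) (use F cj x in auto)
    also have "\<dots> = finsum N (\<lambda>j. c j \<odot>\<^bsub>N\<^esub> y j) {j. c j \<noteq> \<zero>}"
      by (rule N.M.finsum_cong') (use F cj y single in \<open>auto simp: Pi_iff subset_eq\<close>)
    finally show ?thesis by (simp add: free_left_module_lift_def[of S N])
  qed
  show ?thesis
  proof (rule left_module_homI)
    fix r m assume r: "r \<in> carrier S" and m: "m \<in> carrier M"
    interpret F: left_module S "free_left_module S J" by (rule left_module_free)
    have sm: "s m \<in> carrier (free_left_module S J)"
      using free_left_module_mono[where C = T and C' = "carrier S", OF left_module_hom_closed[OF s m]] T_subset by simp
    note L = M.free_left_module_lift_hom[OF x] N.free_left_module_lift_hom[OF y]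
    have "r \<odot>\<^bsub>M\<^esub> m = free_left_module_lift S M x (r \<odot>\<^bsub>free_left_module S J\<^esub> s m)"
      using left_module_hom_smult[OF L(1) r sm] eq[OF m] by simp
    then have "?h (r \<odot>\<^bsub>M\<^esub> m) = free_left_module_lift S N y (r \<odot>\<^bsub>free_left_module S J\<^esub> s m)"
      using lift r sm by simp
    then show "?h (r \<odot>\<^bsub>M\<^esub> m) = r \<odot>\<^bsub>N\<^esub> ?h m"
      using left_module_hom_smult[OF L(2) r sm] by simp
  qed (use left_module_hom_closed[OF hT] left_module_hom_add[OF hT] in auto)
qed

end

context frobenius_extension
begin

text \<open>
  Lifts \<open>k n\<close> that are linear over the members \<open>C n\<close> of a chain of subrings differ by maps into the
  kernel of \<open>f\<close>. The trace condition approximates these differences by \<open>S\<close>-linear maps \<open>D n\<close> into the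
  kernel, which agree with them wherever the coefficients lie in \<open>C n\<close>. Subtracting the \<open>D n\<close> makes the
  lifts eventually constant at every basis element.
\<close>

lemma projective_module_chain:
  fixes M :: "('r, 'm) module" and C :: "nat \<Rightarrow> 'r set"
  assumes M: "left_module S M" and db: "dual_basis (S\<lparr>carrier := T\<rparr>) M J x s"
    and C: "\<And>n. subring (C n) S" and mono: "\<And>n. C n \<subseteq> C (Suc n)"
    and uv: "\<And>n t. t \<in> I \<Longrightarrow> u t \<in> C n" "\<And>n t. t \<in> I \<Longrightarrow> v t \<in> C n"
    and e: "\<And>n r. r \<in> C n \<Longrightarrow> e r \<in> C n"
    and proj: "\<And>n. projective_module (S\<lparr>carrier := C n\<rparr>) M"
    and coeff: "\<And>i. i \<in> J \<Longrightarrow> \<exists>n. \<forall>t \<in> I. \<forall>j. s (v t \<odot>\<^bsub>M\<^esub> x i) j \<in> C n"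
  shows "projective_module S M"
  unfolding projective_module_def
proof (intro conjI allI impI)
  show "left_module S M" by fact
  interpret M: left_module S M by fact
  fix N :: "('r, 'm \<Rightarrow> 'r) module" and B :: "('r, 'm) module" and f g
  assume N: "left_module S N" and B: "left_module S B" and f: "f \<in> left_module_hom S N B"
    and surj: "f ` carrier N = carrier B" and g: "g \<in> left_module_hom S M B"
  interpret N: left_module S N by fact
  interpret B: left_module S B by fact
  let ?C = "\<lambda>n. S\<lparr>carrier := C n\<rparr>"
  let ?T = "S\<lparr>carrier := T\<rparr>"
  note Csub = subringE(1)[OF C]
  have Cmono: "C m \<subseteq> C n" if "m \<le> n" for m n
    using mono that by (rule lift_Suc_mono_le)
  note CM = left_module_subring[OF M C] and CN = left_module_subring[OF N C]
    and CB = left_module_subring[OF B C]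
  note TM = left_module_subring[OF M T_subring] and TN = left_module_subring[OF N T_subring]
    and TB = left_module_subring[OF B T_subring]
  have x: "x \<in> J \<rightarrow> carrier M" and s: "s \<in> left_module_hom ?T M (free_left_module ?T J)"
    and eq: "\<And>m. m \<in> carrier M \<Longrightarrow> free_left_module_lift S M x (s m) = m"
    using db by (auto simp: dual_basis_def)
  have xc: "x j \<in> carrier M" if "j \<in> J" for j using x that by auto
  have "\<exists>k \<in> left_module_hom (?C n) M N. \<forall>m \<in> carrier M. f (k m) = g m" for n
    by (rule projective_module_lift[OF proj CN CB left_module_hom_subring[OF f Csub] surj
          left_module_hom_subring[OF g Csub]])
  then obtain k where k: "\<And>n. k n \<in> left_module_hom (?C n) M N"
    and fk: "\<And>n m. m \<in> carrier M \<Longrightarrow> f (k n m) = g m" by metis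
  note kc = left_module_hom_closed[OF k]
  have fe: "frobenius_extension (?C n) (T \<inter> C n) e I u v" for n
    by (rule frobenius_extension_subring[OF C uv e])
  \<comment> \<open>Projectivity over \<open>C n\<close> enters a second time, now through Higman's
    criterion relative to \<open>T \<inter> C n\<close>.\<close>
  have "\<exists>\<psi> \<in> left_module_hom (S\<lparr>carrier := T \<inter> C n\<rparr>) M M. \<forall>m \<in> carrier M. trace M M \<psi> m = m" for n
    using projective_module_dual_basis[OF proj] frobenius_extension.trace_eq_id[OF fe CM] by fastforce
  then obtain \<psi> where \<psi>: "\<And>n. \<psi> n \<in> left_module_hom (S\<lparr>carrier := T \<inter> C n\<rparr>) M M"
    and tr: "\<And>n m. m \<in> carrier M \<Longrightarrow> trace M M (\<psi> n) m = m" by metis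
  note \<psi>c = left_module_hom_closed[OF \<psi>]

  define d where "d n m = k (Suc n) m \<ominus>\<^bsub>N\<^esub> k n m" for n m
  have d: "d n \<in> left_module_hom (?C n) M N" for n
  proof -
    have "k (Suc n) \<in> left_module_hom (?C n) M N"
      using left_module_hom_subring[OF k[of "Suc n"], of "C n"] mono by simp
    from left_module_hom_diff_fun[OF CM CN this k] show ?thesis by (simp add: d_def[abs_def])
  qed
  note dc = left_module_hom_closed[OF d]
  have fd: "f (d n m) = \<zero>\<^bsub>B\<^esub>" if "m \<in> carrier M" for n m
    using that kc left_module_hom_closed[OF g that]
    by (simp add: d_def left_module_hom_minus[OF N B f] fk B.M.minus_eq B.M.r_neg)

  \<comment> \<open>\<open>d n \<circ> \<psi> n\<close> is linear over \<open>T \<inter> C n\<close>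
    only. Its values on the basis are extended along \<open>s\<close> to a map that is linear over
    all of \<open>T\<close>; the two agree at elements whose coordinates lie in
    \<open>C n\<close>.\<close>
  define L where "L n m = free_left_module_lift S N (\<lambda>j. d n (\<psi> n (x j))) (s m)" for n m
  have Y: "(\<lambda>j. d n (\<psi> n (x j))) \<in> J \<rightarrow> carrier N" for n
    using dc \<psi>c xc by auto
  have L: "L n \<in> left_module_hom ?T M N" for n
    using left_module_hom_comp[OF s left_module.free_left_module_lift_hom[OF TN Y]]
    by (simp add: L_def[abs_def])
  define D where "D n = trace M N (L n)" for n
  have D: "D n \<in> left_module_hom S M N" for n
    unfolding D_def by (rule trace_hom[OF M N L])
  note Dc = left_module_hom_closed[OF D]
  have vm: "v t \<odot>\<^bsub>M\<^esub> m \<in> carrier M" if "t \<in> I" "m \<in> carrier M" for t m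
    using that v_closed by simp
  have fL: "f (L n m) = \<zero>\<^bsub>B\<^esub>" if m: "m \<in> carrier M" for n m
  proof -
    note sm = left_module_hom_closed[OF s m]
    then have smj: "s m j \<in> carrier S" "s m j \<noteq> \<zero> \<Longrightarrow> j \<in> J" for j
      using T_subset by (auto simp: free_left_module_carrier)
    have "f (L n m) = free_left_module_lift S B (\<lambda>j. f (d n (\<psi> n (x j)))) (s m)"
      using free_left_module_lift_comp[OF TN TB left_module_hom_subring[OF f T_subset] Y sm]
      by (simp add: L_def)
    also have "\<dots> = \<zero>\<^bsub>B\<^esub>"
      unfolding free_left_module_lift_def
      by (rule B.M.add.finprod_one_eqI) (use smj fd \<psi>c xc in \<open>simp add: B.smult_zero\<close>)
    finally show ?thesis .
  qed
  have fD: "f (D n m) = \<zero>\<^bsub>B\<^esub>" if m: "m \<in> carrier M" for n m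
  proof -
    have Lv: "L n (v t \<odot>\<^bsub>M\<^esub> m) \<in> carrier N" if "t \<in> I" for t
      using left_module_hom_closed[OF L vm[OF that m]] .
    have "f (D n m) = finsum B (\<lambda>t. f (u t \<odot>\<^bsub>N\<^esub> L n (v t \<odot>\<^bsub>M\<^esub> m))) I"
      unfolding D_def trace_def
      by (rule left_module_hom_finsum[OF N B f I_finite]) (use Lv u_closed in auto)
    also have "\<dots> = \<zero>\<^bsub>B\<^esub>"
      by (rule B.M.add.finprod_one_eqI)
         (use Lv fL vm m u_closed in \<open>simp add: left_module_hom_smult[OF f] B.smult_zero\<close>)
    finally show ?thesis .
  qed
  \<comment> \<open>Under the assumption on coordinates, \<open>L n\<close> is
    \<open>d n \<circ> \<psi> n\<close> at all \<open>v t m\<close>. The \<open>u t\<close> lie in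
    \<open>C n\<close> and can be moved inside \<open>d n\<close>, where the trace of
    \<open>\<psi> n\<close> remains, that is, \<open>m\<close>.\<close>
  have D_eq: "D n m = d n m"
    if m: "m \<in> carrier M" and c: "\<forall>t \<in> I. \<forall>j. s (v t \<odot>\<^bsub>M\<^esub> m) j \<in> C n" for n m
  proof -
    let ?TC = "S\<lparr>carrier := T \<inter> C n\<rparr>"
    have TC: "subring (T \<inter> C n) S" by (rule subring_inter[OF T_subring C])
    have dTC: "d n \<in> left_module_hom ?TC M N"
      using left_module_hom_subring[OF d, of "T \<inter> C n"] by simp
    have Lv: "L n (v t \<odot>\<^bsub>M\<^esub> m) = d n (\<psi> n (v t \<odot>\<^bsub>M\<^esub> m))" if t: "t \<in> I" for t
    proof -
      have "s (v t \<odot>\<^bsub>M\<^esub> m) \<in> carrier (free_left_module ?TC J)"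
        using left_module_hom_closed[OF s vm[OF t m]] c t by (simp add: free_left_module_carrier)
      from free_left_module_lift_comp[OF left_module_subring[OF M TC] left_module_subring[OF N TC]
          left_module_hom_comp[OF \<psi> dTC] x this]
      show ?thesis by (simp add: L_def eq vm t m)
    qed
    have \<psi>v: "\<psi> n (v t \<odot>\<^bsub>M\<^esub> m) \<in> carrier M" if "t \<in> I" for t
      using \<psi>c vm[OF that m] .
    have "D n m = finsum N (\<lambda>t. d n (u t \<odot>\<^bsub>M\<^esub> \<psi> n (v t \<odot>\<^bsub>M\<^esub> m))) I"
      unfolding D_def trace_def
      by (rule N.M.finsum_cong')
         (use Lv \<psi>v dc uv u_closed left_module_hom_smult[OF d[of n]] in auto)
    also have "\<dots> = d n (trace M M (\<psi> n) m)"
      unfolding trace_def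
      by (rule left_module_hom_finsum[OF CM CN d I_finite, symmetric]) (use \<psi>v u_closed in auto)
    finally show ?thesis by (simp add: tr m)
  qed

  \<comment> \<open>\<open>P n\<close> is the sum of the \<open>D i\<close> with
    \<open>i < n\<close>, an \<open>S\<close>-linear map into the kernel of
    \<open>f\<close>.\<close>
  define P where "P = rec_nat (\<lambda>m. \<zero>\<^bsub>N\<^esub>) (\<lambda>n p m. p m \<oplus>\<^bsub>N\<^esub> D n m)"
  have P0: "P 0 m = \<zero>\<^bsub>N\<^esub>" and PSuc: "P (Suc n) m = P n m \<oplus>\<^bsub>N\<^esub> D n m" for n m
    by (simp_all add: P_def)
  have P: "P n \<in> left_module_hom S M N" for n
  proof (induction n)
    case 0
    show ?case by (rule left_module_homI) (simp_all add: P0 N.smult_zero)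
  next
    case (Suc n)
    from left_module_hom_add_fun[OF M N Suc D[of n]] show ?case by (simp add: PSuc[abs_def])
  qed
  note Pc = left_module_hom_closed[OF P]
  have fP: "f (P n m) = \<zero>\<^bsub>B\<^esub>" if "m \<in> carrier M" for n m
    by (induction n)
       (simp_all add: P0 PSuc that Pc Dc left_module_hom_zero[OF N B f] left_module_hom_add[OF f] fD)
  define q where "q n m = k n m \<ominus>\<^bsub>N\<^esub> P n m" for n m
  have q: "q n \<in> left_module_hom (?C n) M N" for n
    using left_module_hom_diff_fun[OF CM CN k left_module_hom_subring[OF P Csub]]
    by (simp add: q_def[abs_def])
  note qc = left_module_hom_closed[OF q]
  have fq: "f (q n m) = g m" if "m \<in> carrier M" for n m
    using that left_module_hom_closed[OF g that]
    by (simp add: q_def left_module_hom_minus[OF N B f] kc Pc fk fP B.M.minus_eq)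
  \<comment> \<open>The two sides differ by \<open>d n m - D n m\<close>.\<close>
  have q_Suc: "q (Suc n) m = q n m"
    if m: "m \<in> carrier M" and "\<forall>t \<in> I. \<forall>j. s (v t \<odot>\<^bsub>M\<^esub> m) j \<in> C n" for n m
  proof -
    have "k (Suc n) m \<oplus>\<^bsub>N\<^esub> (\<ominus>\<^bsub>N\<^esub> P n m \<oplus>\<^bsub>N\<^esub> (k n m \<oplus>\<^bsub>N\<^esub> \<ominus>\<^bsub>N\<^esub> k (Suc n) m))
        = (k n m \<oplus>\<^bsub>N\<^esub> \<ominus>\<^bsub>N\<^esub> P n m) \<oplus>\<^bsub>N\<^esub> (k (Suc n) m \<oplus>\<^bsub>N\<^esub> \<ominus>\<^bsub>N\<^esub> k (Suc n) m)"
      using m kc Pc by (simp only: N.M.a_ac N.M.a_inv_closed N.M.a_closed)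
    then show ?thesis
      using m kc Pc D_eq[OF that]
      by (simp add: q_def PSuc d_def N.M.minus_eq N.M.minus_add N.M.minus_minus N.M.r_neg N.M.a_comm)
  qed

  \<comment> \<open>From stage \<open>n0 i\<close> on, the value \<open>q n (x i)\<close> no longer
    changes.\<close>
  obtain n0 where n0: "\<And>i t j. \<lbrakk>i \<in> J; t \<in> I\<rbrakk> \<Longrightarrow> s (v t \<odot>\<^bsub>M\<^esub> x i) j \<in> C (n0 i)"
    using coeff by metis
  define y where "y i = q (n0 i) (x i)" for i
  have y: "y \<in> J \<rightarrow> carrier N" using qc xc by (auto simp: y_def)
  have q_y: "q n (x i) = y i" if i: "i \<in> J" and "n0 i \<le> n" for n i
    using that(2)
  proof (induction n rule: dec_induct)
    case base
    show ?case by (simp add: y_def)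
  next
    case (step n)
    have "\<forall>t \<in> I. \<forall>j. s (v t \<odot>\<^bsub>M\<^esub> x i) j \<in> C n"
      using n0[OF i] Cmono[OF step(1)] by blast
    from q_Suc[OF xc[OF i] this] step show ?case by simp
  qed
  have h: "free_left_module_lift S N y (s (v t \<odot>\<^bsub>M\<^esub> x i)) = v t \<odot>\<^bsub>N\<^esub> y i"
    if i: "i \<in> J" and t: "t \<in> I" for i t
  proof -
    let ?m = "v t \<odot>\<^bsub>M\<^esub> x i"
    have m: "?m \<in> carrier M" using vm[OF t xc[OF i]] .
    note sm = left_module_hom_closed[OF s m]
    have fin: "finite {j. s ?m j \<noteq> \<zero>}" using sm by (simp add: free_left_module_carrier)
    \<comment> \<open>A stage at which \<open>q n\<close> has its final values at \<open>x i\<close>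
      and at every \<open>x j\<close> that occurs in \<open>v t (x i)\<close>, and at which the
      coefficients of \<open>v t (x i)\<close> lie in \<open>C n\<close>. The limit can then be
      replaced by the \<open>C n\<close>-linear map \<open>q n\<close>.\<close>
    define n where "n = Max (insert (n0 i) (n0 ` {j. s ?m j \<noteq> \<zero>}))"
    have ni: "n0 i \<le> n" and nj: "\<And>j. s ?m j \<noteq> \<zero> \<Longrightarrow> n0 j \<le> n"
      using fin by (auto simp: n_def)
    have cm: "s ?m \<in> carrier (free_left_module (?C n) J)"
      using sm n0[OF i t] Cmono[OF ni] by (auto simp: free_left_module_carrier)
    have "free_left_module_lift S N y (s ?m) = free_left_module_lift S N (\<lambda>j. q n (x j)) (s ?m)"
      using left_module.free_left_module_lift_cong[OF CN cm, of y "\<lambda>j. q n (x j)"]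
        q_y nj funcset_mem[OF y] qc xc by simp
    also have "\<dots> = q n (free_left_module_lift S M x (s ?m))"
      using free_left_module_lift_comp[OF CM CN q x cm] by simp
    also have "\<dots> = q n ?m" using eq[OF m] by simp
    also have "\<dots> = v t \<odot>\<^bsub>N\<^esub> q n (x i)"
      using left_module_hom_smult[OF q, of "v t" n "x i"] uv t xc i by simp
    finally show ?thesis using q_y[OF i ni] by simp
  qed
  show "\<exists>h \<in> left_module_hom S M N. \<forall>m \<in> carrier M. f (h m) = g m"
  proof (intro bexI ballI)
    show "(\<lambda>m. free_left_module_lift S N y (s m)) \<in> left_module_hom S M N"
      by (rule hom_from_subring[OF M N db y h])
    fix m assume m: "m \<in> carrier M"
    note sm = left_module_hom_closed[OF s m]
    have "f (free_left_module_lift S N y (s m)) = free_left_module_lift S B (\<lambda>j. f (y j)) (s m)"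
      using free_left_module_lift_comp[OF TN TB left_module_hom_subring[OF f T_subset] y sm] by simp
    also have "\<dots> = free_left_module_lift S B (\<lambda>j. g (x j)) (s m)"
      using left_module.free_left_module_lift_cong[OF TB sm, of "\<lambda>j. f (y j)" "\<lambda>j. g (x j)"]
        fq xc left_module_hom_closed[OF g] by (simp add: y_def)
    also have "\<dots> = g m"
      using free_left_module_lift_comp[OF TM TB left_module_hom_subring[OF g T_subset] x sm] eq[OF m]
      by simp
    finally show "f (free_left_module_lift S N y (s m)) = g m" .
  qed
qed

end

section \<open>Reduction to countable dual bases\<close>

context frobenius_extension
begin

section \<open>Submodules given by vanishing coordinates\<close>

definition supported :: "('r, 'm, 'y) module_scheme \<Rightarrow> ('m \<Rightarrow> 'i \<Rightarrow> 'r) \<Rightarrow> 'i set \<Rightarrow> 'm set"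
  where "supported M s J' = {m \<in> carrier M. \<forall>j. j \<notin> J' \<longrightarrow> s m j = \<zero>}"

text \<open>A dual basis need not be free, so \<open>x i\<close> may have coordinates outside
  \<open>{i}\<close>. For a saturated \<open>J' \<subseteq> J\<close> the set
  \<open>supported M s J'\<close> turns out to be the \<open>S\<close>-submodule generated by the
  \<open>x i\<close> with \<open>i \<in> J'\<close>, although only the finitely many
  \<open>v t\<close> are tested.\<close>

definition saturated ::
    "('r, 'm, 'y) module_scheme \<Rightarrow> ('i \<Rightarrow> 'm) \<Rightarrow> ('m \<Rightarrow> 'i \<Rightarrow> 'r) \<Rightarrow> 'i set \<Rightarrow> bool"
  where "saturated M x s J' \<longleftrightarrow> (\<forall>i \<in> J'. \<forall>t \<in> I. v t \<odot>\<^bsub>M\<^esub> x i \<in> supported M s J')"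

lemma supported_mono: "J1 \<subseteq> J2 \<Longrightarrow> supported M s J1 \<subseteq> supported M s J2"
  by (auto simp: supported_def)

context
  fixes M :: "('r, 'm, 'y) module_scheme" and J :: "'i set" and x s
  assumes M: "left_module S M" and db: "dual_basis (S\<lparr>carrier := T\<rparr>) M J x s"
begin

lemma basis_hom: "s \<in> left_module_hom (S\<lparr>carrier := T\<rparr>) M (free_left_module (S\<lparr>carrier := T\<rparr>) J)"
  and basis_closed: "j \<in> J \<Longrightarrow> x j \<in> carrier M"
  and basis_eq: "m \<in> carrier M \<Longrightarrow> free_left_module_lift S M x (s m) = m"
  using db by (auto simp: dual_basis_def)

lemma coeff_closed: "m \<in> carrier M \<Longrightarrow> s m \<in> carrier (free_left_module S J)"
  using free_left_module_mono[where C = T and C' = "carrier S", OF left_module_hom_closed[OF basis_hom]]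
    T_subset by simp

lemma coeff_add: "\<lbrakk>m \<in> carrier M; m' \<in> carrier M\<rbrakk> \<Longrightarrow> s (m \<oplus>\<^bsub>M\<^esub> m') j = s m j \<oplus> s m' j"
  using left_module_hom_add[OF basis_hom] by (simp add: free_left_module_add)

lemma coeff_smult: "\<lbrakk>r \<in> T; m \<in> carrier M\<rbrakk> \<Longrightarrow> s (r \<odot>\<^bsub>M\<^esub> m) j = r \<otimes> s m j"
  using left_module_hom_smult[OF basis_hom] by (simp add: free_left_module_smult)

lemma coeff_zero: "s \<zero>\<^bsub>M\<^esub> j = \<zero>"
proof -
  interpret T: ring "S\<lparr>carrier := T\<rparr>" by (rule subring_is_ring[OF T_subring])
  show ?thesis
    using left_module_hom_zero[OF left_module_subring[OF M T_subring] T.left_module_free basis_hom]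
    by (simp add: free_left_module_zero)
qed

lemma supported_zero: "\<zero>\<^bsub>M\<^esub> \<in> supported M s J'"
proof -
  interpret M: left_module S M by (rule M)
  show ?thesis by (simp add: supported_def coeff_zero)
qed

lemma supported_add:
  "\<lbrakk>m \<in> supported M s J'; m' \<in> supported M s J'\<rbrakk> \<Longrightarrow> m \<oplus>\<^bsub>M\<^esub> m' \<in> supported M s J'"
proof -
  interpret M: left_module S M by (rule M)
  show "\<lbrakk>m \<in> supported M s J'; m' \<in> supported M s J'\<rbrakk> \<Longrightarrow> m \<oplus>\<^bsub>M\<^esub> m' \<in> supported M s J'"
    by (simp add: supported_def coeff_add)
qed

lemma supported_subset: "supported M s J' \<subseteq> carrier M"
  by (auto simp: supported_def)

text \<open>\<open>r (x i)\<close> is a combination of the \<open>v t (x i)\<close> with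
  coefficients in \<open>T\<close>, and scalars from \<open>T\<close> do not enlarge supports
  because \<open>s\<close> is \<open>T\<close>-linear.\<close>

lemma supported_smult_basis:
  assumes "saturated M x s J'" "J' \<subseteq> J" and r: "r \<in> carrier S" and i: "i \<in> J'"
  shows "r \<odot>\<^bsub>M\<^esub> x i \<in> supported M s J'"
proof -
  interpret M: left_module S M by (rule M)
  have xi: "x i \<in> carrier M" using assms basis_closed by auto
  have vx: "v t \<odot>\<^bsub>M\<^esub> x i \<in> supported M s J'" if "t \<in> I" for t
    using assms(1) i that by (auto simp: saturated_def)
  have "e (r \<otimes> u t) \<odot>\<^bsub>M\<^esub> (v t \<odot>\<^bsub>M\<^esub> x i) \<in> supported M s J'" if t: "t \<in> I" for t
  proof -
    have er: "e (r \<otimes> u t) \<in> T" "e (r \<otimes> u t) \<in> carrier S"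
      using t r by (simp_all add: e_closed e_closed' u_closed)
    show ?thesis
      using vx[OF t] er by (auto simp: supported_def coeff_smult)
  qed
  then have "finsum M (\<lambda>t. e (r \<otimes> u t) \<odot>\<^bsub>M\<^esub> (v t \<odot>\<^bsub>M\<^esub> x i)) I \<in> supported M s J'"
    by (intro M.M.finsum_in_subset I_finite supported_subset supported_zero supported_add) auto
  moreover have "(\<lambda>m. m) \<in> left_module_hom (S\<lparr>carrier := T\<rparr>) M M"
    by (simp add: left_module_hom_def)
  from hom_expansion[OF M M this r xi]
  have "r \<odot>\<^bsub>M\<^esub> x i = finsum M (\<lambda>t. e (r \<otimes> u t) \<odot>\<^bsub>M\<^esub> (v t \<odot>\<^bsub>M\<^esub> x i)) I" .
  ultimately show ?thesis by simp
qed

text \<open>\<open>s\<close> gives no direct control over scalars outside \<open>T\<close>. But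
  \<open>m\<close> is a combination of basis elements with index in \<open>J'\<close>, so the case
  of basis elements suffices.\<close>

lemma supported_smult:
  assumes "saturated M x s J'" "J' \<subseteq> J" and r: "r \<in> carrier S" and m: "m \<in> supported M s J'"
  shows "r \<odot>\<^bsub>M\<^esub> m \<in> supported M s J'"
proof -
  interpret M: left_module S M by (rule M)
  interpret F: left_module S "free_left_module S J" by (rule left_module_free)
  have mc: "m \<in> carrier M" using m by (simp add: supported_def)
  have xP: "x \<in> J \<rightarrow> carrier M" using basis_closed by auto
  have rs: "r \<odot>\<^bsub>free_left_module S J\<^esub> s m \<in> carrier (free_left_module S J)"
    using r coeff_closed[OF mc] by simp
  have smj: "s m j \<in> carrier S" for j
    using coeff_closed[OF mc] by (simp add: free_left_module_carrier)
  have "free_left_module_lift S M x (r \<odot>\<^bsub>free_left_module S J\<^esub> s m) \<in> supported M s J'"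
  proof (rule M.free_left_module_lift_in_submodule[OF rs supported_subset supported_zero supported_add])
    fix j assume "(r \<odot>\<^bsub>free_left_module S J\<^esub> s m) j \<noteq> \<zero>"
    then have "s m j \<noteq> \<zero>" using r by (auto simp: free_left_module_smult)
    then have "j \<in> J'" using m by (auto simp: supported_def)
    then show "(r \<odot>\<^bsub>free_left_module S J\<^esub> s m) j \<odot>\<^bsub>M\<^esub> x j \<in> supported M s J'"
      using supported_smult_basis[OF assms(1,2)] r smj by (simp add: free_left_module_smult)
  qed
  also have "free_left_module_lift S M x (r \<odot>\<^bsub>free_left_module S J\<^esub> s m) = r \<odot>\<^bsub>M\<^esub> m"
    using left_module_hom_smult[OF M.free_left_module_lift_hom[OF xP] r coeff_closed[OF mc]]
      basis_eq[OF mc] by simp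
  finally show ?thesis .
qed

lemma supported_basis:
  assumes "saturated M x s J'" "J' \<subseteq> J" "i \<in> J'"
  shows "x i \<in> supported M s J'"
proof -
  interpret M: left_module S M by (rule M)
  show ?thesis
    using supported_smult_basis[OF assms(1,2) one_closed assms(3)] basis_closed assms(2,3)
    by (simp add: subset_eq)
qed

lemma supported_module:
  assumes "saturated M x s J'" "J' \<subseteq> J"
  shows "left_module S (M\<lparr>carrier := supported M s J'\<rparr>)"
  using M supported_subset supported_zero supported_add supported_smult[OF assms]
  by (rule left_module_submodule)

lemma supported_dual_basis:
  assumes "saturated M x s J'" "J' \<subseteq> J"
  shows "dual_basis (S\<lparr>carrier := T\<rparr>) (M\<lparr>carrier := supported M s J'\<rparr>) J' x s"
proof -
  let ?M = "M\<lparr>carrier := supported M s J'\<rparr>" and ?T = "S\<lparr>carrier := T\<rparr>"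
  note M' = supported_module[OF assms]
  have xP: "x \<in> J' \<rightarrow> carrier ?M" using supported_basis[OF assms] by auto
  have s': "s m \<in> carrier (free_left_module ?T J')" if "m \<in> supported M s J'" for m
    using that left_module_hom_closed[OF basis_hom, of m]
    by (auto simp: supported_def free_left_module_carrier)
  show ?thesis
    unfolding dual_basis_def
  proof (intro conjI ballI xP)
    show "s \<in> left_module_hom ?T ?M (free_left_module ?T J')"
    proof (rule left_module_homI)
      fix m m' assume "m \<in> carrier ?M" "m' \<in> carrier ?M"
      then show "s (m \<oplus>\<^bsub>?M\<^esub> m') = s m \<oplus>\<^bsub>free_left_module ?T J'\<^esub> s m'"
        by (intro ext) (simp add: supported_def free_left_module_add coeff_add)
    next
      fix r m assume "r \<in> carrier ?T" "m \<in> carrier ?M"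
      then show "s (r \<odot>\<^bsub>?M\<^esub> m) = r \<odot>\<^bsub>free_left_module ?T J'\<^esub> s m"
        by (intro ext) (simp add: supported_def free_left_module_smult coeff_smult)
    qed (use s' in simp)
    fix m assume "m \<in> carrier ?M"
    then have m: "m \<in> supported M s J'" "m \<in> carrier M" by (auto simp: supported_def)
    have "(\<lambda>m. m) \<in> left_module_hom ?T ?M M"
      using supported_subset by (auto simp: left_module_hom_def)
    from free_left_module_lift_comp[OF left_module_subring[OF M' T_subring]
        left_module_subring[OF M T_subring] this xP s'[OF m(1)]]
    show "free_left_module_lift ?T ?M x (s m) = m" using basis_eq[OF m(2)] by simp
  qed
qed

text \<open>Reduces membership of \<open>m\<close> to the finitely many basis elements that occur in
  it, even if their indices lie outside \<open>J'\<close>.\<close>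

lemma supported_if_basis_supported:
  assumes "saturated M x s J'" "J' \<subseteq> J" "m \<in> carrier M"
    and "\<And>j. s m j \<noteq> \<zero> \<Longrightarrow> x j \<in> supported M s J'"
  shows "m \<in> supported M s J'"
proof -
  interpret M: left_module S M by (rule M)
  note sm = coeff_closed[OF assms(3)]
  have "free_left_module_lift S M x (s m) \<in> supported M s J'"
  proof (rule M.free_left_module_lift_in_submodule[OF sm supported_subset supported_zero supported_add])
    fix j assume "s m j \<noteq> \<zero>"
    then show "s m j \<odot>\<^bsub>M\<^esub> x j \<in> supported M s J'"
      using supported_smult[OF assms(1,2)] assms(4) sm by (simp add: free_left_module_carrier)
  qed
  then show ?thesis using basis_eq[OF assms(3)] by simp
qed

end

text \<open>
  The quotient of \<open>M\<close> by \<open>supported M s J'\<close> is realised inside \<open>M\<close>, as the image of a \<open>T\<close>-linear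
  projection \<open>\<rho>\<close>. This keeps the type of the elements, which is fixed in the hypothesis on modules
  with countable dual bases.
\<close>

lemma supported_quotient:
  fixes M :: "('r, 'm) module" and J :: "'i set"
  assumes M: "left_module S M" and db: "dual_basis (S\<lparr>carrier := T\<rparr>) M J x s"
    and J': "saturated M x s J'" "J' \<subseteq> J"
  obtains Q :: "('r, 'm) module" and \<rho> y s' where "left_module S Q" "\<rho> \<in> left_module_hom S M Q"
    "\<rho> ` carrier M = carrier Q" "\<And>m. m \<in> carrier M \<Longrightarrow> \<rho> m = \<zero>\<^bsub>Q\<^esub> \<longleftrightarrow> m \<in> supported M s J'"
    "dual_basis (S\<lparr>carrier := T\<rparr>) Q (J - J') y s'"
proof -
  interpret M: left_module S M by (rule M)
  let ?T = "S\<lparr>carrier := T\<rparr>"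
  let ?V = "supported M s J'"
  note TM = left_module_subring[OF M T_subring]
  interpret TM: left_module ?T M by (rule TM)
  note bh = basis_hom[OF M db] and bc = basis_closed[OF M db] and be = basis_eq[OF M db]
  note V = supported_subset[OF M db, of J'] supported_zero[OF M db, of J']
    supported_add[OF M db, of _ J'] supported_smult[OF M db J']
  let ?a = "\<lambda>i. if i \<in> J' then x i else \<zero>\<^bsub>M\<^esub>"
  let ?b = "\<lambda>i. if i \<in> J' then \<zero>\<^bsub>M\<^esub> else x i"
  \<comment> \<open>The coordinates in \<open>J'\<close> are dropped. Then
    \<open>m - \<rho> m\<close> lies in the submodule and \<open>\<rho>\<close> vanishes on it, so
    \<open>\<rho>\<close> is a projection with the submodule as kernel.\<close>
  define \<rho> where "\<rho> m = free_left_module_lift S M ?b (s m)" for m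
  have bP: "?b \<in> J \<rightarrow> carrier M" using bc by auto
  have \<rho>: "\<rho> \<in> left_module_hom ?T M M"
    using left_module_hom_comp[OF bh TM.free_left_module_lift_hom[OF bP]] by (simp add: \<rho>_def[abs_def])
  note \<rho>c = left_module_hom_closed[OF \<rho>] and \<rho>_add = left_module_hom_add[OF \<rho>]
  have \<rho>0: "\<rho> m = \<zero>\<^bsub>M\<^esub>" if "m \<in> ?V" for m
  proof -
    have m: "m \<in> carrier M" using that V by auto
    have smj: "s m i \<in> carrier S" for i
      using coeff_closed[OF M db m] by (simp add: free_left_module_carrier)
    show ?thesis
      unfolding \<rho>_def free_left_module_lift_def
    proof (rule M.M.add.finprod_one_eqI)
      fix i assume "i \<in> {i. s m i \<noteq> \<zero>}"
      then have "i \<in> J'" using that by (auto simp: supported_def)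
      then show "s m i \<odot>\<^bsub>M\<^esub> ?b i = \<zero>\<^bsub>M\<^esub>" using smj by (simp add: M.smult_zero)
    qed
  qed
  have split: "\<exists>w \<in> ?V. m = w \<oplus>\<^bsub>M\<^esub> \<rho> m" if m: "m \<in> carrier M" for m
  proof
    note sm = coeff_closed[OF M db m]
    then have F: "finite {i. s m i \<noteq> \<zero>}" "{i. s m i \<noteq> \<zero>} \<subseteq> J" and smj: "\<And>i. s m i \<in> carrier S"
      by (auto simp: free_left_module_carrier)
    show "free_left_module_lift S M ?a (s m) \<in> ?V"
      by (rule M.free_left_module_lift_in_submodule[OF sm V(1,2,3)])
         (use supported_smult_basis[OF M db J'] V(2) smj in \<open>simp_all add: M.smult_zero\<close>)
    have "m = finsum M (\<lambda>i. s m i \<odot>\<^bsub>M\<^esub> x i) {i. s m i \<noteq> \<zero>}"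
      using be[OF m] by (simp add: free_left_module_lift_def)
    also have "\<dots> = finsum M (\<lambda>i. s m i \<odot>\<^bsub>M\<^esub> ?a i \<oplus>\<^bsub>M\<^esub> s m i \<odot>\<^bsub>M\<^esub> ?b i) {i. s m i \<noteq> \<zero>}"
      by (rule M.M.finsum_cong') (use F smj bc in \<open>auto simp: M.smult_zero subset_eq\<close>)
    also have "\<dots> = free_left_module_lift S M ?a (s m) \<oplus>\<^bsub>M\<^esub> \<rho> m"
      unfolding \<rho>_def free_left_module_lift_def
      by (rule M.M.finsum_addf) (use F smj bc in auto)
    finally show "m = free_left_module_lift S M ?a (s m) \<oplus>\<^bsub>M\<^esub> \<rho> m" .
  qed
  \<comment> \<open>\<open>m\<close> and \<open>\<rho> m\<close> differ by an element of the
    submodule, which is stable under \<open>r\<close> and killed by \<open>\<rho>\<close>. This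
    identity makes the action on \<open>Q\<close> associative.\<close>
  have smult_\<rho>: "\<rho> (r \<odot>\<^bsub>M\<^esub> \<rho> m) = \<rho> (r \<odot>\<^bsub>M\<^esub> m)" if r: "r \<in> carrier S" and m: "m \<in> carrier M" for r m
  proof -
    obtain w where w: "w \<in> ?V" "m = w \<oplus>\<^bsub>M\<^esub> \<rho> m" using split[OF m] by blast
    then have wc: "w \<in> carrier M" using V by auto
    have "r \<odot>\<^bsub>M\<^esub> m = r \<odot>\<^bsub>M\<^esub> w \<oplus>\<^bsub>M\<^esub> r \<odot>\<^bsub>M\<^esub> \<rho> m"
      using M.smult_r_distr[OF r wc \<rho>c[OF m]] w(2) by simp
    then show ?thesis
      using \<rho>_add[of "r \<odot>\<^bsub>M\<^esub> w" "r \<odot>\<^bsub>M\<^esub> \<rho> m"] \<rho>0[OF V(4)[OF r w(1)]] r wc \<rho>c m by simp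
  qed
  have idem: "\<rho> (\<rho> m) = \<rho> m" if "m \<in> carrier M" for m
    using smult_\<rho>[OF one_closed that] that \<rho>c by simp
  \<comment> \<open>\<open>\<rho>\<close> need not be linear over \<open>S\<close>, so its image
    need not be stable under the scalars of \<open>M\<close>; the action is that of the quotient,
    carried over to representatives.\<close>
  define Q where "Q = M\<lparr>carrier := \<rho> ` carrier M, smult := \<lambda>r q. \<rho> (r \<odot>\<^bsub>M\<^esub> q)\<rparr>"
  have Q: "carrier Q = \<rho> ` carrier M" "\<zero>\<^bsub>Q\<^esub> = \<zero>\<^bsub>M\<^esub>" "x \<oplus>\<^bsub>Q\<^esub> y = x \<oplus>\<^bsub>M\<^esub> y" "r \<odot>\<^bsub>Q\<^esub> y = \<rho> (r \<odot>\<^bsub>M\<^esub> y)"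
    for x y r
    by (simp_all add: Q_def)
  have Qc: "q \<in> carrier M" "\<rho> q = q" if "q \<in> carrier Q" for q
    using that \<rho>c idem by (auto simp: Q)
  have QI: "\<rho> m \<in> carrier Q" if "m \<in> carrier M" for m using that by (simp add: Q)
  have "abelian_group Q"
  proof (rule abelian_groupI)
    fix q assume q: "q \<in> carrier Q"
    show "\<exists>q' \<in> carrier Q. q' \<oplus>\<^bsub>Q\<^esub> q = \<zero>\<^bsub>Q\<^esub>"
    proof
      have "\<rho> (\<ominus>\<^bsub>M\<^esub> q \<oplus>\<^bsub>M\<^esub> q) = \<rho> (\<ominus>\<^bsub>M\<^esub> q) \<oplus>\<^bsub>M\<^esub> \<rho> q"
        using Qc[OF q] by (intro \<rho>_add) auto
      then show "\<rho> (\<ominus>\<^bsub>M\<^esub> q) \<oplus>\<^bsub>Q\<^esub> q = \<zero>\<^bsub>Q\<^esub>"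
        using Qc[OF q] \<rho>0[OF V(2)] by (simp add: Q M.M.l_neg)
      show "\<rho> (\<ominus>\<^bsub>M\<^esub> q) \<in> carrier Q" using QI Qc[OF q] by simp
    qed
  next
    fix q q' assume q: "q \<in> carrier Q" "q' \<in> carrier Q"
    then show "q \<oplus>\<^bsub>Q\<^esub> q' \<in> carrier Q"
      using QI[of "q \<oplus>\<^bsub>M\<^esub> q'"] \<rho>_add[of q q'] Qc by (simp add: Q(3))
  next
    show "\<zero>\<^bsub>Q\<^esub> \<in> carrier Q" using QI[of "\<zero>\<^bsub>M\<^esub>"] \<rho>0[OF V(2)] by (simp add: Q)
  qed (simp_all add: Q(2,3) Qc M.M.a_ac)
  then have QM: "left_module S Q"
    by (intro left_module.intro left_module_axioms.intro ring_axioms)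
       (simp_all add: Q(3,4) Qc QI \<rho>_add M.smult_l_distr M.smult_r_distr M.smult_assoc1 smult_\<rho>)
  have \<rho>Q: "\<rho> \<in> left_module_hom S M Q"
    by (rule left_module_homI) (simp_all add: QI Q(3,4) \<rho>_add smult_\<rho>)
  have ker: "\<rho> m = \<zero>\<^bsub>Q\<^esub> \<longleftrightarrow> m \<in> ?V" if m: "m \<in> carrier M" for m
  proof
    assume "\<rho> m = \<zero>\<^bsub>Q\<^esub>"
    moreover obtain w where "w \<in> ?V" "m = w \<oplus>\<^bsub>M\<^esub> \<rho> m" using split[OF m] by blast
    ultimately show "m \<in> ?V" using V(1) by (auto simp: Q(2))
  qed (simp add: \<rho>0 Q(2))
  let ?s = "\<lambda>q i. if i \<in> J' then \<zero> else s q i"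
  have QT: "r \<odot>\<^bsub>Q\<^esub> q = r \<odot>\<^bsub>M\<^esub> q" if "r \<in> T" "q \<in> carrier Q" for r q
    using left_module_hom_smult[OF \<rho>, of r q] that Qc by (simp add: Q(4))
  have "dual_basis ?T Q (J - J') (\<lambda>i. \<rho> (x i)) ?s"
    unfolding dual_basis_def
  proof (intro conjI ballI)
    show xQ: "(\<lambda>i. \<rho> (x i)) \<in> J - J' \<rightarrow> carrier Q" using QI bc by auto
    have sc: "?s q \<in> carrier (free_left_module ?T (J - J'))" if q: "q \<in> carrier Q" for q
    proof -
      have sq: "s q \<in> carrier (free_left_module ?T J)"
        using left_module_hom_closed[OF bh] Qc(1)[OF q] .
      have "{i. ?s q i \<noteq> \<zero>} \<subseteq> {i. s q i \<noteq> \<zero>}" by auto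
      moreover have "finite {i. s q i \<noteq> \<zero>}" using sq by (simp add: free_left_module_carrier)
      ultimately have "finite {i. ?s q i \<noteq> \<zero>}" by (rule finite_subset)
      then show ?thesis using sq subringE(2)[OF T_subring] by (simp add: free_left_module_carrier)
    qed
    show "?s \<in> left_module_hom ?T Q (free_left_module ?T (J - J'))"
    proof (rule left_module_homI)
      fix q q' assume "q \<in> carrier Q" "q' \<in> carrier Q"
      then show "?s (q \<oplus>\<^bsub>Q\<^esub> q') = ?s q \<oplus>\<^bsub>free_left_module ?T (J - J')\<^esub> ?s q'"
        by (intro ext) (simp add: free_left_module_add Q(3) Qc coeff_add[OF M db])
    next
      fix r q assume "r \<in> carrier ?T" "q \<in> carrier Q"
      then show "?s (r \<odot>\<^bsub>Q\<^esub> q) = r \<odot>\<^bsub>free_left_module ?T (J - J')\<^esub> ?s q"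
        using T_subset
        by (intro ext) (auto simp add: free_left_module_smult QT Qc coeff_smult[OF M db])
    qed (rule sc)
    fix q assume q: "q \<in> carrier Q"
    have sq: "s q \<in> carrier (free_left_module ?T J)"
      using left_module_hom_closed[OF bh] Qc(1)[OF q] .
    interpret Q: left_module S Q by (rule QM)
    \<comment> \<open>Basis elements with index in \<open>J'\<close> become zero in
      \<open>Q\<close>, so their coordinates can be omitted.\<close>
    have \<rho>x: "\<rho> (x i) = \<zero>\<^bsub>Q\<^esub>" if "i \<in> J'" for i
      using \<rho>0[OF supported_basis[OF M db J' that]] by (simp add: Q(2))
    have "q = \<rho> (free_left_module_lift S M x (s q))" using be Qc[OF q] by simp
    also have "\<dots> = free_left_module_lift S Q (\<lambda>i. \<rho> (x i)) (s q)"
      using free_left_module_lift_comp[OF TM left_module_subring[OF QM T_subring]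
          left_module_hom_subring[OF \<rho>Q T_subset] _ sq, of x] bc by auto
    also have "\<dots> = free_left_module_lift S Q (\<lambda>i. \<rho> (x i)) (?s q)"
      unfolding free_left_module_lift_def
    proof (rule Q.M.add.finprod_mono_neutral_cong_right)
      show "finite {i. s q i \<noteq> \<zero>}" using sq by (simp add: free_left_module_carrier)
      have cl: "s q i \<in> carrier S" "s q i \<noteq> \<zero> \<Longrightarrow> i \<in> J" for i
        using sq T_subset by (auto simp: free_left_module_carrier)
      show "s q i \<odot>\<^bsub>Q\<^esub> \<rho> (x i) = \<zero>\<^bsub>Q\<^esub>" if "i \<in> {i. s q i \<noteq> \<zero>} - {i. ?s q i \<noteq> \<zero>}" for i
        using that cl by (simp add: \<rho>x Q.smult_zero split: if_splits)
      show "(\<lambda>i. s q i \<odot>\<^bsub>Q\<^esub> \<rho> (x i)) \<in> {i. s q i \<noteq> \<zero>} \<rightarrow> carrier Q"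
        using cl bc QI by (intro funcsetI Q.smult_closed) auto
    qed (auto split: if_splits)
    finally show "free_left_module_lift ?T Q (\<lambda>i. \<rho> (x i)) (?s q) = q" by simp
  qed
  then show ?thesis
    using that[OF QM \<rho>Q _ ker, of "\<lambda>i. \<rho> (x i)" ?s] by (simp add: Q(1))
qed

text \<open>Call \<open>j\<close> reachable from \<open>i\<close> in one step if
  \<open>v t (x i)\<close> has a nonzero coordinate at \<open>j\<close> for some \<open>t\<close>.
  Since \<open>I\<close> and all supports are finite, each index reaches finitely many others in one
  step, so all indices reachable from \<open>i\<close> form a countable set, and this set is
  saturated.\<close>

lemma saturated_closure:
  assumes M: "left_module S M" and db: "dual_basis (S\<lparr>carrier := T\<rparr>) M J x s" and i: "i \<in> J"
  obtains K where "countable K" "i \<in> K" "K \<subseteq> J" "saturated M x s K"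
proof -
  interpret M: left_module S M by (rule M)
  define rel where "rel = {(i, j). i \<in> J \<and> (\<exists>t \<in> I. s (v t \<odot>\<^bsub>M\<^esub> x i) j \<noteq> \<zero>)}"
  have vx: "s (v t \<odot>\<^bsub>M\<^esub> x i) \<in> carrier (free_left_module S J)" if "i \<in> J" "t \<in> I" for i t
    using coeff_closed[OF M db] basis_closed[OF M db] that v_closed by simp
  have "countable (rel `` Y)" if "countable Y" for Y
  proof -
    have "rel `` Y = (\<Union>i \<in> Y \<inter> J. \<Union>t \<in> I. {j. s (v t \<odot>\<^bsub>M\<^esub> x i) j \<noteq> \<zero>})"
      by (auto simp: rel_def)
    also have "countable \<dots>"
      using that vx I_finite
      by (intro countable_UN countable_Int1) (auto simp: free_left_module_carrier intro: countable_finite)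
    finally show ?thesis .
  qed
  then have count: "countable (rel\<^sup>* `` {i})"
    by (rule countable_rtrancl) (simp_all add: countable_finite)
  have sub: "rel\<^sup>* `` {i} \<subseteq> J"
  proof -
    have "j \<in> J" if "(i, j) \<in> rel\<^sup>*" for j
      using that
    proof (induction rule: rtrancl_induct)
      case (step j k)
      then show ?case using vx by (fastforce simp: rel_def free_left_module_carrier)
    qed (rule i)
    then show ?thesis by auto
  qed
  have "v t \<odot>\<^bsub>M\<^esub> x j \<in> supported M s (rel\<^sup>* `` {i})" if j: "(i, j) \<in> rel\<^sup>*" and t: "t \<in> I" for j t
  proof -
    have "j \<in> J" using j sub by auto
    then have "v t \<odot>\<^bsub>M\<^esub> x j \<in> carrier M" "\<And>k. s (v t \<odot>\<^bsub>M\<^esub> x j) k \<noteq> \<zero> \<Longrightarrow> (j, k) \<in> rel"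
      using t v_closed basis_closed[OF M db] by (auto simp: rel_def)
    then show ?thesis using j by (auto simp: supported_def intro: rtrancl_into_rtrancl)
  qed
  then have "saturated M x s (rel\<^sup>* `` {i})" by (auto simp: saturated_def)
  with count sub show ?thesis by (intro that[of "rel\<^sup>* `` {i}"]) auto
qed

lemma saturated_Union:
  assumes "\<And>K. K \<in> \<K> \<Longrightarrow> saturated M x s K"
  shows "saturated M x s (\<Union>\<K>)"
  unfolding saturated_def
proof (intro ballI)
  fix i t assume "i \<in> \<Union>\<K>" and t: "t \<in> I"
  then obtain K where K: "K \<in> \<K>" "i \<in> K" by auto
  then have "v t \<odot>\<^bsub>M\<^esub> x i \<in> supported M s K" using assms t by (auto simp: saturated_def)
  then show "v t \<odot>\<^bsub>M\<^esub> x i \<in> supported M s (\<Union>\<K>)"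
    using supported_mono[of K "\<Union>\<K>" M s] K(1) by auto
qed

section \<open>Extension of partial lifts\<close>

text \<open>The quotient by the submodule supported on \<open>J1\<close> has a countable dual basis,
  so it is projective and the submodule splits off. The given lift is kept on the submodule, and a
  new one is chosen on the complement.\<close>

lemma lift_extension:
  fixes M :: "('r, 'm) module" and N :: "('r, 'n) module" and B :: "('r, 'b) module" and J :: "'i set"
  assumes M: "left_module S M" and db: "dual_basis (S\<lparr>carrier := T\<rparr>) M J x s"
    and ctbl: "\<And>(Q :: ('r, 'm) module) (J' :: 'i set) y s'.
      \<lbrakk>left_module S Q; dual_basis (S\<lparr>carrier := T\<rparr>) Q J' y s'; countable J'\<rbrakk> \<Longrightarrow> projective_module S Q"
    and N: "left_module S N" and B: "left_module S B" and f: "f \<in> left_module_hom S N B"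
    and surj: "f ` carrier N = carrier B" and g: "g \<in> left_module_hom S M B"
    and J1: "saturated M x s J1" "J1 \<subseteq> J" and J2: "countable (J - J1)"
    and h: "h \<in> left_module_hom S (M\<lparr>carrier := supported M s J1\<rparr>) N"
    and fh: "\<And>m. m \<in> supported M s J1 \<Longrightarrow> f (h m) = g m"
  shows "\<exists>h' \<in> left_module_hom S M N. (\<forall>m \<in> carrier M. f (h' m) = g m) \<and>
    (\<forall>m \<in> supported M s J1. h' m = h m)"
proof -
  interpret M: left_module S M by (rule M)
  interpret N: left_module S N by (rule N)
  interpret B: left_module S B by (rule B)
  let ?V = "supported M s J1"
  obtain Q :: "('r, 'm) module" and \<rho> y s' where Q: "left_module S Q"
    and \<rho>: "\<rho> \<in> left_module_hom S M Q" and \<rho>surj: "\<rho> ` carrier M = carrier Q"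
    and ker: "\<And>m. m \<in> carrier M \<Longrightarrow> \<rho> m = \<zero>\<^bsub>Q\<^esub> \<longleftrightarrow> m \<in> ?V"
    and dbQ: "dual_basis (S\<lparr>carrier := T\<rparr>) Q (J - J1) y s'"
    by (rule supported_quotient[OF M db J1]) blast
  interpret Q: left_module S Q by (rule Q)
  have QP: "projective_module S Q" by (rule ctbl[OF Q dbQ J2])
  have "(\<lambda>q. q) \<in> left_module_hom S Q Q" by (simp add: left_module_hom_def)
  from projective_module_lift[OF QP M Q \<rho> \<rho>surj this]
  obtain \<sigma> where \<sigma>: "\<sigma> \<in> left_module_hom S Q M" and \<rho>\<sigma>: "\<And>q. q \<in> carrier Q \<Longrightarrow> \<rho> (\<sigma> q) = q" by auto
  \<comment> \<open>Projectivity of \<open>Q\<close> is used again, now to lift \<open>g\<close> on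
    the complement \<open>\<sigma>(Q)\<close>.\<close>
  from projective_module_lift[OF QP N B f surj left_module_hom_comp[OF \<sigma> g]]
  obtain k where k: "k \<in> left_module_hom S Q N" and fk: "\<And>q. q \<in> carrier Q \<Longrightarrow> f (k q) = g (\<sigma> q)" by auto
  note cl = left_module_hom_closed[OF \<rho>] left_module_hom_closed[OF \<sigma>] left_module_hom_closed[OF k]
    left_module_hom_closed[OF g]
  \<comment> \<open>The component of \<open>m\<close> in the submodule along the splitting
    \<open>\<sigma>\<close>.\<close>
  define w where "w m = m \<ominus>\<^bsub>M\<^esub> \<sigma> (\<rho> m)" for m
  have idM: "(\<lambda>m. m) \<in> left_module_hom S M M" by (simp add: left_module_hom_def)
  have w: "w \<in> left_module_hom S M M"
    using left_module_hom_diff_fun[OF M M idM left_module_hom_comp[OF \<rho> \<sigma>]] by (simp add: w_def[abs_def])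
  have wV: "w m \<in> ?V" if m: "m \<in> carrier M" for m
  proof -
    have "\<rho> (w m) = \<zero>\<^bsub>Q\<^esub>"
      using m cl by (simp add: w_def left_module_hom_minus[OF M Q \<rho>] \<rho>\<sigma> Q.M.minus_eq Q.M.r_neg)
    then show ?thesis using ker[OF left_module_hom_closed[OF w m]] by simp
  qed
  have "w \<in> left_module_hom S M (M\<lparr>carrier := ?V\<rparr>)"
    using w wV by (auto simp: left_module_hom_def)
  from left_module_hom_add_fun[OF M N left_module_hom_comp[OF this h] left_module_hom_comp[OF \<rho> k]]
  have hom: "(\<lambda>m. h (w m) \<oplus>\<^bsub>N\<^esub> k (\<rho> m)) \<in> left_module_hom S M N" .
  have hc: "h m \<in> carrier N" if "m \<in> ?V" for m
    using left_module_hom_closed[OF h] that by simp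
  have lift: "f (h (w m) \<oplus>\<^bsub>N\<^esub> k (\<rho> m)) = g m" if m: "m \<in> carrier M" for m
  proof -
    have "f (h (w m) \<oplus>\<^bsub>N\<^esub> k (\<rho> m)) = g (w m) \<oplus>\<^bsub>B\<^esub> g (\<sigma> (\<rho> m))"
      using m hc wV cl by (simp add: left_module_hom_add[OF f] fh fk)
    also have "\<dots> = g m"
      using m cl by (simp add: w_def left_module_hom_minus[OF M B g] B.M.minus_eq B.M.a_assoc B.M.l_neg)
    finally show ?thesis .
  qed
  have ext: "h (w m) \<oplus>\<^bsub>N\<^esub> k (\<rho> m) = h m" if m: "m \<in> ?V" for m
  proof -
    have mc: "m \<in> carrier M" using m by (simp add: supported_def)
    have \<rho>0: "\<rho> m = \<zero>\<^bsub>Q\<^esub>" using ker[OF mc] m by simp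
    have "w m = m"
      using mc by (simp add: w_def \<rho>0 left_module_hom_zero[OF Q M \<sigma>] M.M.minus_eq)
    then show ?thesis using hc[OF m] by (simp add: \<rho>0 left_module_hom_zero[OF Q N k])
  qed
  show ?thesis
    by (intro bexI[OF _ hom] conjI ballI lift ext)
qed

text \<open>A partial lift lives on the submodule supported on a saturated set \<open>K\<close>.
  Adjoining the saturated closure of one index adds only countably many indices, so the extension
  step applies and a maximal partial lift is defined everywhere.\<close>

theorem projective_module_from_countable:
  fixes M :: "('r, 'm) module" and J :: "'i set"
  assumes M: "left_module S M" and db: "dual_basis (S\<lparr>carrier := T\<rparr>) M J x s"
    and ctbl: "\<And>(Q :: ('r, 'm) module) (J' :: 'i set) y s'.
      \<lbrakk>left_module S Q; dual_basis (S\<lparr>carrier := T\<rparr>) Q J' y s'; countable J'\<rbrakk> \<Longrightarrow> projective_module S Q"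
  shows "projective_module S M"
  unfolding projective_module_def
proof (intro conjI allI impI)
  show "left_module S M" by fact
  fix N :: "('r, 'm \<Rightarrow> 'r) module" and B :: "('r, 'm) module" and f g
  assume N: "left_module S N" and B: "left_module S B" and f: "f \<in> left_module_hom S N B"
    and surj: "f ` carrier N = carrier B" and g: "g \<in> left_module_hom S M B"
  interpret M: left_module S M by (rule M)
  interpret N: left_module S N by (rule N)
  let ?V = "\<lambda>K. supported M s K"
  define lifts where "lifts K h \<longleftrightarrow> K \<subseteq> J \<and> saturated M x s K \<and>
    h \<in> left_module_hom S (M\<lparr>carrier := ?V K\<rparr>) N \<and> (\<forall>m \<in> ?V K. f (h m) = g m)" for K h
  \<comment> \<open>Functions are total, so the graph over the domain is what distinguishes a
    partial lift; inclusion of graphs is extension of lifts.\<close>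
  define graph where "graph K h = (\<lambda>m. (m, h m)) ` ?V K" for K and h :: "'m \<Rightarrow> 'm \<Rightarrow> 'r"
  define \<A> where "\<A> = {graph K h | K h. lifts K h}"
  have "\<exists>\<Gamma> \<in> \<A>. \<forall>\<Delta> \<in> \<A>. \<Gamma> \<subseteq> \<Delta> \<longrightarrow> \<Delta> = \<Gamma>"
  proof (rule subset_Zorn_nonempty)
    have "m = \<zero>\<^bsub>M\<^esub>" if "m \<in> ?V {}" for m
    proof -
      have "m \<in> carrier M" "s m = (\<lambda>_. \<zero>)" using that by (auto simp: supported_def)
      then show ?thesis using basis_eq[OF M db, of m] by (simp add: free_left_module_lift_def)
    qed
    moreover have "f \<zero>\<^bsub>N\<^esub> = \<zero>\<^bsub>B\<^esub>" "g \<zero>\<^bsub>M\<^esub> = \<zero>\<^bsub>B\<^esub>"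
      using left_module_hom_zero[OF N B f] left_module_hom_zero[OF M B g] .
    ultimately have "lifts {} (\<lambda>_. \<zero>\<^bsub>N\<^esub>)"
      by (auto simp: lifts_def saturated_def N.smult_zero intro!: left_module_homI)
    then show "\<A> \<noteq> {}" by (auto simp: \<A>_def)
  next
    fix \<C> assume ne: "\<C> \<noteq> {}" and chain: "subset.chain \<A> \<C>"
    have "\<forall>\<Gamma> \<in> \<C>. \<exists>K h. lifts K h \<and> \<Gamma> = graph K h"
      using chain by (auto simp: subset.chain_def \<A>_def)
    then obtain K h where lift: "\<And>\<Gamma>. \<Gamma> \<in> \<C> \<Longrightarrow> lifts (K \<Gamma>) (h \<Gamma>)"
      and graph: "\<And>\<Gamma>. \<Gamma> \<in> \<C> \<Longrightarrow> \<Gamma> = graph (K \<Gamma>) (h \<Gamma>)" by metis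
    have mem: "(m, y) \<in> \<Gamma> \<longleftrightarrow> m \<in> ?V (K \<Gamma>) \<and> y = h \<Gamma> m" if "\<Gamma> \<in> \<C>" for \<Gamma> m y
      by (subst graph[OF that]) (auto simp: graph_def)
    define K0 where "K0 = \<Union>(K ` \<C>)"
    have K: "K \<Gamma> \<subseteq> J" "saturated M x s (K \<Gamma>)" "K \<Gamma> \<subseteq> K0" if "\<Gamma> \<in> \<C>" for \<Gamma>
      using lift[OF that] that by (auto simp: lifts_def K0_def)
    have K0: "K0 \<subseteq> J" "saturated M x s K0"
      unfolding K0_def using K by (auto intro!: saturated_Union)
    have "\<exists>\<Gamma> \<in> \<C>. F \<subseteq> ?V (K \<Gamma>)" if F: "finite F" "\<And>m. m \<in> F \<Longrightarrow> \<exists>\<Gamma> \<in> \<C>. m \<in> ?V (K \<Gamma>)" for F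
    proof -
      obtain G where G: "\<And>m. m \<in> F \<Longrightarrow> G m \<in> \<C> \<and> m \<in> ?V (K (G m))" using F(2) by metis
      have "(\<lambda>m. (m, h (G m) m)) ` F \<subseteq> \<Union>\<C>" using G mem by fastforce
      then obtain \<Gamma> where "\<Gamma> \<in> \<C>" "(\<lambda>m. (m, h (G m) m)) ` F \<subseteq> \<Gamma>"
        using finite_subset_Union_chain[OF finite_imageI[OF F(1)] _ ne chain] by metis
      then show ?thesis using mem by blast
    qed note common = this
    \<comment> \<open>The graphs form a chain, hence so do the domains, but the index sets
      \<open>K \<Gamma>\<close> need not. Therefore the \<open>x j\<close> that occur in
      \<open>m\<close> are put into a common domain, rather than their indices into a common
      \<open>K \<Gamma>\<close>.\<close>
    have dom: "\<exists>\<Gamma> \<in> \<C>. m \<in> ?V (K \<Gamma>)" if m: "m \<in> ?V K0" for m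
    proof -
      have mc: "m \<in> carrier M" using m by (simp add: supported_def)
      have "finite {j. s m j \<noteq> \<zero>}"
        using coeff_closed[OF M db mc] by (simp add: free_left_module_carrier)
      moreover have "\<exists>\<Gamma> \<in> \<C>. x j \<in> ?V (K \<Gamma>)" if "s m j \<noteq> \<zero>" for j
      proof -
        have "j \<in> K0" using that m by (auto simp: supported_def)
        then obtain \<Gamma> where "\<Gamma> \<in> \<C>" "j \<in> K \<Gamma>" by (auto simp: K0_def)
        then show ?thesis using supported_basis[OF M db K(2,1)] by blast
      qed
      ultimately obtain \<Gamma> where \<Gamma>: "\<Gamma> \<in> \<C>" "x ` {j. s m j \<noteq> \<zero>} \<subseteq> ?V (K \<Gamma>)"
        using common[of "x ` {j. s m j \<noteq> \<zero>}"] by auto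
      have "m \<in> ?V (K \<Gamma>)"
        by (rule supported_if_basis_supported[OF M db K(2,1)[OF \<Gamma>(1)] mc]) (use \<Gamma>(2) in auto)
      then show ?thesis using \<Gamma>(1) by blast
    qed
    have agree: "h \<Gamma> m = h \<Gamma>' m" if "\<Gamma> \<in> \<C>" "\<Gamma>' \<in> \<C>" "m \<in> ?V (K \<Gamma>)" "m \<in> ?V (K \<Gamma>')" for \<Gamma> \<Gamma>' m
    proof -
      have "\<Gamma> \<subseteq> \<Gamma>' \<or> \<Gamma>' \<subseteq> \<Gamma>" using chain that(1,2) by (auto simp: subset.chain_def)
      moreover have "(m, h \<Gamma> m) \<in> \<Gamma>" "(m, h \<Gamma>' m) \<in> \<Gamma>'"
        using mem[OF that(1)] mem[OF that(2)] that(3,4) by simp_all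
      ultimately have "(m, h \<Gamma> m) \<in> \<Gamma>' \<or> (m, h \<Gamma>' m) \<in> \<Gamma>" by auto
      then show ?thesis by (simp add: mem[OF that(1)] mem[OF that(2)] that(3,4) eq_commute)
    qed
    define H where "H m = h (SOME \<Gamma>. \<Gamma> \<in> \<C> \<and> m \<in> ?V (K \<Gamma>)) m" for m
    have H: "H m = h \<Gamma> m" if "\<Gamma> \<in> \<C>" "m \<in> ?V (K \<Gamma>)" for \<Gamma> m
    proof -
      have "(SOME \<Gamma>. \<Gamma> \<in> \<C> \<and> m \<in> ?V (K \<Gamma>)) \<in> \<C> \<and> m \<in> ?V (K (SOME \<Gamma>. \<Gamma> \<in> \<C> \<and> m \<in> ?V (K \<Gamma>)))"
        by (rule someI[of "\<lambda>\<Gamma>. \<Gamma> \<in> \<C> \<and> m \<in> ?V (K \<Gamma>)", OF conjI[OF that]])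
      then show ?thesis unfolding H_def by (intro agree that) simp_all
    qed
    have hom: "h \<Gamma> \<in> left_module_hom S (M\<lparr>carrier := ?V (K \<Gamma>)\<rparr>) N" if "\<Gamma> \<in> \<C>" for \<Gamma>
      using lift[OF that] by (simp add: lifts_def)
    have "lifts K0 H"
      unfolding lifts_def
    proof (intro conjI ballI K0 left_module_homI)
      fix m assume m: "m \<in> carrier (M\<lparr>carrier := ?V K0\<rparr>)"
      then obtain \<Gamma> where \<Gamma>: "\<Gamma> \<in> \<C>" "m \<in> ?V (K \<Gamma>)" using dom by auto
      then show "H m \<in> carrier N" using H[OF \<Gamma>] left_module_hom_closed[OF hom] by simp
      fix r assume r: "r \<in> carrier S"
      have "r \<odot>\<^bsub>M\<^esub> m \<in> ?V (K \<Gamma>)" by (rule supported_smult[OF M db K(2,1) r]) fact+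
      then show "H (r \<odot>\<^bsub>M\<lparr>carrier := ?V K0\<rparr>\<^esub> m) = r \<odot>\<^bsub>N\<^esub> H m"
        using H \<Gamma> left_module_hom_smult[OF hom[OF \<Gamma>(1)] r, of m] by simp
    next
      fix m m' assume "m \<in> carrier (M\<lparr>carrier := ?V K0\<rparr>)" "m' \<in> carrier (M\<lparr>carrier := ?V K0\<rparr>)"
      then obtain \<Gamma> where \<Gamma>: "\<Gamma> \<in> \<C>" "m \<in> ?V (K \<Gamma>)" "m' \<in> ?V (K \<Gamma>)"
        using common[of "{m, m'}"] dom by auto
      moreover have "m \<oplus>\<^bsub>M\<^esub> m' \<in> ?V (K \<Gamma>)" by (rule supported_add[OF M db]) fact+
      ultimately show "H (m \<oplus>\<^bsub>M\<lparr>carrier := ?V K0\<rparr>\<^esub> m') = H m \<oplus>\<^bsub>N\<^esub> H m'"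
        using H left_module_hom_add[OF hom[OF \<Gamma>(1)], of m m'] by simp
    next
      fix m assume "m \<in> ?V K0"
      then obtain \<Gamma> where \<Gamma>: "\<Gamma> \<in> \<C>" "m \<in> ?V (K \<Gamma>)" using dom by auto
      then show "f (H m) = g m" using H[OF \<Gamma>] lift by (simp add: lifts_def)
    qed
    moreover have "\<Union>\<C> = graph K0 H"
    proof (intro equalityI subsetI)
      fix p assume "p \<in> \<Union>\<C>"
      then obtain \<Gamma> where \<Gamma>: "\<Gamma> \<in> \<C>" "p \<in> \<Gamma>" by auto
      then have "fst p \<in> ?V (K \<Gamma>)" "snd p = H (fst p)" using mem[OF \<Gamma>(1), of "fst p" "snd p"] H by auto
      then show "p \<in> graph K0 H"
        using supported_mono[OF K(3)[OF \<Gamma>(1)], of M s] unfolding graph_def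
        by (intro image_eqI[of _ _ "fst p"]) (auto intro: prod_eqI)
    next
      fix p assume "p \<in> graph K0 H"
      then obtain m where m: "m \<in> ?V K0" "p = (m, H m)" by (auto simp: graph_def)
      then obtain \<Gamma> where "\<Gamma> \<in> \<C>" "m \<in> ?V (K \<Gamma>)" using dom by auto
      then show "p \<in> \<Union>\<C>" using m mem H by (auto intro!: bexI[of _ \<Gamma>])
    qed
    ultimately show "\<Union>\<C> \<in> \<A>" by (auto simp: \<A>_def)
  qed
  then obtain K h where K: "K \<subseteq> J" "saturated M x s K"
    and h: "h \<in> left_module_hom S (M\<lparr>carrier := ?V K\<rparr>) N" "\<And>m. m \<in> ?V K \<Longrightarrow> f (h m) = g m"
    and max: "\<And>\<Delta>. \<lbrakk>\<Delta> \<in> \<A>; graph K h \<subseteq> \<Delta>\<rbrakk> \<Longrightarrow> \<Delta> = graph K h"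
    by (auto simp: \<A>_def lifts_def)
  have "x i \<in> ?V K" if i: "i \<in> J" for i
  proof -
    obtain L where L: "countable L" "i \<in> L" "L \<subseteq> J" "saturated M x s L"
      by (rule saturated_closure[OF M db i])
    have J2: "K \<union> L \<subseteq> J" "saturated M x s (K \<union> L)"
      using K L saturated_Union[of "{K, L}" M x s] by auto
    \<comment> \<open>The extension takes place inside the submodule supported on
      \<open>K \<union> L\<close>, for which only the countably many indices in \<open>L - K\<close>
      are new.\<close>
    let ?M = "M\<lparr>carrier := ?V (K \<union> L)\<rparr>"
    note M2 = supported_module[OF M db J2(2,1)] and db2 = supported_dual_basis[OF M db J2(2,1)]
    have V: "supported ?M s K = ?V K" by (auto simp: supported_def)
    have "\<exists>h' \<in> left_module_hom S ?M N. (\<forall>m \<in> carrier ?M. f (h' m) = g m) \<and>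
        (\<forall>m \<in> supported ?M s K. h' m = h m)"
    proof (rule lift_extension[OF M2 db2 _ N B f surj])
      show "g \<in> left_module_hom S ?M B"
        using g by (auto simp: left_module_hom_def supported_def)
      show "saturated ?M x s K" using K(2) V by (simp add: saturated_def)
      show "countable (K \<union> L - K)" using L(1) by (simp add: Un_Diff)
    qed (use ctbl h V in auto)
    then obtain h' where h': "h' \<in> left_module_hom S ?M N" "\<And>m. m \<in> ?V (K \<union> L) \<Longrightarrow> f (h' m) = g m"
      and ext: "\<And>m. m \<in> ?V K \<Longrightarrow> h' m = h m"
      using V by auto
    have "lifts (K \<union> L) h'" using J2 h' by (simp add: lifts_def)
    then have "graph (K \<union> L) h' \<in> \<A>" by (auto simp: \<A>_def)
    moreover have "graph K h \<subseteq> graph (K \<union> L) h'"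
      using supported_mono[of K "K \<union> L" M s] ext by (auto simp: graph_def)
    \<comment> \<open>Equal graphs have equal domains. This puts \<open>x i\<close> into the domain
      of \<open>h\<close> without placing \<open>i\<close> in \<open>K\<close>.\<close>
    ultimately have "graph (K \<union> L) h' = graph K h" by (rule max)
    moreover have "x i \<in> ?V (K \<union> L)"
      using supported_basis[OF M db J2(2,1)] L(2) by auto
    ultimately show ?thesis by (auto simp: graph_def)
  qed
  then have "m \<in> ?V K" if "m \<in> carrier M" for m
    using supported_if_basis_supported[OF M db K(2,1) that] coeff_closed[OF M db that]
    by (auto simp: free_left_module_carrier)
  then have "?V K = carrier M" using supported_subset[OF M db] by auto
  then show "\<exists>h \<in> left_module_hom S M N. \<forall>m \<in> carrier M. f (h m) = g m"
    using h by auto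
qed

end

section \<open>Subrings and projections of a strongly graded ring\<close>

context strongly_graded_ring
begin

section \<open>Homogeneous parts as subrings\<close>

definition part :: "'g set \<Rightarrow> 'r set"
  where "part V = {finsum S c F | c F. finite F \<and> F \<subseteq> V \<and> (\<forall>\<gamma> \<in> F. c \<gamma> \<in> A \<gamma>)}"

lemma graded_part_eq: "graded_part S A V = S\<lparr>carrier := part V\<rparr>"
  by (simp add: graded_part_def part_def)

lemma part_carrier: "part (carrier \<Gamma>) = carrier S"
  using components_span by (simp add: graded_part_eq)

lemma component_zero: "\<gamma> \<in> carrier \<Gamma> \<Longrightarrow> \<zero>\<^bsub>S\<^esub> \<in> A \<gamma>"
  and component_add: "\<lbrakk>\<gamma> \<in> carrier \<Gamma>; r \<in> A \<gamma>; r' \<in> A \<gamma>\<rbrakk> \<Longrightarrow> r \<oplus>\<^bsub>S\<^esub> r' \<in> A \<gamma>"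
  and component_subset: "\<gamma> \<in> carrier \<Gamma> \<Longrightarrow> A \<gamma> \<subseteq> carrier S"
  using additive_subgroup.zero_closed[OF component_subgroup] additive_subgroup.a_closed[OF component_subgroup]
    additive_subgroup.a_subset[OF component_subgroup] by auto

lemma component_carrier: "\<lbrakk>r \<in> A \<gamma>; \<gamma> \<in> carrier \<Gamma>\<rbrakk> \<Longrightarrow> r \<in> carrier S"
  using component_subset by auto

lemma component_neg: "\<lbrakk>\<gamma> \<in> carrier \<Gamma>; r \<in> A \<gamma>\<rbrakk> \<Longrightarrow> \<ominus>\<^bsub>S\<^esub> r \<in> A \<gamma>"
  using additive_subgroup.a_subgroup[OF component_subgroup] subgroup.m_inv_closed[of "A \<gamma>" "add_monoid S" r]
  by (simp add: a_inv_def)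

lemma component_mult:
  "\<lbrakk>\<gamma> \<in> carrier \<Gamma>; \<tau> \<in> carrier \<Gamma>; r \<in> A \<gamma>; r' \<in> A \<tau>\<rbrakk> \<Longrightarrow> r \<otimes>\<^bsub>S\<^esub> r' \<in> A (\<gamma> \<otimes>\<^bsub>\<Gamma>\<^esub> \<tau>)"
  using strongly_graded ideal_prod.prod by metis

lemma one_component: "\<one>\<^bsub>S\<^esub> \<in> A \<one>\<^bsub>\<Gamma>\<^esub>"
  using ring_hom_one[OF base_operations] base_component R.one_closed by simp

lemma finsum_restrict:
  assumes "finite G" "G \<subseteq> carrier \<Gamma>" "\<And>\<gamma>. \<gamma> \<in> G \<inter> F \<Longrightarrow> c \<gamma> \<in> carrier S"
  shows "finsum S (\<lambda>\<gamma>. if \<gamma> \<in> F then c \<gamma> else \<zero>\<^bsub>S\<^esub>) G = finsum S c (G \<inter> F)"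
  by (rule S.add.finprod_mono_neutral_cong_right) (use assms in auto)

lemma partE:
  assumes "r \<in> part V"
  obtains c F where "finite F" "F \<subseteq> V" "\<And>\<gamma>. \<gamma> \<in> F \<Longrightarrow> c \<gamma> \<in> A \<gamma>" "r = finsum S c F"
  using assms by (auto simp: part_def)

lemma partI:
  "\<lbrakk>finite F; F \<subseteq> V; \<And>\<gamma>. \<gamma> \<in> F \<Longrightarrow> c \<gamma> \<in> A \<gamma>\<rbrakk> \<Longrightarrow> finsum S c F \<in> part V"
  by (auto simp: part_def)

lemma part_mono: "V \<subseteq> W \<Longrightarrow> part V \<subseteq> part W"
  by (auto simp: part_def)

lemma part_subset: "V \<subseteq> carrier \<Gamma> \<Longrightarrow> part V \<subseteq> carrier S"
  using part_mono part_carrier by blast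

lemma part_zero: "\<zero>\<^bsub>S\<^esub> \<in> part V"
  using partI[of "{}" V] by simp

lemma component_part: "\<lbrakk>\<gamma> \<in> V; V \<subseteq> carrier \<Gamma>; r \<in> A \<gamma>\<rbrakk> \<Longrightarrow> r \<in> part V"
  using partI[of "{\<gamma>}" V "\<lambda>_. r"] component_carrier by auto

text \<open>Both families are padded with zeros to the common index set \<open>F \<union> G\<close>.
  The intersection with \<open>V\<close> serves the projections, and \<open>V = UNIV\<close> gives
  the full sums.\<close>

lemma finsum_add_extend:
  assumes F: "finite F" "F \<subseteq> carrier \<Gamma>" "\<And>\<gamma>. \<gamma> \<in> F \<Longrightarrow> c \<gamma> \<in> A \<gamma>"
    and G: "finite G" "G \<subseteq> carrier \<Gamma>" "\<And>\<gamma>. \<gamma> \<in> G \<Longrightarrow> d \<gamma> \<in> A \<gamma>"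
    and b_def: "b = (\<lambda>\<gamma>. (if \<gamma> \<in> F then c \<gamma> else \<zero>\<^bsub>S\<^esub>) \<oplus>\<^bsub>S\<^esub> (if \<gamma> \<in> G then d \<gamma> else \<zero>\<^bsub>S\<^esub>))"
  shows "\<gamma> \<in> F \<union> G \<Longrightarrow> b \<gamma> \<in> A \<gamma>"
    and "finsum S b ((F \<union> G) \<inter> V) = finsum S c (F \<inter> V) \<oplus>\<^bsub>S\<^esub> finsum S d (G \<inter> V)"
proof -
  show "b \<gamma> \<in> A \<gamma>" if "\<gamma> \<in> F \<union> G"
    unfolding b_def by (rule component_add) (use that F G component_zero in auto)
  have cc: "c \<gamma> \<in> carrier S" if "\<gamma> \<in> F" for \<gamma> using F(2,3) that component_carrier by blast
  have dc: "d \<gamma> \<in> carrier S" if "\<gamma> \<in> G" for \<gamma> using G(2,3) that component_carrier by blast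
  have "finsum S b ((F \<union> G) \<inter> V)
      = finsum S (\<lambda>\<gamma>. if \<gamma> \<in> F then c \<gamma> else \<zero>\<^bsub>S\<^esub>) ((F \<union> G) \<inter> V)
        \<oplus>\<^bsub>S\<^esub> finsum S (\<lambda>\<gamma>. if \<gamma> \<in> G then d \<gamma> else \<zero>\<^bsub>S\<^esub>) ((F \<union> G) \<inter> V)"
    unfolding b_def by (rule S.finsum_addf) (use cc dc in auto)
  also have "finsum S (\<lambda>\<gamma>. if \<gamma> \<in> F then c \<gamma> else \<zero>\<^bsub>S\<^esub>) ((F \<union> G) \<inter> V) = finsum S c ((F \<union> G) \<inter> V \<inter> F)"
    by (rule finsum_restrict) (use F G cc in auto)
  also have "(F \<union> G) \<inter> V \<inter> F = F \<inter> V" by auto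
  also have "finsum S (\<lambda>\<gamma>. if \<gamma> \<in> G then d \<gamma> else \<zero>\<^bsub>S\<^esub>) ((F \<union> G) \<inter> V) = finsum S d ((F \<union> G) \<inter> V \<inter> G)"
    by (rule finsum_restrict) (use F G dc in auto)
  also have "(F \<union> G) \<inter> V \<inter> G = G \<inter> V" by auto
  finally show "finsum S b ((F \<union> G) \<inter> V) = finsum S c (F \<inter> V) \<oplus>\<^bsub>S\<^esub> finsum S d (G \<inter> V)" .
qed

lemma part_add:
  assumes "r \<in> part V" "r' \<in> part V" "V \<subseteq> carrier \<Gamma>"
  shows "r \<oplus>\<^bsub>S\<^esub> r' \<in> part V"
proof -
  obtain c F where c: "finite F" "F \<subseteq> V" "\<And>\<gamma>. \<gamma> \<in> F \<Longrightarrow> c \<gamma> \<in> A \<gamma>" "r = finsum S c F"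
    by (rule partE[OF assms(1)]) blast
  obtain d G where d: "finite G" "G \<subseteq> V" "\<And>\<gamma>. \<gamma> \<in> G \<Longrightarrow> d \<gamma> \<in> A \<gamma>" "r' = finsum S d G"
    by (rule partE[OF assms(2)]) blast
  have F: "F \<subseteq> carrier \<Gamma>" "G \<subseteq> carrier \<Gamma>" using c d assms(3) by auto
  let ?b = "\<lambda>\<gamma>. (if \<gamma> \<in> F then c \<gamma> else \<zero>\<^bsub>S\<^esub>) \<oplus>\<^bsub>S\<^esub> (if \<gamma> \<in> G then d \<gamma> else \<zero>\<^bsub>S\<^esub>)"
  note b = finsum_add_extend[OF c(1) F(1) c(3) d(1) F(2) d(3) refl]
  have "finsum S ?b (F \<union> G) \<in> part V"
    by (rule partI) (use c d b(1) in auto)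
  moreover have "finsum S ?b (F \<union> G) = r \<oplus>\<^bsub>S\<^esub> r'"
    using b(2)[of UNIV] c(4) d(4) by simp
  ultimately show ?thesis by simp
qed

lemma part_induct [consumes 2, case_names zero component add]:
  assumes "r \<in> part V" and V: "V \<subseteq> carrier \<Gamma>"
    and zero: "P \<zero>\<^bsub>S\<^esub>" and comp: "\<And>\<gamma> r. \<lbrakk>\<gamma> \<in> V; r \<in> A \<gamma>\<rbrakk> \<Longrightarrow> P r"
    and add: "\<And>r r'. \<lbrakk>r \<in> part V; r' \<in> part V; P r; P r'\<rbrakk> \<Longrightarrow> P (r \<oplus>\<^bsub>S\<^esub> r')"
  shows "P r"
proof -
  obtain c F where c: "finite F" "F \<subseteq> V" "\<And>\<gamma>. \<gamma> \<in> F \<Longrightarrow> c \<gamma> \<in> A \<gamma>" "r = finsum S c F"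
    by (rule partE[OF assms(1)]) blast
  have "P (finsum S c F)"
    using c(1-3)
  proof (induction F rule: finite_induct)
    case (insert \<gamma> F)
    have cl: "c \<in> F \<rightarrow> carrier S" "c \<gamma> \<in> carrier S"
      using insert.prems V component_carrier by blast+
    have "c \<gamma> \<in> part V" "finsum S c F \<in> part V"
      using insert.prems insert.hyps V component_part[of \<gamma>] by (auto intro: partI)
    moreover have "P (c \<gamma>)" by (rule comp[of \<gamma>]) (use insert.prems in auto)
    ultimately have "P (c \<gamma> \<oplus>\<^bsub>S\<^esub> finsum S c F)" using insert by (intro add) auto
    then show ?case using insert.hyps cl by simp
  qed (simp add: zero)
  then show ?thesis using c(4) by simp
qed

lemma part_mult:
  assumes V: "subgroup V \<Gamma>" and r: "r \<in> part V" and r': "r' \<in> part V"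
  shows "r \<otimes>\<^bsub>S\<^esub> r' \<in> part V"
proof -
  have Vc: "V \<subseteq> carrier \<Gamma>" using V by (rule subgroup.subset)
  note pc = subsetD[OF part_subset[OF Vc]]
  show ?thesis
    using r Vc
  proof (induction rule: part_induct)
    case zero
    show ?case using r' pc by (simp add: part_zero)
  next
    case (component \<gamma> r)
    have rc: "r \<in> carrier S" using component Vc component_carrier by blast
    show ?case
      using r' Vc
    proof (induction rule: part_induct)
      case zero
      show ?case using rc by (simp add: part_zero)
    next
      case (component \<tau> r')
      then show ?case
        using \<open>\<gamma> \<in> V\<close> \<open>r \<in> A \<gamma>\<close> Vc component_mult[of \<gamma> \<tau> r r'] subgroup.m_closed[OF V]
        by (intro component_part[of "\<gamma> \<otimes>\<^bsub>\<Gamma>\<^esub> \<tau>"]) auto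
    next
      case (add r1 r2)
      then show ?case using rc pc Vc by (simp add: S.r_distr part_add)
    qed
  next
    case (add r1 r2)
    then show ?case using r' pc Vc by (simp add: S.l_distr part_add)
  qed
qed

lemma part_subring:
  assumes V: "subgroup V \<Gamma>"
  shows "subring (part V) S"
proof (rule S.subringI)
  have Vc: "V \<subseteq> carrier \<Gamma>" using V by (rule subgroup.subset)
  note pc = subsetD[OF part_subset[OF Vc]]
  show "part V \<subseteq> carrier S" by (rule part_subset[OF Vc])
  show "\<one>\<^bsub>S\<^esub> \<in> part V"
    using component_part[OF subgroup.one_closed[OF V] Vc one_component] .
  show "\<ominus>\<^bsub>S\<^esub> r \<in> part V" if "r \<in> part V" for r
    using that Vc
  proof (induction rule: part_induct)
    case (component \<gamma> r)
    then show ?case using component_part[of \<gamma> V] component_neg Vc by blast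
  next
    case (add r r')
    then show ?case using pc Vc by (simp add: S.minus_add part_add)
  qed (simp add: part_zero)
qed (use V subgroup.subset[OF V] part_mult part_add in auto)

lemma part_finite_support:
  assumes "r \<in> part V" obtains F where "finite F" "F \<subseteq> V" "r \<in> part F"
  using assms by (metis partE partI order_refl)

section \<open>Projection onto a part\<close>

text \<open>The value is read off from an arbitrary decomposition into components;
  \<open>finsum_component_unique\<close> makes it independent of the choice.\<close>

definition proj :: "'g set \<Rightarrow> 'r \<Rightarrow> 'r"
  where "proj V r = (let (c, F) = (SOME (c, F). finite F \<and> F \<subseteq> carrier \<Gamma> \<and> (\<forall>\<gamma> \<in> F. c \<gamma> \<in> A \<gamma>) \<and>
    r = finsum S c F) in finsum S c (F \<inter> V))"

text \<open>The difference of the two padded families sums to zero, so independence of the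
  components makes it vanish termwise, and corresponding partial sums agree.\<close>

lemma finsum_component_unique:
  assumes F: "finite F" "F \<subseteq> carrier \<Gamma>" "\<And>\<gamma>. \<gamma> \<in> F \<Longrightarrow> c \<gamma> \<in> A \<gamma>"
    and G: "finite G" "G \<subseteq> carrier \<Gamma>" "\<And>\<gamma>. \<gamma> \<in> G \<Longrightarrow> d \<gamma> \<in> A \<gamma>"
    and eq: "finsum S c F = finsum S d G"
  shows "finsum S c (F \<inter> V) = finsum S d (G \<inter> V)"
proof -
  have cc: "c \<in> F' \<rightarrow> carrier S" if "F' \<subseteq> F" for F' using F(2,3) that component_carrier by blast
  have dc: "d \<in> G' \<rightarrow> carrier S" if "G' \<subseteq> G" for G' using G(2,3) that component_carrier by blast
  define d' where "d' \<gamma> = \<ominus>\<^bsub>S\<^esub> d \<gamma>" for \<gamma>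
  have d': "d' \<gamma> \<in> A \<gamma>" if "\<gamma> \<in> G" for \<gamma>
    using that G by (auto simp: d'_def intro: component_neg)
  have d'_sum: "finsum S d' G' \<oplus>\<^bsub>S\<^esub> finsum S d G' = \<zero>\<^bsub>S\<^esub>" if "G' \<subseteq> G" for G'
  proof -
    have dG: "d \<gamma> \<in> carrier S" if "\<gamma> \<in> G'" for \<gamma> using dc[OF \<open>G' \<subseteq> G\<close>] that by auto
    have "finsum S d' G' \<oplus>\<^bsub>S\<^esub> finsum S d G' = finsum S (\<lambda>\<gamma>. d' \<gamma> \<oplus>\<^bsub>S\<^esub> d \<gamma>) G'"
      by (rule S.finsum_addf[symmetric]) (use dG in \<open>auto simp: d'_def\<close>)
    also have "\<dots> = \<zero>\<^bsub>S\<^esub>"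
      by (rule S.add.finprod_one_eqI) (use dG in \<open>simp add: d'_def S.l_neg\<close>)
    finally show ?thesis .
  qed
  have d'c: "d' \<in> G' \<rightarrow> carrier S" if "G' \<subseteq> G" for G'
    using dc[OF that] S.a_inv_closed by (auto simp: d'_def Pi_iff)
  define b where "b = (\<lambda>\<gamma>. (if \<gamma> \<in> F then c \<gamma> else \<zero>\<^bsub>S\<^esub>) \<oplus>\<^bsub>S\<^esub> (if \<gamma> \<in> G then d' \<gamma> else \<zero>\<^bsub>S\<^esub>))"
  note b = finsum_add_extend[OF F G(1,2) d' b_def]
  have "finsum S b (F \<union> G) = finsum S c F \<oplus>\<^bsub>S\<^esub> finsum S d' G" using b(2)[of UNIV] by simp
  also have "\<dots> = \<zero>\<^bsub>S\<^esub>"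
    using d'_sum[of G] eq dc[of G] d'c[of G] by (simp add: S.a_comm)
  finally have b0: "b \<gamma> = \<zero>\<^bsub>S\<^esub>" if "\<gamma> \<in> F \<union> G" for \<gamma>
    using components_independent[of "F \<union> G" b \<gamma>] F G b(1) that by blast
  have "finsum S c (F \<inter> V) \<oplus>\<^bsub>S\<^esub> finsum S d' (G \<inter> V) = finsum S b ((F \<union> G) \<inter> V)"
    by (rule b(2)[symmetric])
  also have "\<dots> = \<zero>\<^bsub>S\<^esub>"
    by (rule S.add.finprod_one_eqI) (use b0 in auto)
  finally have *: "finsum S c (F \<inter> V) \<oplus>\<^bsub>S\<^esub> finsum S d' (G \<inter> V) = \<zero>\<^bsub>S\<^esub>" .
  have cl: "finsum S c (F \<inter> V) \<in> carrier S" "finsum S d (G \<inter> V) \<in> carrier S"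
    "finsum S d' (G \<inter> V) \<in> carrier S"
    by (intro S.finsum_closed cc dc d'c; auto)+
  have "finsum S d' (G \<inter> V) \<oplus>\<^bsub>S\<^esub> finsum S d (G \<inter> V) = finsum S d' (G \<inter> V) \<oplus>\<^bsub>S\<^esub> finsum S c (F \<inter> V)"
    using d'_sum[of "G \<inter> V"] * cl by (simp add: S.a_comm)
  then show ?thesis using S.add.l_cancel[OF _ cl(2,1,3)] by simp
qed

lemma proj_finsum:
  assumes "finite F" "F \<subseteq> carrier \<Gamma>" "\<And>\<gamma>. \<gamma> \<in> F \<Longrightarrow> c \<gamma> \<in> A \<gamma>"
  shows "proj V (finsum S c F) = finsum S c (F \<inter> V)"
proof -
  let ?P = "\<lambda>(d, G). finite G \<and> G \<subseteq> carrier \<Gamma> \<and> (\<forall>\<gamma> \<in> G. d \<gamma> \<in> A \<gamma>) \<and> finsum S c F = finsum S d G"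
  obtain d G where dG: "(SOME p. ?P p) = (d, G)" by (cases "SOME p. ?P p")
  have "?P (SOME p. ?P p)"
    by (rule someI[of ?P "(c, F)"]) (use assms in auto)
  then have "?P (d, G)" by (simp only: dG)
  then have "finsum S c (F \<inter> V) = finsum S d (G \<inter> V)"
    by (intro finsum_component_unique assms) auto
  then show ?thesis by (simp add: proj_def dG)
qed

lemma carrier_partE:
  assumes "r \<in> carrier S"
  obtains c F where "finite F" "F \<subseteq> carrier \<Gamma>" "\<And>\<gamma>. \<gamma> \<in> F \<Longrightarrow> c \<gamma> \<in> A \<gamma>" "r = finsum S c F"
  using assms partE[of r "carrier \<Gamma>"] part_carrier by blast

lemma proj_add:
  assumes "r \<in> carrier S" "r' \<in> carrier S"
  shows "proj V (r \<oplus>\<^bsub>S\<^esub> r') = proj V r \<oplus>\<^bsub>S\<^esub> proj V r'"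
proof -
  obtain c F where c: "finite F" "F \<subseteq> carrier \<Gamma>" "\<And>\<gamma>. \<gamma> \<in> F \<Longrightarrow> c \<gamma> \<in> A \<gamma>" "r = finsum S c F"
    by (rule carrier_partE[OF assms(1)]) blast
  obtain d G where d: "finite G" "G \<subseteq> carrier \<Gamma>" "\<And>\<gamma>. \<gamma> \<in> G \<Longrightarrow> d \<gamma> \<in> A \<gamma>" "r' = finsum S d G"
    by (rule carrier_partE[OF assms(2)]) blast
  define b where "b = (\<lambda>\<gamma>. (if \<gamma> \<in> F then c \<gamma> else \<zero>\<^bsub>S\<^esub>) \<oplus>\<^bsub>S\<^esub> (if \<gamma> \<in> G then d \<gamma> else \<zero>\<^bsub>S\<^esub>))"
  note b = finsum_add_extend[OF c(1,2,3) d(1,2,3) b_def]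
  have "r \<oplus>\<^bsub>S\<^esub> r' = finsum S b (F \<union> G)" using b(2)[of UNIV] c(4) d(4) by simp
  also have "proj V \<dots> = finsum S b ((F \<union> G) \<inter> V)"
    by (rule proj_finsum) (use c d b(1) in auto)
  finally show ?thesis using b(2) proj_finsum c d by simp
qed

lemma proj_component:
  assumes "\<gamma> \<in> carrier \<Gamma>" "r \<in> A \<gamma>"
  shows "proj V r = (if \<gamma> \<in> V then r else \<zero>\<^bsub>S\<^esub>)"
proof -
  have r: "r \<in> carrier S" using assms component_carrier by auto
  have "proj V (finsum S (\<lambda>_. r) {\<gamma>}) = finsum S (\<lambda>_. r) ({\<gamma>} \<inter> V)"
    by (rule proj_finsum) (use assms in auto)
  then show ?thesis using r by auto
qed

lemma proj_part:
  assumes "r \<in> part W" "W \<subseteq> carrier \<Gamma>"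
  shows "proj V r \<in> part (W \<inter> V)"
proof -
  obtain c F where c: "finite F" "F \<subseteq> W" "\<And>\<gamma>. \<gamma> \<in> F \<Longrightarrow> c \<gamma> \<in> A \<gamma>" "r = finsum S c F"
    by (rule partE[OF assms(1)]) blast
  have "proj V r = finsum S c (F \<inter> V)"
    unfolding c(4) by (rule proj_finsum) (use c assms in auto)
  then show ?thesis using c by (auto intro!: partI)
qed

lemma proj_closed: "r \<in> carrier S \<Longrightarrow> proj V r \<in> part V"
  using proj_part[of r "carrier \<Gamma>" V] part_mono[of "carrier \<Gamma> \<inter> V" V] part_carrier by auto

lemma proj_zero: "proj V \<zero>\<^bsub>S\<^esub> = \<zero>\<^bsub>S\<^esub>"
  using proj_component[OF \<Gamma>.one_closed component_zero[OF \<Gamma>.one_closed]] by simp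

lemma carrier_induct [consumes 1, case_names zero component add]:
  assumes "r \<in> carrier S"
    and "P \<zero>\<^bsub>S\<^esub>" and "\<And>\<gamma> r. \<lbrakk>\<gamma> \<in> carrier \<Gamma>; r \<in> A \<gamma>\<rbrakk> \<Longrightarrow> P r"
    and "\<And>r r'. \<lbrakk>r \<in> carrier S; r' \<in> carrier S; P r; P r'\<rbrakk> \<Longrightarrow> P (r \<oplus>\<^bsub>S\<^esub> r')"
  shows "P r"
  using part_induct[of r "carrier \<Gamma>" P] assms part_carrier by auto

text \<open>For \<open>\<gamma> \<in> V\<close>, the degrees
  \<open>\<gamma> \<otimes> \<tau>\<close> and \<open>\<tau>\<close> lie in \<open>V\<close>
  together, so multiplication from the left by an element of degree \<open>\<gamma>\<close> respects
  the splitting into degrees inside and outside \<open>V\<close>.\<close>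

lemma proj_mult:
  assumes V: "subgroup V \<Gamma>" and r: "r \<in> part V" and r': "r' \<in> carrier S"
  shows "proj V (r \<otimes>\<^bsub>S\<^esub> r') = r \<otimes>\<^bsub>S\<^esub> proj V r'"
proof -
  interpret V: subgroup V \<Gamma> by (rule V)
  have Vc: "V \<subseteq> carrier \<Gamma>" by (rule V.subset)
  note pc = subsetD[OF part_subset[OF Vc]]
  have prc: "proj V r' \<in> carrier S" if "r' \<in> carrier S" for r'
    using pc proj_closed that by blast
  show ?thesis
    using r Vc
  proof (induction rule: part_induct)
    case zero
    show ?case using r' prc by (simp add: proj_zero)
  next
    case (component \<gamma> r)
    have rc: "r \<in> carrier S" using component Vc component_carrier by blast
    show ?case
      using r'
    proof (induction rule: carrier_induct)
      case zero
      show ?case using rc by (simp add: proj_zero)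
    next
      case (component \<tau> r')
      have \<gamma>: "\<gamma> \<in> carrier \<Gamma>" using \<open>\<gamma> \<in> V\<close> by simp
      have "inv\<^bsub>\<Gamma>\<^esub> \<gamma> \<otimes>\<^bsub>\<Gamma>\<^esub> (\<gamma> \<otimes>\<^bsub>\<Gamma>\<^esub> \<tau>) = \<tau>"
        using \<gamma> component(1) by (simp add: \<Gamma>.m_assoc[symmetric])
      then have iff: "\<gamma> \<otimes>\<^bsub>\<Gamma>\<^esub> \<tau> \<in> V \<longleftrightarrow> \<tau> \<in> V"
        using V.m_closed[OF V.m_inv_closed[OF \<open>\<gamma> \<in> V\<close>], of "\<gamma> \<otimes>\<^bsub>\<Gamma>\<^esub> \<tau>"] V.m_closed[OF \<open>\<gamma> \<in> V\<close>, of \<tau>]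
        by metis
      have "proj V (r \<otimes>\<^bsub>S\<^esub> r') = (if \<gamma> \<otimes>\<^bsub>\<Gamma>\<^esub> \<tau> \<in> V then r \<otimes>\<^bsub>S\<^esub> r' else \<zero>\<^bsub>S\<^esub>)"
        by (rule proj_component[OF \<Gamma>.m_closed[OF \<gamma> component(1)]
              component_mult[OF \<gamma> component(1) \<open>r \<in> A \<gamma>\<close> component(2)]])
      then show ?case
        using proj_component[OF component, of V] iff rc by simp
    next
      case (add r1 r2)
      then show ?case using rc prc by (simp add: S.r_distr proj_add)
    qed
  next
    case (add r1 r2)
    then show ?case using r' pc prc by (simp add: S.l_distr proj_add)
  qed
qed

text \<open>The half of strong grading that goes beyond a grading: \<open>\<one>\<close> lies in the
  product of \<open>A \<gamma>\<close> and \<open>A (inv \<gamma>)\<close>. In a group ring a single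
  product of group elements is enough; in general several are needed, hence the index
  \<open>k\<close>.\<close>

lemma component_one_expansion:
  assumes \<gamma>: "\<gamma> \<in> carrier \<Gamma>"
  obtains n :: nat and a b where "\<And>k. k < n \<Longrightarrow> a k \<in> A \<gamma>" "\<And>k. k < n \<Longrightarrow> b k \<in> A (inv\<^bsub>\<Gamma>\<^esub> \<gamma>)"
    "finsum S (\<lambda>k. a k \<otimes>\<^bsub>S\<^esub> b k) {..<n} = \<one>\<^bsub>S\<^esub>"
proof -
  \<comment> \<open>Generalised to every \<open>r\<close> in the product, so that induction along
    its inductive definition applies. A sum concatenates two families, the second one shifted by
    \<open>n1\<close>.\<close>
  have "\<exists>(n::nat) a b. (\<forall>k<n. a k \<in> A \<gamma> \<and> b k \<in> A (inv\<^bsub>\<Gamma>\<^esub> \<gamma>)) \<and>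
      finsum S (\<lambda>k. a k \<otimes>\<^bsub>S\<^esub> b k) {..<n} = r" if "r \<in> A \<gamma> \<cdot>\<^bsub>S\<^esub> A (inv\<^bsub>\<Gamma>\<^esub> \<gamma>)" for r
    using that
  proof (induction rule: ideal_prod.induct)
    case (prod i j)
    have "i \<in> carrier S" "j \<in> carrier S" using prod \<gamma> component_carrier by auto
    then have "finsum S (\<lambda>k. i \<otimes>\<^bsub>S\<^esub> j) {..<(1::nat)} = i \<otimes>\<^bsub>S\<^esub> j" by (simp add: lessThan_Suc)
    then show ?case using prod by (intro exI[of _ 1] exI[of _ "\<lambda>_. i"] exI[of _ "\<lambda>_. j"]) simp
  next
    case (sum r1 r2)
    from sum.IH(1) obtain n1 :: nat and a1 b1
      where 1: "\<forall>k<n1. a1 k \<in> A \<gamma> \<and> b1 k \<in> A (inv\<^bsub>\<Gamma>\<^esub> \<gamma>)"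
        "finsum S (\<lambda>k. a1 k \<otimes>\<^bsub>S\<^esub> b1 k) {..<n1} = r1" by (elim exE conjE)
    from sum.IH(2) obtain n2 :: nat and a2 b2
      where 2: "\<forall>k<n2. a2 k \<in> A \<gamma> \<and> b2 k \<in> A (inv\<^bsub>\<Gamma>\<^esub> \<gamma>)"
        "finsum S (\<lambda>k. a2 k \<otimes>\<^bsub>S\<^esub> b2 k) {..<n2} = r2" by (elim exE conjE)
    have cl: "a1 k \<otimes>\<^bsub>S\<^esub> b1 k \<in> carrier S" if "k < n1" for k
      using 1(1) that component_carrier[OF _ \<gamma>] component_carrier[OF _ \<Gamma>.inv_closed[OF \<gamma>]] by blast
    have cl2: "a2 k \<otimes>\<^bsub>S\<^esub> b2 k \<in> carrier S" if "k < n2" for k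
      using 2(1) that component_carrier[OF _ \<gamma>] component_carrier[OF _ \<Gamma>.inv_closed[OF \<gamma>]] by blast
    define a where "a k = (if k < n1 then a1 k else a2 (k - n1))" for k
    define b where "b k = (if k < n1 then b1 k else b2 (k - n1))" for k
    have split: "{..<n1 + n2} = {..<n1} \<union> (\<lambda>k. k + n1) ` {..<n2}"
    proof (intro equalityI subsetI)
      fix k assume "k \<in> {..<n1 + n2}"
      then show "k \<in> {..<n1} \<union> (\<lambda>k. k + n1) ` {..<n2}"
        by (cases "k < n1") (auto intro!: image_eqI[of _ _ "k - n1"])
    qed auto
    have "finsum S (\<lambda>k. a k \<otimes>\<^bsub>S\<^esub> b k) {..<n1 + n2} = finsum S (\<lambda>k. a k \<otimes>\<^bsub>S\<^esub> b k) {..<n1}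
        \<oplus>\<^bsub>S\<^esub> finsum S (\<lambda>k. a k \<otimes>\<^bsub>S\<^esub> b k) ((\<lambda>k. k + n1) ` {..<n2})"
      unfolding split by (rule S.finsum_Un_disjoint) (use cl cl2 in \<open>auto simp: a_def b_def\<close>)
    also have "finsum S (\<lambda>k. a k \<otimes>\<^bsub>S\<^esub> b k) {..<n1} = r1"
      unfolding 1(2)[symmetric]
      by (rule S.finsum_cong') (use cl in \<open>auto simp: a_def b_def\<close>)
    also have "finsum S (\<lambda>k. a k \<otimes>\<^bsub>S\<^esub> b k) ((\<lambda>k. k + n1) ` {..<n2})
        = finsum S (\<lambda>k. a (k + n1) \<otimes>\<^bsub>S\<^esub> b (k + n1)) {..<n2}"
      by (rule S.finsum_reindex) (use cl2 in \<open>auto simp: a_def b_def\<close>)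
    also have "\<dots> = r2"
      unfolding 2(2)[symmetric]
      by (rule S.finsum_cong') (use cl2 in \<open>auto simp: a_def b_def\<close>)
    finally show ?case
      using 1(1) 2(1) by (intro exI[of _ "n1 + n2"] exI[of _ a] exI[of _ b]) (auto simp: a_def b_def)
  qed
  moreover have "\<one>\<^bsub>S\<^esub> \<in> A \<gamma> \<cdot>\<^bsub>S\<^esub> A (inv\<^bsub>\<Gamma>\<^esub> \<gamma>)"
    using strongly_graded[OF \<gamma> \<Gamma>.inv_closed[OF \<gamma>]] one_component \<gamma> by simp
  ultimately show ?thesis using that by blast
qed

end

section \<open>Change of the base ring\<close>

text \<open>Transitivity of dual bases: \<open>b\<close> and \<open>\<phi>\<close> form a dual basis
  of the ring over \<open>C\<close>, and each coordinate \<open>s m j\<close> is expanded along it.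
  The \<open>b y\<close> may lie outside \<open>T\<close>; they act on \<open>x j\<close> because
  \<open>M\<close> is a module over all of \<open>R\<close>.\<close>

lemma (in ring) dual_basis_change_of_rings:
  fixes M :: "('a, 'm, 'y) module_scheme" and Y :: "'k set"
  assumes M: "left_module R M" and T: "subring T R" and C: "subring C R" "C \<subseteq> T"
    and db: "dual_basis (R\<lparr>carrier := T\<rparr>) M J x s" and b: "b \<in> Y \<rightarrow> carrier R"
    and \<phi>: "\<And>r. r \<in> carrier R \<Longrightarrow> \<phi> r \<in> carrier (free_left_module (R\<lparr>carrier := C\<rparr>) Y)"
    and \<phi>_add: "\<And>r r' y. \<lbrakk>r \<in> carrier R; r' \<in> carrier R\<rbrakk> \<Longrightarrow> \<phi> (r \<oplus> r') y = \<phi> r y \<oplus> \<phi> r' y"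
    and \<phi>_mult: "\<And>r r' y. \<lbrakk>r \<in> C; r' \<in> carrier R\<rbrakk> \<Longrightarrow> \<phi> (r \<otimes> r') y = r \<otimes> \<phi> r' y"
    and \<phi>_sum: "\<And>r. r \<in> carrier R \<Longrightarrow> finsum R (\<lambda>y. \<phi> r y \<otimes> b y) {y. \<phi> r y \<noteq> \<zero>} = r"
  shows "dual_basis (R\<lparr>carrier := C\<rparr>) M (J \<times> Y) (\<lambda>(j, y). b y \<odot>\<^bsub>M\<^esub> x j) (\<lambda>m (j, y). \<phi> (s m j) y)"
proof -
  interpret M: left_module R M by (rule M)
  let ?s = "\<lambda>m (j, y). \<phi> (s m j) y" and ?x = "\<lambda>(j, y). b y \<odot>\<^bsub>M\<^esub> x j"
  let ?C = "R\<lparr>carrier := C\<rparr>"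
  have Tc: "T \<subseteq> carrier R" and Cc: "C \<subseteq> carrier R" using T C subringE(1) by blast+
  have x: "x j \<in> carrier M" if "j \<in> J" for j using db that by (auto simp: dual_basis_def)
  have s: "s \<in> left_module_hom (R\<lparr>carrier := T\<rparr>) M (free_left_module (R\<lparr>carrier := T\<rparr>) J)"
    and eq: "\<And>m. m \<in> carrier M \<Longrightarrow> free_left_module_lift R M x (s m) = m"
    using db by (auto simp: dual_basis_def)
  have sm: "s m j \<in> carrier R" "j \<notin> J \<Longrightarrow> s m j = \<zero>" "finite {j. s m j \<noteq> \<zero>}" if "m \<in> carrier M" for m j
    using left_module_hom_closed[OF s that] Tc by (auto simp: free_left_module_carrier)
  have \<phi>r: "\<phi> r y \<in> C" "y \<notin> Y \<Longrightarrow> \<phi> r y = \<zero>" "finite {y. \<phi> r y \<noteq> \<zero>}" if "r \<in> carrier R" for r y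
    using \<phi>[OF that] by (simp_all add: free_left_module_carrier)
  have \<phi>0: "\<phi> \<zero> y = \<zero>" for y
  proof -
    have "\<phi> \<zero> y \<in> carrier R" using \<phi>r(1)[of \<zero> y] Cc by auto
    then show ?thesis using \<phi>_mult[of \<zero> \<zero> y] subringE(2)[OF C(1)] by simp
  qed
  have supp: "{p. ?s m p \<noteq> \<zero>} = Sigma {j. s m j \<noteq> \<zero>} (\<lambda>j. {y. \<phi> (s m j) y \<noteq> \<zero>})" for m
    using \<phi>0 by auto
  show ?thesis
    unfolding dual_basis_def
  proof (intro conjI ballI left_module_homI)
    show "?x \<in> J \<times> Y \<rightarrow> carrier M" using x b by auto
    fix m assume m: "m \<in> carrier M"
    have "finite {p. ?s m p \<noteq> \<zero>}"
      unfolding supp using sm[OF m] \<phi>r by (intro finite_SigmaI) auto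
    moreover have "?s m p \<in> C" for p using \<phi>r(1) sm(1)[OF m] by (cases p) simp
    moreover have "?s m p = \<zero>" if "p \<notin> J \<times> Y" for p
      using that \<phi>r(2) sm(1,2)[OF m] \<phi>0 by (cases p) auto
    ultimately show "?s m \<in> carrier (free_left_module ?C (J \<times> Y))"
      by (simp add: free_left_module_carrier)
    have F: "finite {j. s m j \<noteq> \<zero>}" "\<And>j. s m j \<noteq> \<zero> \<Longrightarrow> j \<in> J"
      using sm[OF m] by auto
    have \<phi>c: "\<phi> (s m j) y \<in> carrier R" "\<phi> (s m j) y \<noteq> \<zero> \<Longrightarrow> b y \<in> carrier R" for j y
      using \<phi>r(1,2)[OF sm(1)[OF m]] Cc b by auto
    have "free_left_module_lift ?C M ?x (?s m)
        = finsum M (\<lambda>p. ?s m p \<odot>\<^bsub>M\<^esub> ?x p) (Sigma {j. s m j \<noteq> \<zero>} (\<lambda>j. {y. \<phi> (s m j) y \<noteq> \<zero>}))"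
      using supp[of m] by (simp add: free_left_module_lift_def)
    also have "\<dots> = finsum M (\<lambda>j. finsum M (\<lambda>y. \<phi> (s m j) y \<odot>\<^bsub>M\<^esub> (b y \<odot>\<^bsub>M\<^esub> x j)) {y. \<phi> (s m j) y \<noteq> \<zero>})
        {j. s m j \<noteq> \<zero>}"
      using M.M.finsum_Sigma[of "{j. s m j \<noteq> \<zero>}" "\<lambda>j. {y. \<phi> (s m j) y \<noteq> \<zero>}" "\<lambda>p. ?s m p \<odot>\<^bsub>M\<^esub> ?x p"]
        F \<phi>r(3)[OF sm(1)[OF m]] \<phi>c x by simp
    also have "\<dots> = finsum M (\<lambda>j. s m j \<odot>\<^bsub>M\<^esub> x j) {j. s m j \<noteq> \<zero>}"
    proof (rule M.M.finsum_cong')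
      fix j assume "j \<in> {j. s m j \<noteq> \<zero>}"
      then have xj: "x j \<in> carrier M" using x F by auto
      have "finsum M (\<lambda>y. \<phi> (s m j) y \<odot>\<^bsub>M\<^esub> (b y \<odot>\<^bsub>M\<^esub> x j)) {y. \<phi> (s m j) y \<noteq> \<zero>}
          = finsum M (\<lambda>y. (\<phi> (s m j) y \<otimes> b y) \<odot>\<^bsub>M\<^esub> x j) {y. \<phi> (s m j) y \<noteq> \<zero>}"
        by (rule M.M.finsum_cong') (use \<phi>c xj in \<open>auto simp: M.smult_assoc1\<close>)
      also have "\<dots> = finsum R (\<lambda>y. \<phi> (s m j) y \<otimes> b y) {y. \<phi> (s m j) y \<noteq> \<zero>} \<odot>\<^bsub>M\<^esub> x j"
        by (rule M.finsum_smult[symmetric]) (use \<phi>c xj \<phi>r(3)[OF sm(1)[OF m]] in auto)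
      finally show "finsum M (\<lambda>y. \<phi> (s m j) y \<odot>\<^bsub>M\<^esub> (b y \<odot>\<^bsub>M\<^esub> x j)) {y. \<phi> (s m j) y \<noteq> \<zero>} = s m j \<odot>\<^bsub>M\<^esub> x j"
        using \<phi>_sum[OF sm(1)[OF m]] by simp
    qed (use x F sm(1)[OF m] in auto)
    also have "\<dots> = m" using eq[OF m] by (simp add: free_left_module_lift_def)
    finally show "free_left_module_lift ?C M ?x (?s m) = m" .
  next
    fix m m' assume "m \<in> carrier M" "m' \<in> carrier M"
    then show "?s (m \<oplus>\<^bsub>M\<^esub> m') = ?s m \<oplus>\<^bsub>free_left_module ?C (J \<times> Y)\<^esub> ?s m'"
      using left_module_hom_add[OF s] sm(1) \<phi>_add
      by (intro ext) (simp add: free_left_module_add split: prod.split)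
  next
    fix r m assume "r \<in> carrier ?C" "m \<in> carrier M"
    then show "?s (r \<odot>\<^bsub>M\<^esub> m) = r \<odot>\<^bsub>free_left_module ?C (J \<times> Y)\<^esub> ?s m"
      using left_module_hom_smult[OF s, of r m] C(2) sm(1) \<phi>_mult
      by (intro ext) (auto simp add: free_left_module_smult split: prod.split)
  qed
qed

context strongly_graded_ring
begin

lemma finite_subset_part:
  assumes "finite Z" "Z \<subseteq> carrier S"
  shows "\<exists>E. finite E \<and> E \<subseteq> carrier \<Gamma> \<and> Z \<subseteq> part E"
  using assms
proof (induction Z rule: finite_induct)
  case (insert z Z)
  then obtain E where E: "finite E" "E \<subseteq> carrier \<Gamma>" "Z \<subseteq> part E" by auto
  have "z \<in> part (carrier \<Gamma>)" using insert.prems part_carrier by simp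
  then obtain F where F: "finite F" "F \<subseteq> carrier \<Gamma>" "z \<in> part F" by (rule part_finite_support)
  have "part E \<subseteq> part (E \<union> F)" "part F \<subseteq> part (E \<union> F)" by (intro part_mono; simp)+
  then have "insert z Z \<subseteq> part (E \<union> F)" using E(3) F(3) by auto
  then show ?case using E F by (intro exI[of _ "E \<union> F"]) auto
qed (auto intro: exI[of _ "{}"])

text \<open>
  For a right coset \<open>C\<close> with representative \<open>p C\<close>, the elements \<open>a C k\<close> and \<open>b C k\<close> decompose
  \<open>1\<close> in \<open>R\<^sub>g R\<^sub>h\<close>, where \<open>h = p C\<close> and \<open>g\<close> is its inverse.
\<close>

definition coset_data ::
    "'g set \<Rightarrow> ('g set \<Rightarrow> 'g) \<Rightarrow> ('g set \<Rightarrow> nat) \<Rightarrow> ('g set \<Rightarrow> nat \<Rightarrow> 'r) \<Rightarrow> ('g set \<Rightarrow> nat \<Rightarrow> 'r) \<Rightarrow> bool"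
  where "coset_data V p n a b \<longleftrightarrow> (\<forall>C \<in> rcosets\<^bsub>\<Gamma>\<^esub> V. p C \<in> carrier \<Gamma> \<and> V #>\<^bsub>\<Gamma>\<^esub> p C = C \<and>
    (\<forall>k < n C. a C k \<in> A (inv\<^bsub>\<Gamma>\<^esub> p C) \<and> b C k \<in> A (p C)) \<and>
    finsum S (\<lambda>k. a C k \<otimes>\<^bsub>S\<^esub> b C k) {..<n C} = \<one>\<^bsub>S\<^esub>)"

lemma coset_data_exists: "\<exists>p n a b. coset_data V p n a b"
proof -
  have "\<forall>C \<in> rcosets\<^bsub>\<Gamma>\<^esub> V. \<exists>p. p \<in> carrier \<Gamma> \<and> V #>\<^bsub>\<Gamma>\<^esub> p = C"
    by (auto simp: RCOSETS_def)
  then obtain p where p: "\<And>C. C \<in> rcosets\<^bsub>\<Gamma>\<^esub> V \<Longrightarrow> p C \<in> carrier \<Gamma>"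
    "\<And>C. C \<in> rcosets\<^bsub>\<Gamma>\<^esub> V \<Longrightarrow> V #>\<^bsub>\<Gamma>\<^esub> p C = C" by metis
  have "\<exists>n::nat. \<exists>a b. (\<forall>k < n. a k \<in> A (inv\<^bsub>\<Gamma>\<^esub> p C) \<and> b k \<in> A (p C)) \<and>
      finsum S (\<lambda>k. a k \<otimes>\<^bsub>S\<^esub> b k) {..<n} = \<one>\<^bsub>S\<^esub>" if C: "C \<in> rcosets\<^bsub>\<Gamma>\<^esub> V" for C
  proof -
    obtain n :: nat and a b where "\<And>k. k < n \<Longrightarrow> a k \<in> A (inv\<^bsub>\<Gamma>\<^esub> p C)"
      "\<And>k. k < n \<Longrightarrow> b k \<in> A (inv\<^bsub>\<Gamma>\<^esub> (inv\<^bsub>\<Gamma>\<^esub> p C))"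
      "finsum S (\<lambda>k. a k \<otimes>\<^bsub>S\<^esub> b k) {..<n} = \<one>\<^bsub>S\<^esub>"
      by (rule component_one_expansion[OF \<Gamma>.inv_closed[OF p(1)[OF C]]]) blast
    then show ?thesis using p(1)[OF C] by (intro exI[of _ n] exI[of _ a] exI[of _ b]) simp
  qed
  then obtain n :: "'g set \<Rightarrow> nat" and a b where "\<And>C. C \<in> rcosets\<^bsub>\<Gamma>\<^esub> V \<Longrightarrow>
      (\<forall>k < n C. a C k \<in> A (inv\<^bsub>\<Gamma>\<^esub> p C) \<and> b C k \<in> A (p C)) \<and>
      finsum S (\<lambda>k. a C k \<otimes>\<^bsub>S\<^esub> b C k) {..<n C} = \<one>\<^bsub>S\<^esub>" by metis
  then have "coset_data V p n a b" using p by (simp add: coset_data_def)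
  then show ?thesis by blast
qed

section \<open>Expansions along right cosets\<close>

context
  fixes V p n a b
  assumes V: "subgroup V \<Gamma>" and data: "coset_data V p n a b"
begin

lemma coset_dataD:
  assumes "C \<in> rcosets\<^bsub>\<Gamma>\<^esub> V"
  shows "p C \<in> carrier \<Gamma>" "V #>\<^bsub>\<Gamma>\<^esub> p C = C" "k < n C \<Longrightarrow> a C k \<in> A (inv\<^bsub>\<Gamma>\<^esub> p C)"
    "k < n C \<Longrightarrow> b C k \<in> A (p C)" "finsum S (\<lambda>k. a C k \<otimes>\<^bsub>S\<^esub> b C k) {..<n C} = \<one>\<^bsub>S\<^esub>"
    "k < n C \<Longrightarrow> a C k \<in> carrier S" "k < n C \<Longrightarrow> b C k \<in> carrier S"
proof -
  have *: "p C \<in> carrier \<Gamma>" "V #>\<^bsub>\<Gamma>\<^esub> p C = C" "k < n C \<Longrightarrow> a C k \<in> A (inv\<^bsub>\<Gamma>\<^esub> p C)"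
    "k < n C \<Longrightarrow> b C k \<in> A (p C)" "finsum S (\<lambda>k. a C k \<otimes>\<^bsub>S\<^esub> b C k) {..<n C} = \<one>\<^bsub>S\<^esub>" for k
    using data assms by (simp_all add: coset_data_def)
  then show "p C \<in> carrier \<Gamma>" "V #>\<^bsub>\<Gamma>\<^esub> p C = C" "k < n C \<Longrightarrow> a C k \<in> A (inv\<^bsub>\<Gamma>\<^esub> p C)"
    "k < n C \<Longrightarrow> b C k \<in> A (p C)" "finsum S (\<lambda>k. a C k \<otimes>\<^bsub>S\<^esub> b C k) {..<n C} = \<one>\<^bsub>S\<^esub>" by blast+
  show "k < n C \<Longrightarrow> a C k \<in> carrier S" "k < n C \<Longrightarrow> b C k \<in> carrier S"
    using component_carrier[OF *(3) \<Gamma>.inv_closed[OF *(1)]] component_carrier[OF *(4) *(1)] by blast+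
qed

lemma coset_eq_iff:
  assumes C: "C \<in> rcosets\<^bsub>\<Gamma>\<^esub> V" and g: "g \<in> carrier \<Gamma>"
  shows "g \<otimes>\<^bsub>\<Gamma>\<^esub> inv\<^bsub>\<Gamma>\<^esub> p C \<in> V \<longleftrightarrow> C = V #>\<^bsub>\<Gamma>\<^esub> g"
proof -
  note p = coset_dataD(1,2)[OF C]
  have "g \<otimes>\<^bsub>\<Gamma>\<^esub> inv\<^bsub>\<Gamma>\<^esub> p C \<in> V \<longleftrightarrow> g \<in> V #>\<^bsub>\<Gamma>\<^esub> p C"
    using subgroup.rcos_module[OF V \<Gamma>.group_axioms p(1) g] by simp
  also have "\<dots> \<longleftrightarrow> C = V #>\<^bsub>\<Gamma>\<^esub> g"
    using \<Gamma>.repr_independence[OF _ p(1) V, of g] \<Gamma>.rcos_self[OF g V] p(2) by auto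
  finally show ?thesis .
qed

lemma proj_closed': "r \<in> carrier S \<Longrightarrow> proj V r \<in> carrier S"
  using proj_closed[of r V] part_subset[OF subgroup.subset[OF V]] by auto

text \<open>The product has degree \<open>g \<otimes> inv p C\<close>, which lies in
  \<open>V\<close> exactly for the coset of \<open>g\<close>. Thus a homogeneous element sees one
  coset only.\<close>

lemma right_term:
  assumes C: "C \<in> rcosets\<^bsub>\<Gamma>\<^esub> V" and k: "k < n C" and g: "g \<in> carrier \<Gamma>" and r: "r \<in> A g"
  shows "proj V (r \<otimes>\<^bsub>S\<^esub> a C k) = (if C = V #>\<^bsub>\<Gamma>\<^esub> g then r \<otimes>\<^bsub>S\<^esub> a C k else \<zero>\<^bsub>S\<^esub>)"
  using proj_component[OF \<Gamma>.m_closed[OF g \<Gamma>.inv_closed[OF coset_dataD(1)[OF C]]]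
      component_mult[OF g \<Gamma>.inv_closed[OF coset_dataD(1)[OF C]] r coset_dataD(3)[OF C k]], of V]
    coset_eq_iff[OF C g] by simp

text \<open>The product has degree \<open>p C \<otimes> g\<close>. Passing to the inverse turns
  membership in \<open>V\<close> into the right coset relation, now for
  \<open>inv g\<close>.\<close>

lemma left_term:
  assumes C: "C \<in> rcosets\<^bsub>\<Gamma>\<^esub> V" and k: "k < n C" and g: "g \<in> carrier \<Gamma>" and r: "r \<in> A g"
  shows "proj V (b C k \<otimes>\<^bsub>S\<^esub> r) = (if C = V #>\<^bsub>\<Gamma>\<^esub> inv\<^bsub>\<Gamma>\<^esub> g then b C k \<otimes>\<^bsub>S\<^esub> r else \<zero>\<^bsub>S\<^esub>)"
proof -
  note p = coset_dataD(1)[OF C]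
  have inv: "inv\<^bsub>\<Gamma>\<^esub> (p C \<otimes>\<^bsub>\<Gamma>\<^esub> g) = inv\<^bsub>\<Gamma>\<^esub> g \<otimes>\<^bsub>\<Gamma>\<^esub> inv\<^bsub>\<Gamma>\<^esub> p C"
    using p g by (simp add: \<Gamma>.inv_mult_group)
  have "p C \<otimes>\<^bsub>\<Gamma>\<^esub> g \<in> V \<longleftrightarrow> inv\<^bsub>\<Gamma>\<^esub> (p C \<otimes>\<^bsub>\<Gamma>\<^esub> g) \<in> V"
    using subgroup.m_inv_closed[OF V, of "p C \<otimes>\<^bsub>\<Gamma>\<^esub> g"] subgroup.m_inv_closed[OF V, of "inv\<^bsub>\<Gamma>\<^esub> (p C \<otimes>\<^bsub>\<Gamma>\<^esub> g)"]
      \<Gamma>.inv_inv[OF \<Gamma>.m_closed[OF p g]] by metis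
  also have "\<dots> \<longleftrightarrow> C = V #>\<^bsub>\<Gamma>\<^esub> inv\<^bsub>\<Gamma>\<^esub> g"
    unfolding inv by (rule coset_eq_iff[OF C \<Gamma>.inv_closed[OF g]])
  finally show ?thesis
    using proj_component[OF \<Gamma>.m_closed[OF p g] component_mult[OF p g coset_dataD(4)[OF C k] r], of V]
    by simp
qed

text \<open>\<open>V\<close> may have infinite index, so the sum runs over finite sets of cosets.
  Admitting every finite superset of \<open>\<D>\<close> makes the claim additive in
  \<open>r\<close>, since the sets belonging to two summands can be united. For homogeneous
  \<open>r\<close> one coset contributes, and \<open>\<Sum> a b = \<one>\<close> recovers
  \<open>r\<close>.\<close>

lemma right_coset_expansion:
  assumes "r \<in> carrier S"
  shows "\<exists>\<D>. finite \<D> \<and> \<D> \<subseteq> rcosets\<^bsub>\<Gamma>\<^esub> V \<and>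
    (\<forall>C \<in> rcosets\<^bsub>\<Gamma>\<^esub> V - \<D>. \<forall>k < n C. proj V (r \<otimes>\<^bsub>S\<^esub> a C k) = \<zero>\<^bsub>S\<^esub>) \<and>
    (\<forall>\<E>. finite \<E> \<longrightarrow> \<D> \<subseteq> \<E> \<longrightarrow> \<E> \<subseteq> rcosets\<^bsub>\<Gamma>\<^esub> V \<longrightarrow>
      finsum S (\<lambda>(C, k). proj V (r \<otimes>\<^bsub>S\<^esub> a C k) \<otimes>\<^bsub>S\<^esub> b C k) (Sigma \<E> (\<lambda>C. {..<n C})) = r)"
  using assms
proof (induction rule: carrier_induct)
  case zero
  have "proj V (\<zero>\<^bsub>S\<^esub> \<otimes>\<^bsub>S\<^esub> a C k) = \<zero>\<^bsub>S\<^esub>" if "C \<in> rcosets\<^bsub>\<Gamma>\<^esub> V" "k < n C" for C k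
    using coset_dataD(6)[OF that] by (simp add: proj_zero)
  moreover from this have "finsum S (\<lambda>(C, k). proj V (\<zero>\<^bsub>S\<^esub> \<otimes>\<^bsub>S\<^esub> a C k) \<otimes>\<^bsub>S\<^esub> b C k) (Sigma \<E> (\<lambda>C. {..<n C})) = \<zero>\<^bsub>S\<^esub>"
    if "\<E> \<subseteq> rcosets\<^bsub>\<Gamma>\<^esub> V" for \<E>
    by (intro S.add.finprod_one_eqI) (use that coset_dataD(7) in \<open>auto simp: subset_eq\<close>)
  ultimately show ?case by (intro exI[of _ "{}"]) simp
next
  case (component g r)
  let ?C = "V #>\<^bsub>\<Gamma>\<^esub> g"
  have rc: "r \<in> carrier S" using component component_carrier by auto
  have C: "?C \<in> rcosets\<^bsub>\<Gamma>\<^esub> V"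
    by (rule \<Gamma>.rcosetsI[OF subgroup.subset[OF V] component(1)])
  have "finsum S (\<lambda>(C, k). proj V (r \<otimes>\<^bsub>S\<^esub> a C k) \<otimes>\<^bsub>S\<^esub> b C k) (Sigma \<E> (\<lambda>C. {..<n C})) = r"
    if \<E>: "finite \<E>" "{?C} \<subseteq> \<E>" "\<E> \<subseteq> rcosets\<^bsub>\<Gamma>\<^esub> V" for \<E>
  proof -
    have E: "C \<in> rcosets\<^bsub>\<Gamma>\<^esub> V" if "C \<in> \<E>" for C using that \<E> by auto
    have "finsum S (\<lambda>(C, k). proj V (r \<otimes>\<^bsub>S\<^esub> a C k) \<otimes>\<^bsub>S\<^esub> b C k) (Sigma \<E> (\<lambda>C. {..<n C}))
        = finsum S (\<lambda>(C, k). r \<otimes>\<^bsub>S\<^esub> (a C k \<otimes>\<^bsub>S\<^esub> b C k)) (Sigma {?C} (\<lambda>C. {..<n C}))"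
    proof (rule S.add.finprod_mono_neutral_cong_right)
      show "Sigma {?C} (\<lambda>C. {..<n C}) \<subseteq> Sigma \<E> (\<lambda>C. {..<n C})" using \<E>(2) by auto
      fix q assume "q \<in> Sigma \<E> (\<lambda>C. {..<n C}) - Sigma {?C} (\<lambda>C. {..<n C})"
      then obtain C k where q: "q = (C, k)" "C \<in> \<E>" "k < n C" "C \<noteq> ?C" by auto
      then show "(case q of (C, k) \<Rightarrow> proj V (r \<otimes>\<^bsub>S\<^esub> a C k) \<otimes>\<^bsub>S\<^esub> b C k) = \<zero>\<^bsub>S\<^esub>"
        using right_term[OF E[OF q(2)] q(3) component] coset_dataD(7)[OF E[OF q(2)] q(3)] by simp
    next
      fix q assume "q \<in> Sigma {?C} (\<lambda>C. {..<n C})"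
      then obtain k where q: "q = (?C, k)" "k < n ?C" by auto
      then show "(case q of (C, k) \<Rightarrow> proj V (r \<otimes>\<^bsub>S\<^esub> a C k) \<otimes>\<^bsub>S\<^esub> b C k) =
          (case q of (C, k) \<Rightarrow> r \<otimes>\<^bsub>S\<^esub> (a C k \<otimes>\<^bsub>S\<^esub> b C k))"
        using right_term[OF C q(2) component] coset_dataD(6,7)[OF C q(2)] rc by (simp add: S.m_assoc)
    qed (use \<E> E coset_dataD(6,7) rc proj_closed' in auto)
    also have "\<dots> = finsum S (\<lambda>k. r \<otimes>\<^bsub>S\<^esub> (a ?C k \<otimes>\<^bsub>S\<^esub> b ?C k)) {..<n ?C}"
      using S.finsum_Sigma[of "{?C}" "\<lambda>C. {..<n C}" "\<lambda>(C, k). r \<otimes>\<^bsub>S\<^esub> (a C k \<otimes>\<^bsub>S\<^esub> b C k)"]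
        coset_dataD(6,7)[OF C] rc by (simp add: S.finsum_closed Pi_iff)
    also have "\<dots> = r \<otimes>\<^bsub>S\<^esub> finsum S (\<lambda>k. a ?C k \<otimes>\<^bsub>S\<^esub> b ?C k) {..<n ?C}"
      by (rule S.finsum_rdistr[symmetric]) (use coset_dataD(6,7)[OF C] rc in auto)
    also have "\<dots> = r" using coset_dataD(5)[OF C] rc by simp
    finally show ?thesis .
  qed
  moreover have "proj V (r \<otimes>\<^bsub>S\<^esub> a C k) = \<zero>\<^bsub>S\<^esub>" if "C \<in> rcosets\<^bsub>\<Gamma>\<^esub> V - {?C}" "k < n C" for C k
    using right_term[OF _ that(2) component] that(1) by simp
  ultimately show ?case using C by (intro exI[of _ "{?C}"]) simp
next
  case (add r r')
  from add.IH(1) obtain D where D: "finite D" "D \<subseteq> rcosets\<^bsub>\<Gamma>\<^esub> V"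
    "\<forall>C \<in> rcosets\<^bsub>\<Gamma>\<^esub> V - D. \<forall>k < n C. proj V (r \<otimes>\<^bsub>S\<^esub> a C k) = \<zero>\<^bsub>S\<^esub>"
    "\<forall>\<E>. finite \<E> \<longrightarrow> D \<subseteq> \<E> \<longrightarrow> \<E> \<subseteq> rcosets\<^bsub>\<Gamma>\<^esub> V \<longrightarrow>
      finsum S (\<lambda>(C, k). proj V (r \<otimes>\<^bsub>S\<^esub> a C k) \<otimes>\<^bsub>S\<^esub> b C k) (Sigma \<E> (\<lambda>C. {..<n C})) = r"
    by (elim exE conjE)
  from add.IH(2) obtain D' where D': "finite D'" "D' \<subseteq> rcosets\<^bsub>\<Gamma>\<^esub> V"
    "\<forall>C \<in> rcosets\<^bsub>\<Gamma>\<^esub> V - D'. \<forall>k < n C. proj V (r' \<otimes>\<^bsub>S\<^esub> a C k) = \<zero>\<^bsub>S\<^esub>"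
    "\<forall>\<E>. finite \<E> \<longrightarrow> D' \<subseteq> \<E> \<longrightarrow> \<E> \<subseteq> rcosets\<^bsub>\<Gamma>\<^esub> V \<longrightarrow>
      finsum S (\<lambda>(C, k). proj V (r' \<otimes>\<^bsub>S\<^esub> a C k) \<otimes>\<^bsub>S\<^esub> b C k) (Sigma \<E> (\<lambda>C. {..<n C})) = r'"
    by (elim exE conjE)
  have padd: "proj V ((r \<oplus>\<^bsub>S\<^esub> r') \<otimes>\<^bsub>S\<^esub> a C k) = proj V (r \<otimes>\<^bsub>S\<^esub> a C k) \<oplus>\<^bsub>S\<^esub> proj V (r' \<otimes>\<^bsub>S\<^esub> a C k)"
    if "C \<in> rcosets\<^bsub>\<Gamma>\<^esub> V" "k < n C" for C k
    using add(1,2) coset_dataD(6)[OF that] by (simp add: S.l_distr proj_add)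
  show ?case
  proof (intro exI[of _ "D \<union> D'"] conjI ballI allI impI)
    fix C k assume C: "C \<in> rcosets\<^bsub>\<Gamma>\<^esub> V - (D \<union> D')" and k: "k < n C"
    then have "proj V (r \<otimes>\<^bsub>S\<^esub> a C k) = \<zero>\<^bsub>S\<^esub>" "proj V (r' \<otimes>\<^bsub>S\<^esub> a C k) = \<zero>\<^bsub>S\<^esub>"
      using D(3) D'(3) by auto
    then show "proj V ((r \<oplus>\<^bsub>S\<^esub> r') \<otimes>\<^bsub>S\<^esub> a C k) = \<zero>\<^bsub>S\<^esub>" using padd[of C k] C k by simp
  next
    fix \<E> assume \<E>: "finite \<E>" "D \<union> D' \<subseteq> \<E>" "\<E> \<subseteq> rcosets\<^bsub>\<Gamma>\<^esub> V"
    have E: "C \<in> rcosets\<^bsub>\<Gamma>\<^esub> V" if "C \<in> \<E>" for C using that \<E> by auto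
    have "finsum S (\<lambda>(C, k). proj V ((r \<oplus>\<^bsub>S\<^esub> r') \<otimes>\<^bsub>S\<^esub> a C k) \<otimes>\<^bsub>S\<^esub> b C k) (Sigma \<E> (\<lambda>C. {..<n C}))
        = finsum S (\<lambda>q. (case q of (C, k) \<Rightarrow> proj V (r \<otimes>\<^bsub>S\<^esub> a C k) \<otimes>\<^bsub>S\<^esub> b C k)
            \<oplus>\<^bsub>S\<^esub> (case q of (C, k) \<Rightarrow> proj V (r' \<otimes>\<^bsub>S\<^esub> a C k) \<otimes>\<^bsub>S\<^esub> b C k)) (Sigma \<E> (\<lambda>C. {..<n C}))"
      by (rule S.finsum_cong')
         (use E coset_dataD(6,7) add(1,2) proj_closed' in \<open>auto simp: proj_add S.l_distr\<close>)
    also have "\<dots> = r \<oplus>\<^bsub>S\<^esub> r'"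
    proof (subst S.finsum_addf)
      show "(\<lambda>(C, k). proj V (r \<otimes>\<^bsub>S\<^esub> a C k) \<otimes>\<^bsub>S\<^esub> b C k) \<in> Sigma \<E> (\<lambda>C. {..<n C}) \<rightarrow> carrier S"
        "(\<lambda>(C, k). proj V (r' \<otimes>\<^bsub>S\<^esub> a C k) \<otimes>\<^bsub>S\<^esub> b C k) \<in> Sigma \<E> (\<lambda>C. {..<n C}) \<rightarrow> carrier S"
        using E coset_dataD(6,7) add(1,2) proj_closed' by auto
    qed (use D(4) D'(4) \<E> in simp)
    finally show "finsum S (\<lambda>(C, k). proj V ((r \<oplus>\<^bsub>S\<^esub> r') \<otimes>\<^bsub>S\<^esub> a C k) \<otimes>\<^bsub>S\<^esub> b C k)
        (Sigma \<E> (\<lambda>C. {..<n C})) = r \<oplus>\<^bsub>S\<^esub> r'" .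
  qed (use D D' in auto)
qed

text \<open>For \<open>r\<close> of degree \<open>g\<close> only the coset of \<open>inv g\<close>
  contributes, with value \<open>\<Sum> a b r = r\<close>. Finite index allows one fixed index set
  for all \<open>r\<close>.\<close>

lemma left_coset_expansion:
  assumes fin: "finite (rcosets\<^bsub>\<Gamma>\<^esub> V)" and "r \<in> carrier S"
  shows "finsum S (\<lambda>(C, k). a C k \<otimes>\<^bsub>S\<^esub> proj V (b C k \<otimes>\<^bsub>S\<^esub> r)) (Sigma (rcosets\<^bsub>\<Gamma>\<^esub> V) (\<lambda>C. {..<n C})) = r"
  using assms(2)
proof (induction rule: carrier_induct)
  case zero
  show ?case
    by (rule S.add.finprod_one_eqI) (use coset_dataD(6,7) proj_zero in auto)
next
  case (component g r)
  let ?C = "V #>\<^bsub>\<Gamma>\<^esub> inv\<^bsub>\<Gamma>\<^esub> g"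
  have rc: "r \<in> carrier S" using component component_carrier by auto
  have C: "?C \<in> rcosets\<^bsub>\<Gamma>\<^esub> V"
    by (rule \<Gamma>.rcosetsI[OF subgroup.subset[OF V] \<Gamma>.inv_closed[OF component(1)]])
  have "finsum S (\<lambda>(C, k). a C k \<otimes>\<^bsub>S\<^esub> proj V (b C k \<otimes>\<^bsub>S\<^esub> r)) (Sigma (rcosets\<^bsub>\<Gamma>\<^esub> V) (\<lambda>C. {..<n C}))
      = finsum S (\<lambda>(C, k). (a C k \<otimes>\<^bsub>S\<^esub> b C k) \<otimes>\<^bsub>S\<^esub> r) (Sigma {?C} (\<lambda>C. {..<n C}))"
  proof (rule S.add.finprod_mono_neutral_cong_right)
    show "Sigma {?C} (\<lambda>C. {..<n C}) \<subseteq> Sigma (rcosets\<^bsub>\<Gamma>\<^esub> V) (\<lambda>C. {..<n C})" using C by auto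
    fix q assume "q \<in> Sigma (rcosets\<^bsub>\<Gamma>\<^esub> V) (\<lambda>C. {..<n C}) - Sigma {?C} (\<lambda>C. {..<n C})"
    then obtain C k where q: "q = (C, k)" "C \<in> rcosets\<^bsub>\<Gamma>\<^esub> V" "k < n C" "C \<noteq> ?C" by auto
    then show "(case q of (C, k) \<Rightarrow> a C k \<otimes>\<^bsub>S\<^esub> proj V (b C k \<otimes>\<^bsub>S\<^esub> r)) = \<zero>\<^bsub>S\<^esub>"
      using left_term[OF q(2,3) component] coset_dataD(6)[OF q(2,3)] by simp
  next
    fix q assume "q \<in> Sigma {?C} (\<lambda>C. {..<n C})"
    then obtain k where q: "q = (?C, k)" "k < n ?C" by auto
    then show "(case q of (C, k) \<Rightarrow> a C k \<otimes>\<^bsub>S\<^esub> proj V (b C k \<otimes>\<^bsub>S\<^esub> r)) =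
        (case q of (C, k) \<Rightarrow> (a C k \<otimes>\<^bsub>S\<^esub> b C k) \<otimes>\<^bsub>S\<^esub> r)"
      using left_term[OF C q(2) component] coset_dataD(6,7)[OF C q(2)] rc by (simp add: S.m_assoc)
  qed (use fin coset_dataD(6,7) rc proj_closed' in auto)
  also have "\<dots> = finsum S (\<lambda>k. (a ?C k \<otimes>\<^bsub>S\<^esub> b ?C k) \<otimes>\<^bsub>S\<^esub> r) {..<n ?C}"
    using S.finsum_Sigma[of "{?C}" "\<lambda>C. {..<n C}" "\<lambda>(C, k). (a C k \<otimes>\<^bsub>S\<^esub> b C k) \<otimes>\<^bsub>S\<^esub> r"]
      coset_dataD(6,7)[OF C] rc by (simp add: S.finsum_closed Pi_iff)
  also have "\<dots> = finsum S (\<lambda>k. a ?C k \<otimes>\<^bsub>S\<^esub> b ?C k) {..<n ?C} \<otimes>\<^bsub>S\<^esub> r"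
    by (rule S.finsum_ldistr[symmetric]) (use coset_dataD(6,7)[OF C] rc in auto)
  also have "\<dots> = r" using coset_dataD(5)[OF C] rc by simp
  finally show ?case .
next
  case (add r r')
  let ?I = "Sigma (rcosets\<^bsub>\<Gamma>\<^esub> V) (\<lambda>C. {..<n C})"
  have padd: "proj V (b C k \<otimes>\<^bsub>S\<^esub> (r \<oplus>\<^bsub>S\<^esub> r')) = proj V (b C k \<otimes>\<^bsub>S\<^esub> r) \<oplus>\<^bsub>S\<^esub> proj V (b C k \<otimes>\<^bsub>S\<^esub> r')"
    if "C \<in> rcosets\<^bsub>\<Gamma>\<^esub> V" "k < n C" for C k
    using add(1,2) coset_dataD(7)[OF that] by (simp add: S.r_distr proj_add)
  have "finsum S (\<lambda>(C, k). a C k \<otimes>\<^bsub>S\<^esub> proj V (b C k \<otimes>\<^bsub>S\<^esub> (r \<oplus>\<^bsub>S\<^esub> r'))) ?I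
      = finsum S (\<lambda>q. (case q of (C, k) \<Rightarrow> a C k \<otimes>\<^bsub>S\<^esub> proj V (b C k \<otimes>\<^bsub>S\<^esub> r))
          \<oplus>\<^bsub>S\<^esub> (case q of (C, k) \<Rightarrow> a C k \<otimes>\<^bsub>S\<^esub> proj V (b C k \<otimes>\<^bsub>S\<^esub> r'))) ?I"
    by (rule S.finsum_cong')
       (use coset_dataD(6,7) add(1,2) proj_closed' in \<open>auto simp: proj_add S.r_distr\<close>)
  also have "\<dots> = r \<oplus>\<^bsub>S\<^esub> r'"
  proof (subst S.finsum_addf)
    show "(\<lambda>(C, k). a C k \<otimes>\<^bsub>S\<^esub> proj V (b C k \<otimes>\<^bsub>S\<^esub> r)) \<in> ?I \<rightarrow> carrier S"
      "(\<lambda>(C, k). a C k \<otimes>\<^bsub>S\<^esub> proj V (b C k \<otimes>\<^bsub>S\<^esub> r')) \<in> ?I \<rightarrow> carrier S"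
      using coset_dataD(6,7) add(1,2) proj_closed' by auto
  qed (simp add: add)
  finally show ?case .
qed

end
end

section \<open>Frobenius extensions and dual bases from cosets\<close>

context strongly_graded_ring
begin

text \<open>The \<open>u t\<close> and \<open>v t\<close> are homogeneous with degrees in the finite
  set \<open>E\<close> of coset representatives and their inverses. With \<open>E\<close> at hand,
  generators can be chosen so that the part over a finitely generated subgroup contains all of
  them.\<close>

lemma frobenius_extension_part:
  assumes H: "subgroup H \<Gamma>" and fin: "finite (rcosets\<^bsub>\<Gamma>\<^esub> H)"
  obtains I :: "('g set \<times> nat) set" and u v E where
    "frobenius_extension S (part H) (proj H) I u v" "finite E" "E \<subseteq> carrier \<Gamma>"
    "\<And>t. t \<in> I \<Longrightarrow> u t \<in> part E" "\<And>t. t \<in> I \<Longrightarrow> v t \<in> part E"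
proof -
  obtain p n a b where data: "coset_data H p n a b" using coset_data_exists by blast
  note D = coset_dataD[OF H data]
  define I where "I = Sigma (rcosets\<^bsub>\<Gamma>\<^esub> H) (\<lambda>C. {..<n C})"
  define E where "E = p ` (rcosets\<^bsub>\<Gamma>\<^esub> H) \<union> (\<lambda>C. inv\<^bsub>\<Gamma>\<^esub> p C) ` (rcosets\<^bsub>\<Gamma>\<^esub> H)"
  let ?u = "\<lambda>(C, k). a C k" and ?v = "\<lambda>(C, k). b C k"
  have Ec: "E \<subseteq> carrier \<Gamma>" using D(1) by (auto simp: E_def)
  have I: "C \<in> rcosets\<^bsub>\<Gamma>\<^esub> H" "k < n C" if "(C, k) \<in> I" for C k using that by (auto simp: I_def)
  have u: "?u t \<in> part E" if "t \<in> I" for t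
  proof -
    obtain C k where t: "t = (C, k)" by (cases t)
    have "a C k \<in> A (inv\<^bsub>\<Gamma>\<^esub> p C)" "inv\<^bsub>\<Gamma>\<^esub> p C \<in> E"
      using D(3) I that t by (auto simp: E_def)
    then show ?thesis using component_part[OF _ Ec] t by simp
  qed
  have v: "?v t \<in> part E" if "t \<in> I" for t
  proof -
    obtain C k where t: "t = (C, k)" by (cases t)
    have "b C k \<in> A (p C)" "p C \<in> E"
      using D(4) I that t by (auto simp: E_def)
    then show ?thesis using component_part[OF _ Ec] t by simp
  qed
  have "frobenius_extension S (part H) (proj H) I ?u ?v"
  proof (intro frobenius_extension.intro frobenius_extension_axioms.intro S.ring_axioms part_subring[OF H])
    show "finite I" using fin by (simp add: I_def)
    fix r assume r: "r \<in> carrier S"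
    show "proj H r \<in> part H" using r by (rule proj_closed)
    have "finsum S (\<lambda>t. ?u t \<otimes>\<^bsub>S\<^esub> proj H (?v t \<otimes>\<^bsub>S\<^esub> r)) I
        = finsum S (\<lambda>(C, k). a C k \<otimes>\<^bsub>S\<^esub> proj H (b C k \<otimes>\<^bsub>S\<^esub> r)) I"
      by (rule arg_cong[of _ _ "\<lambda>f. finsum S f I"]) auto
    then show "finsum S (\<lambda>t. ?u t \<otimes>\<^bsub>S\<^esub> proj H (?v t \<otimes>\<^bsub>S\<^esub> r)) I = r"
      using left_coset_expansion[OF H data fin r] by (simp add: I_def)
    have "finsum S (\<lambda>t. proj H (r \<otimes>\<^bsub>S\<^esub> ?u t) \<otimes>\<^bsub>S\<^esub> ?v t) I
        = finsum S (\<lambda>(C, k). proj H (r \<otimes>\<^bsub>S\<^esub> a C k) \<otimes>\<^bsub>S\<^esub> b C k) I"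
      by (rule arg_cong[of _ _ "\<lambda>f. finsum S f I"]) auto
    then show "finsum S (\<lambda>t. proj H (r \<otimes>\<^bsub>S\<^esub> ?u t) \<otimes>\<^bsub>S\<^esub> ?v t) I = r"
      using right_coset_expansion[OF H data r] fin unfolding I_def by auto
  next
    fix r r' assume "r \<in> part H" "r' \<in> carrier S"
    then show "proj H (r \<otimes>\<^bsub>S\<^esub> r') = r \<otimes>\<^bsub>S\<^esub> proj H r'" by (rule proj_mult[OF H])
  qed (use u v part_subset[OF Ec] proj_add in auto)
  then show ?thesis
    using that[OF _ _ Ec u v] fin by (simp add: E_def)
qed

text \<open>The expansion along the cosets of \<open>V\<close> in all of \<open>\<Gamma>\<close>,
  possibly infinitely many, provides coordinates of \<open>S\<close> over \<open>part V\<close>.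
  They are composed with the given dual basis; the case of interest is
  \<open>V = K \<inter> H\<close>.\<close>

lemma dual_basis_part:
  fixes M :: "('r, 'm, 'y) module_scheme" and J :: "'i set"
  assumes M: "left_module S M" and H: "subgroup H \<Gamma>" and V: "subgroup V \<Gamma>" "V \<subseteq> H"
    and db: "dual_basis (S\<lparr>carrier := part H\<rparr>) M J x s"
  shows "\<exists>(J' :: ('i \<times> 'g set \<times> nat) set) x' s'. dual_basis (S\<lparr>carrier := part V\<rparr>) M J' x' s'"
proof -
  obtain p n a b where data: "coset_data V p n a b" using coset_data_exists by blast
  note D = coset_dataD[OF V(1) data]
  let ?Y = "Sigma (rcosets\<^bsub>\<Gamma>\<^esub> V) (\<lambda>C. {..<n C})"
  define b' where "b' = (\<lambda>(C, k). b C k)"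
  \<comment> \<open>Elements of the free module vanish outside the index set, hence the default
    zero.\<close>
  define \<phi> where "\<phi> r y = (if y \<in> ?Y then proj V (r \<otimes>\<^bsub>S\<^esub> (case y of (C, k) \<Rightarrow> a C k)) else \<zero>\<^bsub>S\<^esub>)" for r y
  have \<phi>1: "\<phi> r (C, k) = proj V (r \<otimes>\<^bsub>S\<^esub> a C k)" if "C \<in> rcosets\<^bsub>\<Gamma>\<^esub> V" "k < n C" for r C k
    using that by (simp add: \<phi>_def)
  have \<phi>0: "\<phi> r y = \<zero>\<^bsub>S\<^esub>" if "y \<notin> ?Y" for r y
    using that by (simp add: \<phi>_def)
  have \<phi>V: "\<phi> r y \<in> part V" if "r \<in> carrier S" for r y
  proof (cases "y \<in> ?Y")
    case True
    then obtain C k where y: "y = (C, k)" "C \<in> rcosets\<^bsub>\<Gamma>\<^esub> V" "k < n C" by auto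
    then show ?thesis using \<phi>1 proj_closed D(6) that by simp
  qed (simp add: \<phi>0 part_zero)
  have \<phi>S: "\<phi> r y \<in> carrier S" if "r \<in> carrier S" for r y
    by (rule subsetD[OF part_subset[OF subgroup.subset[OF V(1)]] \<phi>V[OF that]])
  have main: "finite {y. \<phi> r y \<noteq> \<zero>\<^bsub>S\<^esub>} \<and> finsum S (\<lambda>y. \<phi> r y \<otimes>\<^bsub>S\<^esub> b' y) {y. \<phi> r y \<noteq> \<zero>\<^bsub>S\<^esub>} = r"
    if r: "r \<in> carrier S" for r
  proof -
    from right_coset_expansion[OF V(1) data r]
    obtain \<D> where \<D>: "finite \<D>" "\<D> \<subseteq> rcosets\<^bsub>\<Gamma>\<^esub> V"
      "\<forall>C \<in> rcosets\<^bsub>\<Gamma>\<^esub> V - \<D>. \<forall>k < n C. proj V (r \<otimes>\<^bsub>S\<^esub> a C k) = \<zero>\<^bsub>S\<^esub>"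
      and sum: "\<forall>\<E>. finite \<E> \<longrightarrow> \<D> \<subseteq> \<E> \<longrightarrow> \<E> \<subseteq> rcosets\<^bsub>\<Gamma>\<^esub> V \<longrightarrow>
        finsum S (\<lambda>(C, k). proj V (r \<otimes>\<^bsub>S\<^esub> a C k) \<otimes>\<^bsub>S\<^esub> b C k) (Sigma \<E> (\<lambda>C. {..<n C})) = r"
      by (elim exE conjE)
    have \<D>4: "finsum S (\<lambda>(C, k). proj V (r \<otimes>\<^bsub>S\<^esub> a C k) \<otimes>\<^bsub>S\<^esub> b C k) (Sigma \<D> (\<lambda>C. {..<n C})) = r"
      using sum \<D>(1,2) by simp
    have sub: "{y. \<phi> r y \<noteq> \<zero>\<^bsub>S\<^esub>} \<subseteq> Sigma \<D> (\<lambda>C. {..<n C})"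
      using \<D>(3) by (auto simp: \<phi>_def split: if_splits)
    have finD: "finite (Sigma \<D> (\<lambda>C. {..<n C}))" using \<D>(1) by simp
    have bS: "b' y \<in> carrier S" if "y \<in> Sigma \<D> (\<lambda>C. {..<n C})" for y
      using that \<D>(2) D(7) by (auto simp: b'_def)
    have "finsum S (\<lambda>y. \<phi> r y \<otimes>\<^bsub>S\<^esub> b' y) {y. \<phi> r y \<noteq> \<zero>\<^bsub>S\<^esub>}
        = finsum S (\<lambda>y. \<phi> r y \<otimes>\<^bsub>S\<^esub> b' y) (Sigma \<D> (\<lambda>C. {..<n C}))"
      by (rule S.add.finprod_mono_neutral_cong_left[OF finD sub])
         (use bS \<phi>S[OF r] in auto)
    also have "\<dots> = finsum S (\<lambda>(C, k). proj V (r \<otimes>\<^bsub>S\<^esub> a C k) \<otimes>\<^bsub>S\<^esub> b C k) (Sigma \<D> (\<lambda>C. {..<n C}))"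
    proof (rule S.finsum_cong')
      show "(\<lambda>(C, k). proj V (r \<otimes>\<^bsub>S\<^esub> a C k) \<otimes>\<^bsub>S\<^esub> b C k) \<in> Sigma \<D> (\<lambda>C. {..<n C}) \<rightarrow> carrier S"
        using \<D>(2) D(6,7) proj_closed'[OF V(1) data] r by auto
    qed (use \<D>(2) \<phi>1 in \<open>auto simp: b'_def\<close>)
    finally show ?thesis using \<D>4 finite_subset[OF sub finD] by simp
  qed
  have "dual_basis (S\<lparr>carrier := part V\<rparr>) M (J \<times> ?Y) (\<lambda>(j, y). b' y \<odot>\<^bsub>M\<^esub> x j) (\<lambda>m (j, y). \<phi> (s m j) y)"
  proof (rule S.dual_basis_change_of_rings[OF M part_subring[OF H] part_subring[OF V(1)] part_mono[OF V(2)] db])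
    show "b' \<in> ?Y \<rightarrow> carrier S" using D(7) by (auto simp: b'_def)
    fix r assume r: "r \<in> carrier S"
    show "\<phi> r \<in> carrier (free_left_module (S\<lparr>carrier := part V\<rparr>) ?Y)"
      using main[OF r] \<phi>V[OF r] \<phi>0 by (simp add: free_left_module_carrier)
    show "finsum S (\<lambda>y. \<phi> r y \<otimes>\<^bsub>S\<^esub> b' y) {y. \<phi> r y \<noteq> \<zero>\<^bsub>S\<^esub>} = r" using main[OF r] by blast
  next
    fix r r' y assume r: "r \<in> carrier S" "r' \<in> carrier S"
    show "\<phi> (r \<oplus>\<^bsub>S\<^esub> r') y = \<phi> r y \<oplus>\<^bsub>S\<^esub> \<phi> r' y"
    proof (cases "y \<in> ?Y")
      case True
      then obtain C k where y: "y = (C, k)" "C \<in> rcosets\<^bsub>\<Gamma>\<^esub> V" "k < n C" by auto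
      then show ?thesis using r D(6)[OF y(2,3)] by (simp add: \<phi>1 S.l_distr proj_add)
    qed (simp add: \<phi>0)
  next
    fix r r' y assume r: "r \<in> part V" "r' \<in> carrier S"
    have rS: "r \<in> carrier S" using r part_subset[OF subgroup.subset[OF V(1)]] by auto
    show "\<phi> (r \<otimes>\<^bsub>S\<^esub> r') y = r \<otimes>\<^bsub>S\<^esub> \<phi> r' y"
    proof (cases "y \<in> ?Y")
      case True
      then obtain C k where y: "y = (C, k)" "C \<in> rcosets\<^bsub>\<Gamma>\<^esub> V" "k < n C" by auto
      then show ?thesis using r rS D(6)[OF y(2,3)] proj_mult[OF V(1)] by (simp add: \<phi>1 S.m_assoc)
    qed (simp add: \<phi>0 rS)
  qed
  then show ?thesis by blast
qed

section \<open>Restriction of the grading to a subgroup\<close>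

text \<open>With \<open>K\<close> in the place of \<open>\<Gamma>\<close>, the conjecture speaks of
  a part of the ring \<open>graded_part S A K\<close>; here it is recognised as a subring of
  \<open>S\<close>.\<close>

lemma graded_part_graded_part:
  assumes K: "subgroup K \<Gamma>" and V: "V \<subseteq> K"
  shows "graded_part (graded_part S A K) A V = S\<lparr>carrier := part V\<rparr>"
proof -
  have Kc: "K \<subseteq> carrier \<Gamma>" by (rule subgroup.subset[OF K])
  interpret K: ring "S\<lparr>carrier := part K\<rparr>" by (rule S.subring_is_ring[OF part_subring[OF K]])
  have fs: "finsum (S\<lparr>carrier := part K\<rparr>) c F = finsum S c F" if "F \<subseteq> V" "\<forall>\<gamma> \<in> F. c \<gamma> \<in> A \<gamma>" for c F
    by (rule finsum_subgroup[OF S.abelian_group_axioms K.abelian_group_axioms part_subset[OF Kc]])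
       (use that V component_part[OF _ Kc] in auto)
  have "{finsum (S\<lparr>carrier := part K\<rparr>) c F | c F. finite F \<and> F \<subseteq> V \<and> (\<forall>\<gamma> \<in> F. c \<gamma> \<in> A \<gamma>)} = part V"
    (is "?L = _")
  proof (intro equalityI subsetI)
    fix r assume "r \<in> ?L"
    then obtain c F where c: "finite F" "F \<subseteq> V" "\<forall>\<gamma> \<in> F. c \<gamma> \<in> A \<gamma>" "r = finsum (S\<lparr>carrier := part K\<rparr>) c F"
      by blast
    then show "r \<in> part V" using partI[of F V c] by (simp add: fs)
  next
    fix r assume "r \<in> part V"
    then obtain c F where c: "finite F" "F \<subseteq> V" "\<And>\<gamma>. \<gamma> \<in> F \<Longrightarrow> c \<gamma> \<in> A \<gamma>" "r = finsum S c F"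
      by (rule partE) blast
    then have "r = finsum (S\<lparr>carrier := part K\<rparr>) c F" by (simp add: fs)
    then show "r \<in> ?L" using c(1-3) by blast
  qed
  then show ?thesis
    by (simp add: graded_part_def[of "S\<lparr>carrier := part K\<rparr>"] graded_part_eq[of K])
qed

lemma strongly_graded_ring_part:
  assumes K: "subgroup K \<Gamma>"
  shows "strongly_graded_ring (\<Gamma>\<lparr>carrier := K\<rparr>) R (graded_part S A K) A"
proof -
  have Kc: "K \<subseteq> carrier \<Gamma>" by (rule subgroup.subset[OF K])
  interpret K: ring "S\<lparr>carrier := part K\<rparr>" by (rule S.subring_is_ring[OF part_subring[OF K]])
  have fs: "finsum (S\<lparr>carrier := part K\<rparr>) c F = finsum S c F" if "F \<subseteq> K" "\<And>\<gamma>. \<gamma> \<in> F \<Longrightarrow> c \<gamma> \<in> A \<gamma>" for c F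
    by (rule finsum_subgroup[OF S.abelian_group_axioms K.abelian_group_axioms part_subset[OF Kc]])
       (use that component_part[OF _ Kc] in auto)
  \<comment> \<open>\<open>ideal_prod\<close> refers to the operations of the ring but not to its
    carrier.\<close>
  have prod: "B \<cdot>\<^bsub>S\<lparr>carrier := part K\<rparr>\<^esub> D = B \<cdot>\<^bsub>S\<^esub> D" for B D
  proof (intro equalityI subsetI)
    fix r assume "r \<in> B \<cdot>\<^bsub>S\<lparr>carrier := part K\<rparr>\<^esub> D"
    then show "r \<in> B \<cdot>\<^bsub>S\<^esub> D"
      by (induction rule: ideal_prod.induct) (auto intro: ideal_prod.intros)
  next
    fix r assume "r \<in> B \<cdot>\<^bsub>S\<^esub> D"
    then show "r \<in> B \<cdot>\<^bsub>S\<lparr>carrier := part K\<rparr>\<^esub> D"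
    proof (induction rule: ideal_prod.induct)
      case (prod i j)
      then show ?case using ideal_prod.prod[of i B j D "S\<lparr>carrier := part K\<rparr>"] by simp
    next
      case (sum r r')
      then show ?case using ideal_prod.sum[of r "S\<lparr>carrier := part K\<rparr>" B D r'] by simp
    qed
  qed
  have sub: "additive_subgroup (A \<gamma>) (S\<lparr>carrier := part K\<rparr>)" if \<gamma>: "\<gamma> \<in> K" for \<gamma>
  proof -
    have "A \<gamma> \<subseteq> part K" using component_part[OF \<gamma> Kc] by auto
    moreover have "subgroup (A \<gamma>) (add_monoid S)"
      using additive_subgroup.a_subgroup[OF component_subgroup] \<gamma> Kc by auto
    moreover have "subgroup (part K) (add_monoid S)"
      using part_subring[OF K] by (rule subring.axioms(1))
    ultimately have "subgroup (A \<gamma>) (add_monoid S\<lparr>carrier := part K\<rparr>)"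
      using S.add.subgroup_incl by blast
    then show ?thesis by (intro additive_subgroup.intro) simp
  qed
  have "strongly_graded_ring (\<Gamma>\<lparr>carrier := K\<rparr>) R (S\<lparr>carrier := part K\<rparr>) A"
  proof (intro strongly_graded_ring.intro strongly_graded_ring_axioms.intro
      subgroup.subgroup_is_group[OF K \<Gamma>.group_axioms] R.ring_axioms K.ring_axioms)
    show "carrier (graded_part (S\<lparr>carrier := part K\<rparr>) A (carrier (\<Gamma>\<lparr>carrier := K\<rparr>))) =
        carrier (S\<lparr>carrier := part K\<rparr>)"
      using graded_part_graded_part[OF K order_refl] by (simp add: graded_part_eq[of K])
  next
    fix F c \<gamma>
    assume "finite F" "F \<subseteq> carrier (\<Gamma>\<lparr>carrier := K\<rparr>)" "\<And>\<gamma>. \<gamma> \<in> F \<Longrightarrow> c \<gamma> \<in> A \<gamma>"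
      "finsum (S\<lparr>carrier := part K\<rparr>) c F = \<zero>\<^bsub>S\<lparr>carrier := part K\<rparr>\<^esub>" "\<gamma> \<in> F"
    then show "c \<gamma> = \<zero>\<^bsub>S\<lparr>carrier := part K\<rparr>\<^esub>"
      using components_independent[of F c \<gamma>] fs[of F c] Kc by auto
  next
    show "(\<lambda>r. r) \<in> ring_hom R (S\<lparr>carrier := part K\<rparr>)"
      using base_operations base_component component_part[OF subgroup.one_closed[OF K] Kc]
      by (auto simp: ring_hom_def)
  next
    fix \<gamma> \<tau> assume "\<gamma> \<in> carrier (\<Gamma>\<lparr>carrier := K\<rparr>)" "\<tau> \<in> carrier (\<Gamma>\<lparr>carrier := K\<rparr>)"
    then show "A \<gamma> \<cdot>\<^bsub>S\<lparr>carrier := part K\<rparr>\<^esub> A \<tau> = A (\<gamma> \<otimes>\<^bsub>\<Gamma>\<lparr>carrier := K\<rparr>\<^esub> \<tau>)"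
      unfolding prod using strongly_graded[of \<gamma> \<tau>] subgroup.mem_carrier[OF K] by simp
  qed (use sub base_component in auto)
  then show ?thesis by (simp add: graded_part_eq[of K])
qed

end

section \<open>Passage to finitely generated subgroups\<close>

text \<open>Every coset of \<open>K \<inter> H\<close> in \<open>K\<close> is the intersection of
  \<open>K\<close> with a coset of \<open>H\<close>.\<close>

lemma (in group) finite_rcosets_subgroup:
  assumes K: "subgroup K G" and H: "subgroup H G" and fin: "finite (rcosets H)"
  shows "finite (rcosets\<^bsub>G\<lparr>carrier := K\<rparr>\<^esub> (K \<inter> H))"
proof (rule finite_subset)
  interpret K: subgroup K G by (rule K)
  show "rcosets\<^bsub>G\<lparr>carrier := K\<rparr>\<^esub> (K \<inter> H) \<subseteq> (\<lambda>C. C \<inter> K) ` (rcosets H)"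
  proof
    fix C assume "C \<in> rcosets\<^bsub>G\<lparr>carrier := K\<rparr>\<^esub> (K \<inter> H)"
    then obtain k where k: "k \<in> K" "C = (K \<inter> H) #> k" by (auto simp: RCOSETS_def)
    have "h \<in> K" if "h \<in> H" "h \<otimes> k \<in> K" for h
    proof -
      have "h = h \<otimes> k \<otimes> inv k"
        using that k subgroup.mem_carrier[OF H] by (simp add: m_assoc)
      then show ?thesis using K.m_closed[OF that(2) K.m_inv_closed[OF k(1)]] by simp
    qed
    then have "C = (H #> k) \<inter> K" using k by (auto simp: r_coset_def)
    moreover have "H #> k \<in> rcosets H" using k rcosetsI[OF subgroup.subset[OF H]] by auto
    ultimately show "C \<in> (\<lambda>C. C \<inter> K) ` (rcosets H)" by auto
  qed
qed (use fin in simp)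

text \<open>Orders and cyclic subgroups are the same in \<open>K\<close> and in \<open>G\<close>,
  and \<open>\<langle>x\<rangle> \<subseteq> K\<close> gives \<open>\<langle>x\<rangle> \<inter> (K
  \<inter> H) = \<langle>x\<rangle> \<inter> H\<close>.\<close>

lemma (in group) moore_condition_subgroup:
  assumes K: "subgroup K G" and cond: "moore_condition G H R"
  shows "moore_condition (G\<lparr>carrier := K\<rparr>) (K \<inter> H) R"
  unfolding moore_condition_def
proof (intro ballI impI)
  fix x assume "x \<in> carrier (G\<lparr>carrier := K\<rparr>)" "x \<noteq> \<one>\<^bsub>G\<lparr>carrier := K\<rparr>\<^esub>"
  then have x: "x \<in> K" "x \<in> carrier G" "x \<noteq> \<one>" using subgroup.mem_carrier[OF K] by auto
  have "generate (G\<lparr>carrier := K\<rparr>) {x} = generate G {x}"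
    using generate_consistent[of "{x}" K] K x by simp
  moreover have "generate G {x} \<subseteq> K"
    using generate_subgroup_incl[of "{x}" K] K x by simp
  moreover have "group.ord (G\<lparr>carrier := K\<rparr>) x = ord x"
    unfolding group.ord_def[OF subgroup.subgroup_is_group[OF K is_group]] ord_def
    by (simp add: nat_pow_def)
  ultimately show "generate (G\<lparr>carrier := K\<rparr>) {x} \<inter> (K \<inter> H) \<noteq> {\<one>\<^bsub>G\<lparr>carrier := K\<rparr>\<^esub>} \<or>
      group.ord (G\<lparr>carrier := K\<rparr>) x \<noteq> 0 \<and>
      add_pow R (group.ord (G\<lparr>carrier := K\<rparr>) x) \<one>\<^bsub>R\<^esub> \<in> Units R"
    using cond x by (simp add: moore_condition_def Int_assoc[symmetric] inf.absorb1)
qed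

theorem theorem1p2:
  fixes G :: "('g, 'x) monoid_scheme"
  assumes "group G"
    and "\<And>K. finitely_generated_subgroup G K \<Longrightarrow>
           moore_conjecture TYPE('r) TYPE('m) (G\<lparr>carrier := K\<rparr>)"
  shows "moore_conjecture TYPE('r) TYPE('m) G"
  unfolding moore_conjecture_def moore_conjecture_for_def
proof (intro allI impI)
  interpret G: group G by fact
  fix R S :: "'r ring" and H A and M :: "('r, 'm) module"
  assume R: "ring R" and H: "subgroup H G" and fin: "finite (rcosets\<^bsub>G\<^esub> H)"
    and cond: "moore_condition G H R" and graded: "strongly_graded_ring G R S A"
    and M: "left_module S M" and proj: "projective_module (graded_part S A H) M"
  interpret strongly_graded_ring G R S A by (rule graded)
  obtain I :: "('g set \<times> nat) set" and u v E
    where frob: "frobenius_extension S (part H) (local.proj H) I u v"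
      and E: "finite E" "E \<subseteq> carrier G"
      and uE: "\<And>t. t \<in> I \<Longrightarrow> u t \<in> part E" and vE: "\<And>t. t \<in> I \<Longrightarrow> v t \<in> part E"
    by (rule frobenius_extension_part[OF H fin]) blast
  \<comment> \<open>Stated for every module \<open>Q\<close> of the given type, because the
    countable reduction replaces \<open>M\<close> by subquotients.\<close>
  have fg: "projective_module (S\<lparr>carrier := part K\<rparr>) Q"
    if Q: "left_module S Q" and db: "dual_basis (S\<lparr>carrier := part H\<rparr>) Q J x s"
      and K: "finitely_generated_subgroup G K"
    for Q :: "('r, 'm) module" and J :: "'m set" and x s K
  proof -
    have Ks: "subgroup K G"
      using K G.generate_is_subgroup by (auto simp: finitely_generated_subgroup_def)
    have KH: "subgroup (K \<inter> H) G" by (rule G.subgroups_Inter_pair[OF Ks H])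
    have "subgroup (K \<inter> H) (G\<lparr>carrier := K\<rparr>)"
      by (rule G.subgroup_incl[OF KH Ks]) simp
    then have conj: "moore_conjecture_for TYPE('m) (G\<lparr>carrier := K\<rparr>) (K \<inter> H) R"
      using assms(2)[OF K] R G.finite_rcosets_subgroup[OF Ks H fin] by (simp add: moore_conjecture_def)
    have mod: "left_module (graded_part S A K) Q"
      using left_module_subring[OF Q part_subring[OF Ks]] by (simp add: graded_part_eq[of K])
    have "projective_module (graded_part (graded_part S A K) A (K \<inter> H)) Q"
    proof -
      \<comment> \<open>The indices become triples, but projectivity over the smaller ring is a
        statement about \<open>Q\<close> alone, so the types in the hypothesis are
        respected.\<close>
      obtain J' :: "('m \<times> 'g set \<times> nat) set" and x' s'
        where "dual_basis (S\<lparr>carrier := part (K \<inter> H)\<rparr>) Q J' x' s'"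
        using dual_basis_part[OF Q H KH _ db] by auto
      then show ?thesis
        unfolding graded_part_graded_part[OF Ks Int_lower1]
        by (rule dual_basis_projective_module[OF left_module_subring[OF Q part_subring[OF KH]]])
    qed
    from conj[unfolded moore_conjecture_for_def, rule_format, OF G.moore_condition_subgroup[OF Ks cond]
        strongly_graded_ring_part[OF Ks] mod this]
    have "projective_module (graded_part S A K) Q" .
    then show ?thesis by (simp add: graded_part_eq[of K])
  qed
  have ctbl: "projective_module S Q"
    if Q: "left_module S Q" and db: "dual_basis (S\<lparr>carrier := part H\<rparr>) Q J x s" and J: "countable J"
    for Q :: "('r, 'm) module" and J :: "'m set" and x s
  proof -
    interpret Q: left_module S Q by (rule Q)
    note cc = frobenius_extension.coeff_closed[OF frob Q db]
    \<comment> \<open>All coefficients of the \<open>v t (x i)\<close>; a finite set, as there are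
      finitely many \<open>t\<close> and each element has finite support.\<close>
    define Z where "Z i = (\<Union>t \<in> I. range (s (v t \<odot>\<^bsub>Q\<^esub> x i)))" for i
    have vx: "v t \<odot>\<^bsub>Q\<^esub> x i \<in> carrier Q" if "t \<in> I" "i \<in> J" for t i
      using frobenius_extension.v_closed[OF frob that(1)] frobenius_extension.basis_closed[OF frob Q db that(2)]
      by simp
    have "\<exists>D. finite D \<and> D \<subseteq> carrier G \<and> Z i \<subseteq> part D" if i: "i \<in> J" for i
    proof (rule finite_subset_part)
      have "finite (range (s (v t \<odot>\<^bsub>Q\<^esub> x i)))" if t: "t \<in> I" for t
      proof (rule finite_subset)
        show "range (s (v t \<odot>\<^bsub>Q\<^esub> x i)) \<subseteq>
            insert \<zero>\<^bsub>S\<^esub> (s (v t \<odot>\<^bsub>Q\<^esub> x i) ` {j. s (v t \<odot>\<^bsub>Q\<^esub> x i) j \<noteq> \<zero>\<^bsub>S\<^esub>})" by auto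
        show "finite (insert \<zero>\<^bsub>S\<^esub> (s (v t \<odot>\<^bsub>Q\<^esub> x i) ` {j. s (v t \<odot>\<^bsub>Q\<^esub> x i) j \<noteq> \<zero>\<^bsub>S\<^esub>}))"
          using cc[OF vx[OF t i]] by (simp add: free_left_module_carrier)
      qed
      then show "finite (Z i)"
        using frobenius_extension.I_finite[OF frob] by (simp add: Z_def)
      show "Z i \<subseteq> carrier S"
        using cc[OF vx] i by (auto simp: Z_def free_left_module_carrier)
    qed
    then obtain D where D: "\<And>i. i \<in> J \<Longrightarrow> finite (D i)" "\<And>i. i \<in> J \<Longrightarrow> D i \<subseteq> carrier G"
      "\<And>i. i \<in> J \<Longrightarrow> Z i \<subseteq> part (D i)" by metis
    \<comment> \<open>The enumeration of \<open>J\<close> arranges the finite degree sets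
      \<open>D i\<close> in an increasing chain. \<open>E\<close> is included from the start, so
      that every \<open>part (K n)\<close> contains all \<open>u t\<close> and
      \<open>v t\<close>.\<close>
    define W where "W n = E \<union> (\<Union>i \<in> {i \<in> J. to_nat_on J i \<le> n}. D i)" for n
    define K where "K n = generate G (W n)" for n
    have "finite {i \<in> J. to_nat_on J i \<le> n}" for n
      using finite_vimage_IntI[OF finite_atMost inj_on_to_nat_on[OF J], of n]
      by (auto simp: vimage_def Int_def conj_commute)
    then have W: "finite (W n)" "W n \<subseteq> carrier G" for n
      using D E by (auto simp: W_def)
    have K: "finitely_generated_subgroup G (K n)" "subgroup (K n) G" for n
      using W[of n] G.generate_is_subgroup by (auto simp: finitely_generated_subgroup_def K_def)
    have WK: "W n \<subseteq> K n" for n by (auto simp: K_def intro: generate.incl)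
    show ?thesis
    proof (rule frobenius_extension.projective_module_chain[OF frob Q db, where C = "\<lambda>n. part (K n)"])
      fix n
      show "subring (part (K n)) S" by (rule part_subring[OF K(2)])
      have "W n \<subseteq> W (Suc n)" by (auto simp: W_def)
      then show "part (K n) \<subseteq> part (K (Suc n))"
        unfolding K_def by (intro part_mono G.mono_generate)
      have "part E \<subseteq> part (K n)" using WK[of n] by (intro part_mono) (auto simp: W_def)
      then show "u t \<in> part (K n)" "v t \<in> part (K n)" if "t \<in> I" for t
        using uE[OF that] vE[OF that] by blast+
      show "local.proj H r \<in> part (K n)" if "r \<in> part (K n)" for r
        using proj_part[OF that subgroup.subset[OF K(2)], of H] part_mono[of "K n \<inter> H" "K n"] by auto
      show "projective_module (S\<lparr>carrier := part (K n)\<rparr>) Q" by (rule fg[OF Q db K(1)])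
    next
      fix i assume i: "i \<in> J"
      have "D i \<subseteq> K (to_nat_on J i)" using i WK[of "to_nat_on J i"] by (auto simp: W_def)
      then have "Z i \<subseteq> part (K (to_nat_on J i))" using D(3)[OF i] part_mono by blast
      then show "\<exists>n. \<forall>t \<in> I. \<forall>j. s (v t \<odot>\<^bsub>Q\<^esub> x i) j \<in> part (K n)"
        by (intro exI[of _ "to_nat_on J i"]) (auto simp: Z_def)
    qed
  qed
  \<comment> \<open>The index set is the carrier of \<open>M\<close>, so the indices have type
    \<open>'m\<close>, as in \<open>ctbl\<close>.\<close>
  obtain s where "dual_basis (S\<lparr>carrier := part H\<rparr>) M (carrier M) (\<lambda>x. x) s"
    using projective_module_dual_basis[OF proj] by (auto simp: graded_part_eq[of H])
  then show "projective_module S M"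
    by (rule frobenius_extension.projective_module_from_countable[OF frob M _ ctbl])
qed

end
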